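(* Let $2\le p<4$ and $s<-(1-2/p)$. Then for any $M>0$ the following hold: (1) $\mathcal{S}_M\phi\in C([0,T_M];H^{s,p}(\mathbb{R}))$ for every $\phi\in\mathscr{B}^p_M$. (2) There exists $C_M>0$ such that $$\sup_{t\in[0,T_M]}\|\mathcal{S}_M\phi_1-\mathcal{S}_M\phi_2\|_{H^{s,p}(\mathbb{R})}\le C_M\|\phi_1-\phi_2\|_{L^p}$$ for any $\phi_1,\phi_2\in\mathscr{B}^p_M$.
   Context: $H^{s,p}(\mathbb{R})$ is the Bessel potential space. $\mathscr{B}^p_M=\{\phi\in L^p(\mathbb{R})\mid\|\phi\|_{L^p}\le M\}$. $U(t)=e^{it\partial_x^2}$ denotes the free Schrödinger group on $\mathbb{R}$ (acting on tempered distributions). Consider the Cauchy problem $iu_t+u_{xx}+|u|^2u=0$, $u|_{t=0}=\phi$, on $\mathbb{R}$; a solution is understood as a solution of the integral equation $u(t)=U(t)\phi+i\int_0^tU(t-s)|u(s)|^2u(s)\,ds$, equivalently, with $v(t)=U(-t)u(t)$, of $v(t)=\phi+i\int_0^tU(-s)\big[|U(s)v(s)|^2\,U(s)v(s)\big]ds$. For $T>0$, $1\le p,q<\infty$, $\theta\in\mathbb{R}$: $\tilde X^p_{q,\theta}(T)$ is the space of $v:[0,T]\times\mathbb{R}\to\mathbb{C}$ with $\|v\|_{\tilde X^p_{q,\theta}(T)}=\big(\int_0^T(s^\theta\|(\partial_sv)(s,\cdot)\|_{L^p})^q\,ds\big)^{1/q}<\infty$; $X^p_{q,\theta}(T)=\{v\in\tilde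 X^p_{q,\theta}(T)\mid v(0)\in L^p\}$ with norm $\|v(0)\|_{L^p}+\|v\|_{\tilde X^p_{q,\theta}(T)}$; and $Y^p_{q,\theta}(T)$ consists of $u:[0,T]\times\mathbb{R}\to\mathbb{C}$ such that $U(-t)u(t)\in X^p_{q,\theta}(T)$, with norm $\|u\|_{Y^p_{q,\theta}(T)}=\|U(-t)u(t)\|_{X^p_{q,\theta}(T)}$. Throughout $q=p'=\frac{p}{p-1}$ and $\theta=-(1-\frac2p)$. For $2\le p<4$ and $M>0$, $T_M>0$ is the local existence time from the well-posedness result of the paper: for every $\phi\in\mathscr{B}^p_M$ there is a unique solution in $Y^p_{q,\theta}(T_M)$, denoted $\mathcal{S}_M\phi$, and $\phi\mapsto\mathcal{S}_M\phi$ is Lipschitz from $\mathscr{B}^p_M$ to $Y^p_{q,\theta}(T_M)$. *)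

theory Defs
  imports "HOL-Analysis.Analysis"
begin

section \<open>Schwartz functions and tempered distributions on the line\<close>

definition nth_deriv :: "nat \<Rightarrow> (real \<Rightarrow> complex) \<Rightarrow> real \<Rightarrow> complex" where
  "nth_deriv n f = ((\<lambda>g x. vector_derivative g (at x)) ^^ n) f"

definition schwartz :: "(real \<Rightarrow> complex) set" where
  "schwartz = {f. (\<forall>n x. nth_deriv n f differentiable (at x)) \<and>
                  (\<forall>k n. bounded (range (\<lambda>x. \<bar>x\<bar> ^ k * norm (nth_deriv n f x))))}"

definition schwartz_seminorm :: "nat \<Rightarrow> nat \<Rightarrow> (real \<Rightarrow> complex) \<Rightarrow> real" where
  "schwartz_seminorm k n f = (SUP x. \<bar>x\<bar> ^ k * norm (nth_deriv n f x))"

type_synonym tdist = "(real \<Rightarrow> complex) \<Rightarrow> complex"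

text \<open>Distributions are functionals on all functions that vanish by convention outside the
  Schwartz space, so that equality of distributions is equality in HOL, and the pointwise difference
  of functions is the difference of distributions.\<close>

definition tempered :: "tdist set" where
  "tempered = {F. (\<forall>\<psi>. \<psi> \<notin> schwartz \<longrightarrow> F \<psi> = 0) \<and>
     (\<forall>\<psi>\<in>schwartz. \<forall>\<eta>\<in>schwartz. F (\<lambda>x. \<psi> x + \<eta> x) = F \<psi> + F \<eta>) \<and>
     (\<forall>\<psi>\<in>schwartz. \<forall>c. F (\<lambda>x. c * \<psi> x) = c * F \<psi>) \<and>
     (\<exists>C N. \<forall>\<psi>\<in>schwartz. norm (F \<psi>) \<le> C * (\<Sum>k\<le>N. \<Sum>n\<le>N. schwartz_seminorm k n \<psi>))}"

text \<open>Measurable functions integrable against every Schwartz function, i.e. the functions that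
  define a tempered distribution by integration.\<close>

definition tempered_fun :: "(real \<Rightarrow> complex) \<Rightarrow> bool" where
  "tempered_fun f \<longleftrightarrow> f \<in> borel_measurable lborel \<and>
     (\<forall>\<psi>\<in>schwartz. integrable lborel (\<lambda>x. f x * \<psi> x))"

definition td_of :: "(real \<Rightarrow> complex) \<Rightarrow> tdist" where
  "td_of f = (\<lambda>\<psi>. if \<psi> \<in> schwartz then (LINT x|lborel. f x * \<psi> x) else 0)"

definition td_is_fun :: "tdist \<Rightarrow> bool" where
  "td_is_fun F \<longleftrightarrow> (\<exists>f. tempered_fun f \<and> F = td_of f)"

text \<open>A representing function; it is unique up to null sets.\<close>

definition td_rep :: "tdist \<Rightarrow> real \<Rightarrow> complex" where
  "td_rep F = (SOME f. tempered_fun f \<and> F = td_of f)"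


section \<open>Fourier multipliers\<close>

definition fourier :: "(real \<Rightarrow> complex) \<Rightarrow> real \<Rightarrow> complex" where
  "fourier f \<xi> = (LINT x|lborel. cis (- (x * \<xi>)) * f x)"

definition fourier_inv :: "(real \<Rightarrow> complex) \<Rightarrow> real \<Rightarrow> complex" where
  "fourier_inv g x = complex_of_real (1 / (2 * pi)) * (LINT \<xi>|lborel. cis (x * \<xi>) * g \<xi>)"

definition td_fourier :: "tdist \<Rightarrow> tdist" where
  "td_fourier F = (\<lambda>\<psi>. if \<psi> \<in> schwartz then F (fourier \<psi>) else 0)"

definition td_fourier_inv :: "tdist \<Rightarrow> tdist" where
  "td_fourier_inv F = (\<lambda>\<psi>. if \<psi> \<in> schwartz then F (fourier_inv \<psi>) else 0)"

definition td_mult :: "(real \<Rightarrow> complex) \<Rightarrow> tdist \<Rightarrow> tdist" where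
  "td_mult m F = (\<lambda>\<psi>. if \<psi> \<in> schwartz then F (\<lambda>\<xi>. m \<xi> * \<psi> \<xi>) else 0)"

definition td_multiplier :: "(real \<Rightarrow> complex) \<Rightarrow> tdist \<Rightarrow> tdist" where
  "td_multiplier m F = td_fourier_inv (td_mult m (td_fourier F))"

text \<open>The free group $e^{it\partial_x^2}$ and the Bessel potential $(1-\partial_x^2)^{s/2}$.\<close>

definition schrodinger :: "real \<Rightarrow> tdist \<Rightarrow> tdist" where
  "schrodinger t = td_multiplier (\<lambda>\<xi>. cis (- (t * \<xi>\<^sup>2)))"

definition bessel :: "real \<Rightarrow> tdist \<Rightarrow> tdist" where
  "bessel s = td_multiplier (\<lambda>\<xi>. complex_of_real ((1 + \<xi>\<^sup>2) powr (s / 2)))"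


section \<open>Lebesgue and Bessel potential spaces\<close>

definition Lp :: "real \<Rightarrow> (real \<Rightarrow> complex) set" where
  "Lp p = {f. f \<in> borel_measurable lborel \<and> integrable lborel (\<lambda>x. norm (f x) powr p)}"

definition Lp_norm :: "real \<Rightarrow> (real \<Rightarrow> complex) \<Rightarrow> real" where
  "Lp_norm p f = (LINT x|lborel. norm (f x) powr p) powr (1 / p)"

definition Lp_ball :: "real \<Rightarrow> real \<Rightarrow> (real \<Rightarrow> complex) set" where
  "Lp_ball p M = {\<phi> \<in> Lp p. Lp_norm p \<phi> \<le> M}"

definition td_Lp :: "real \<Rightarrow> tdist set" where
  "td_Lp p = td_of ` Lp p"

definition td_Lp_norm :: "real \<Rightarrow> tdist \<Rightarrow> real" where
  "td_Lp_norm p F = Lp_norm p (td_rep F)"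

definition Hsp :: "real \<Rightarrow> real \<Rightarrow> tdist set" where
  "Hsp s p = {F \<in> tempered. bessel s F \<in> td_Lp p}"

definition Hsp_norm :: "real \<Rightarrow> real \<Rightarrow> tdist \<Rightarrow> real" where
  "Hsp_norm s p F = td_Lp_norm p (bessel s F)"

definition continuous_into_Hsp :: "real \<Rightarrow> real \<Rightarrow> real \<Rightarrow> (real \<Rightarrow> tdist) \<Rightarrow> bool" where
  "continuous_into_Hsp T s p u \<longleftrightarrow>
     (\<forall>t\<in>{0..T}. u t \<in> Hsp s p) \<and>
     (\<forall>t\<in>{0..T}. ((\<lambda>r. Hsp_norm s p (u r - u t)) \<longlongrightarrow> 0) (at t within {0..T}))"


section \<open>The spaces X and Y\<close>

text \<open>Functions of time on $[0,T]$ are taken with values in tempered distributions, because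
  $U(t)\phi$ with $\phi\in L^p$, $p>2$, need not be a function for every $t$. They vanish by
  convention outside $[0,T]$.\<close>

definition curves :: "real \<Rightarrow> (real \<Rightarrow> tdist) set" where
  "curves T = {v. (\<forall>t\<in>{0..T}. v t \<in> tempered) \<and> (\<forall>t. t \<notin> {0..T} \<longrightarrow> v t = (\<lambda>_. 0))}"

text \<open>The function \<open>w\<close> is the distributional time derivative of \<open>v\<close> on $(0,T)$. A curve with
  a derivative as in the definition of the spaces below is only determined for almost every time;
  as usual it is identified with its continuous representative, which gives a meaning to $v(0)$.\<close>

definition has_time_deriv ::
    "real \<Rightarrow> (real \<Rightarrow> tdist) \<Rightarrow> (real \<Rightarrow> real \<Rightarrow> complex) \<Rightarrow> bool" where
  "has_time_deriv T v w \<longleftrightarrow>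
     (\<lambda>(\<tau>, x). w \<tau> x) \<in> borel_measurable (lborel \<Otimes>\<^sub>M lborel) \<and>
     (AE \<tau> in lborel. \<tau> \<in> {0..T} \<longrightarrow> tempered_fun (w \<tau>)) \<and>
     (\<forall>\<psi>\<in>schwartz. continuous_on {0..T} (\<lambda>t. v t \<psi>) \<and>
        (\<forall>a b. 0 < a \<and> a \<le> b \<and> b \<le> T \<longrightarrow>
           set_integrable lborel {a..b} (\<lambda>\<tau>. td_of (w \<tau>) \<psi>) \<and>
           v b \<psi> - v a \<psi> = (LINT \<tau>:{a..b}|lborel. td_of (w \<tau>) \<psi>)))"

definition time_deriv :: "real \<Rightarrow> (real \<Rightarrow> tdist) \<Rightarrow> real \<Rightarrow> real \<Rightarrow> complex" where
  "time_deriv T v = (SOME w. has_time_deriv T v w)"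

definition Xtilde :: "real \<Rightarrow> real \<Rightarrow> real \<Rightarrow> real \<Rightarrow> (real \<Rightarrow> tdist) set" where
  "Xtilde p q \<theta> T = {v \<in> curves T. (\<forall>t\<in>{0..T}. td_is_fun (v t)) \<and>
     (\<exists>w. has_time_deriv T v w \<and>
        (AE \<tau> in lborel. \<tau> \<in> {0..T} \<longrightarrow> w \<tau> \<in> Lp p) \<and>
        set_integrable lborel {0..T} (\<lambda>\<tau>. (\<tau> powr \<theta> * Lp_norm p (w \<tau>)) powr q))}"

definition Xtilde_norm :: "real \<Rightarrow> real \<Rightarrow> real \<Rightarrow> real \<Rightarrow> (real \<Rightarrow> tdist) \<Rightarrow> real" where
  "Xtilde_norm p q \<theta> T v =
     (LINT \<tau>:{0..T}|lborel. (\<tau> powr \<theta> * Lp_norm p (time_deriv T v \<tau>)) powr q) powr (1 / q)"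

definition Xspace :: "real \<Rightarrow> real \<Rightarrow> real \<Rightarrow> real \<Rightarrow> (real \<Rightarrow> tdist) set" where
  "Xspace p q \<theta> T = {v \<in> Xtilde p q \<theta> T. v 0 \<in> td_Lp p}"

definition Xnorm :: "real \<Rightarrow> real \<Rightarrow> real \<Rightarrow> real \<Rightarrow> (real \<Rightarrow> tdist) \<Rightarrow> real" where
  "Xnorm p q \<theta> T v = td_Lp_norm p (v 0) + Xtilde_norm p q \<theta> T v"

definition pull_back :: "real \<Rightarrow> (real \<Rightarrow> tdist) \<Rightarrow> real \<Rightarrow> tdist" where
  "pull_back T u = (\<lambda>t. if t \<in> {0..T} then schrodinger (- t) (u t) else (\<lambda>_. 0))"

definition Yspace :: "real \<Rightarrow> real \<Rightarrow> real \<Rightarrow> real \<Rightarrow> (real \<Rightarrow> tdist) set" where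
  "Yspace p q \<theta> T = {u \<in> curves T. pull_back T u \<in> Xspace p q \<theta> T}"

definition Ynorm :: "real \<Rightarrow> real \<Rightarrow> real \<Rightarrow> real \<Rightarrow> (real \<Rightarrow> tdist) \<Rightarrow> real" where
  "Ynorm p q \<theta> T u = Xnorm p q \<theta> T (pull_back T u)"


section \<open>The cubic equation and its solution map\<close>

definition cubic_fun :: "(real \<Rightarrow> complex) \<Rightarrow> real \<Rightarrow> complex" where
  "cubic_fun f x = complex_of_real ((norm (f x))\<^sup>2) * f x"

definition cubic :: "tdist \<Rightarrow> tdist" where
  "cubic F = td_of (cubic_fun (td_rep F))"

text \<open>The Duhamel integral is the integral of a distribution-valued function: it is tested
  against Schwartz functions. The nonlinearity is required to make sense at almost every time.\<close>

definition integral_solution :: "real \<Rightarrow> (real \<Rightarrow> complex) \<Rightarrow> (real \<Rightarrow> tdist) \<Rightarrow> bool" where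
  "integral_solution T \<phi> u \<longleftrightarrow>
     (AE \<tau> in lborel. \<tau> \<in> {0..T} \<longrightarrow>
        td_is_fun (u \<tau>) \<and> tempered_fun (cubic_fun (td_rep (u \<tau>)))) \<and>
     (\<forall>t\<in>{0..T}. \<forall>\<psi>\<in>schwartz.
        set_integrable lborel {0..t} (\<lambda>\<tau>. schrodinger (t - \<tau>) (cubic (u \<tau>)) \<psi>) \<and>
        u t \<psi> = schrodinger t (td_of \<phi>) \<psi> +
          \<i> * (LINT \<tau>:{0..t}|lborel. schrodinger (t - \<tau>) (cubic (u \<tau>)) \<psi>))"

text \<open>From here on $q=p'$ and $\theta=-(1-2/p)$.\<close>

definition Y_p :: "real \<Rightarrow> real \<Rightarrow> (real \<Rightarrow> tdist) set" where
  "Y_p p T = Yspace p (p / (p - 1)) (- (1 - 2 / p)) T"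

definition Y_p_norm :: "real \<Rightarrow> real \<Rightarrow> (real \<Rightarrow> tdist) \<Rightarrow> real" where
  "Y_p_norm p T = Ynorm p (p / (p - 1)) (- (1 - 2 / p)) T"

definition solution_map :: "real \<Rightarrow> real \<Rightarrow> (real \<Rightarrow> complex) \<Rightarrow> real \<Rightarrow> tdist" where
  "solution_map p T \<phi> = (THE u. u \<in> Y_p p T \<and> integral_solution T \<phi> u)"

text \<open>The defining property of the local existence time $T_M$.\<close>

definition local_existence_time :: "real \<Rightarrow> real \<Rightarrow> real \<Rightarrow> bool" where
  "local_existence_time p M T \<longleftrightarrow> T > 0 \<and>
     (\<forall>\<phi>\<in>Lp_ball p M. \<exists>!u. u \<in> Y_p p T \<and> integral_solution T \<phi> u) \<and>
     (\<exists>L. \<forall>\<phi>\<^sub>1\<in>Lp_ball p M. \<forall>\<phi>\<^sub>2\<in>Lp_ball p M.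
        Y_p_norm p T (solution_map p T \<phi>\<^sub>1 - solution_map p T \<phi>\<^sub>2) \<le> L * Lp_norm p (\<phi>\<^sub>1 - \<phi>\<^sub>2))"

end

theory Submission
  imports Defs "HOL-Probability.Characteristic_Functions" "HOL-Probability.Sinc_Integral"
begin

text \<open>A solution in the space \<open>Y\<close> is \<open>u(t) = U(t) v(t)\<close> with \<open>v\<close> a continuous curve in \<open>L\<^sup>p\<close>, because
  the weighted norm of the time derivative of \<open>v\<close> controls its \<open>L\<^sup>1\<close> norm in time with values in
  \<open>L\<^sup>p\<close>. So it suffices that \<open>J\<^sup>s U(t)\<close>, with \<open>J\<^sup>s\<close> the Bessel potential, is bounded on \<open>L\<^sup>p\<close>, locally
  uniformly in \<open>t\<close>, and depends norm continuously on \<open>t\<close>.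

  With \<open>\<sigma> = - s / 2\<close> the Gamma integral writes the multiplier of \<open>J\<^sup>s U(t)\<close> as
  \<open>1 / \<Gamma>(\<sigma>) \<integral> \<tau> powr (\<sigma> - 1) exp(- \<tau>) exp(- (\<tau> + i t) \<xi>\<^sup>2) d\<tau>\<close> over \<open>\<tau> > 0\<close>.
  The Gaussian multiplier inside is bounded by \<open>1\<close>, and its convolution kernel has \<open>L\<^sup>1\<close> norm at most \<open>sqrt (1 + t / \<tau>)\<close>. Interpolation
  gives an operator norm on \<open>L\<^sup>p\<close> of order \<open>(1 + t / \<tau>) powr ((1 - 2 / p) / 2)\<close>, and the integral over
  \<open>\<tau>\<close> converges at \<open>0\<close> exactly when \<open>s < - (1 - 2 / p)\<close>.\<close>

section \<open>Schwartz functions\<close>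

text \<open>For p > 2 the group does not act on L^p, and \<open>U(t) f\<close> may fail to be a
  function. The operator identity is therefore never read pointwise: it is tested against a Schwartz
  function, the whole multiplier is moved onto that test function, and only the smoothed average is
  realised as a function. The interpolation is of Marcinkiewicz type between L^2 and L^infinity,
  since only the power of the kernel norm matters, not the constant. A second obstacle sits in the
  norm of Y. The time derivative of a difference of two solutions is picked by \<open>SOME\<close>,
  so the Lipschitz hypothesis speaks about an unspecified function. Distributional time derivatives
  must be shown unique up to null sets, which calls for a jointly measurable family of test
  functions that detects zero: heat kernels with moving centre, damped by a fixed Gaussian. The time
  weight has exponent -(1 - 2/p) \<le> 0, so its inverse is bounded on [0,T]; this is how the
  weighted norm dominates the L^1 norm in time.\<close>

lemma nth_deriv_0 [simp]: "nth_deriv 0 f = f"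
  by (simp add: nth_deriv_def)

lemma nth_deriv_Suc: "nth_deriv (Suc n) f = (\<lambda>x. vector_derivative (nth_deriv n f) (at x))"
  by (simp add: nth_deriv_def)

lemma nth_deriv_Suc': "nth_deriv (Suc n) f = nth_deriv n (\<lambda>x. vector_derivative f (at x))"
  by (simp add: nth_deriv_def funpow_Suc_right del: funpow.simps)

text \<open>Avoids formulas for higher derivatives: a class that contains \<open>f\<close>, is
  closed under differentiation and consists of rapidly decreasing functions contains every
  \<open>nth_deriv n f\<close>. Products, reflections, Gaussians and Fourier images are all handled
  by exhibiting such a class.\<close>

lemma schwartz_coinduct:
  assumes "f \<in> C"
    and deriv: "\<And>g. g \<in> C \<Longrightarrow> \<exists>g'\<in>C. \<forall>x. (g has_vector_derivative g' x) (at x)"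
    and decay: "\<And>g k. g \<in> C \<Longrightarrow> \<exists>B. \<forall>x. \<bar>x\<bar> ^ k * norm (g x) \<le> B"
  shows "f \<in> schwartz"
proof -
  have C: "nth_deriv n f \<in> C" for n
  proof (induction n)
    case (Suc n)
    obtain g' where "g' \<in> C" and "\<forall>x. (nth_deriv n f has_vector_derivative g' x) (at x)"
      using deriv[OF Suc] by blast
    then have "nth_deriv (Suc n) f = g'"
      by (auto simp: nth_deriv_Suc vector_derivative_at)
    then show ?case using \<open>g' \<in> C\<close> by simp
  qed (use assms in simp)
  have "nth_deriv n f differentiable (at x)" for n x
    using deriv[OF C[of n]] by (auto simp: differentiable_def has_vector_derivative_def)
  moreover have "bounded (range (\<lambda>x. \<bar>x\<bar> ^ k * norm (nth_deriv n f x)))" for k n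
    using decay[OF C[of n], of k] by (auto simp: bounded_iff)
  ultimately show ?thesis by (auto simp: schwartz_def)
qed

lemma schwartz_deriv:
  assumes "f \<in> schwartz"
  obtains f' where "f' \<in> schwartz" "\<And>x. (f has_vector_derivative f' x) (at x)"
proof
  show "(\<lambda>x. vector_derivative f (at x)) \<in> schwartz"
    using assms by (auto simp: schwartz_def simp flip: nth_deriv_Suc')
  show "(f has_vector_derivative vector_derivative f (at x)) (at x)" for x
  proof -
    have "nth_deriv 0 f differentiable (at x)" using assms unfolding schwartz_def by blast
    then show ?thesis by (simp flip: vector_derivative_works)
  qed
qed

lemma schwartz_decay:
  assumes "f \<in> schwartz"
  obtains B where "B \<ge> 0" "\<And>x. \<bar>x\<bar> ^ k * norm (f x) \<le> B"
proof -
  have "bounded (range (\<lambda>x. \<bar>x\<bar> ^ k * norm (nth_deriv 0 f x)))"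
    using assms unfolding schwartz_def by blast
  then obtain B where B: "\<And>x. \<bar>x\<bar> ^ k * norm (f x) \<le> B"
    by (auto simp: bounded_iff abs_mult)
  have "0 \<le> \<bar>0\<bar> ^ k * norm (f 0)" by simp
  also have "\<dots> \<le> B" by (rule B)
  finally show ?thesis using B that by blast
qed

lemma one_plus_power_le:
  fixes y :: real
  assumes "y \<ge> 0"
  shows "(1 + y) ^ n \<le> 2 ^ n * (1 + y ^ n)"
proof -
  have "(1 + y) ^ n \<le> (2 * max 1 y) ^ n" using assms by (intro power_mono) auto
  also have "\<dots> = 2 ^ n * max 1 y ^ n" by (simp add: power_mult_distrib)
  also have "\<dots> \<le> 2 ^ n * (1 + y ^ n)" using assms by (intro mult_left_mono) (auto simp: max_def)
  finally show ?thesis .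
qed

lemma schwartz_decay':
  assumes "f \<in> schwartz"
  obtains B where "B \<ge> 0" "\<And>x. (1 + \<bar>x\<bar>) ^ k * norm (f x) \<le> B"
proof -
  obtain B0 where B0: "B0 \<ge> 0" "\<And>x. \<bar>x\<bar> ^ 0 * norm (f x) \<le> B0" using schwartz_decay[OF assms] by blast
  obtain B1 where B1: "B1 \<ge> 0" "\<And>x. \<bar>x\<bar> ^ k * norm (f x) \<le> B1" using schwartz_decay[OF assms] by blast
  have "(1 + \<bar>x\<bar>) ^ k * norm (f x) \<le> 2 ^ k * (B0 + B1)" for x
  proof -
    have "(1 + \<bar>x\<bar>) ^ k * norm (f x) \<le> (2 ^ k * (1 + \<bar>x\<bar> ^ k)) * norm (f x)"
      by (intro mult_right_mono one_plus_power_le) auto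
    also have "\<dots> = 2 ^ k * (\<bar>x\<bar> ^ 0 * norm (f x) + \<bar>x\<bar> ^ k * norm (f x))" by (simp add: algebra_simps)
    also have "\<dots> \<le> 2 ^ k * (B0 + B1)" by (intro mult_left_mono add_mono B0 B1) auto
    finally show ?thesis .
  qed
  then show ?thesis using that[of "2 ^ k * (B0 + B1)"] B0 B1 by auto
qed

text \<open>A syntactic class of multipliers of the Schwartz space. The symbols of interest are
  phases, chirps and Bessel weights. Constants and the identity are generators because derivatives
  of these produce them, and the bracket has an arbitrary exponent because differentiation lowers it
  by 1.\<close>

inductive_set slow :: "(real \<Rightarrow> complex) set" where
  slow_const: "(\<lambda>_. c) \<in> slow"
| slow_ident: "complex_of_real \<in> slow"
| slow_cis: "(\<lambda>x. cis (a * x)) \<in> slow"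
| slow_chirp: "(\<lambda>x. cis (a * x\<^sup>2)) \<in> slow"
| slow_bracket: "(\<lambda>x. complex_of_real ((1 + x\<^sup>2) powr a)) \<in> slow"
| slow_add: "m \<in> slow \<Longrightarrow> m' \<in> slow \<Longrightarrow> (\<lambda>x. m x + m' x) \<in> slow"
| slow_mult: "m \<in> slow \<Longrightarrow> m' \<in> slow \<Longrightarrow> (\<lambda>x. m x * m' x) \<in> slow"

lemma has_vector_derivative_cis [derivative_intros]:
  assumes "(g has_real_derivative g') (at x within S)"
  shows "((\<lambda>x. cis (g x)) has_vector_derivative (\<i> * of_real g' * cis (g x))) (at x within S)"
proof -
  have "(cis has_vector_derivative (\<i> * cis y)) (at y within T)" for y T
    unfolding cis_conv_exp
    by (rule derivative_eq_intros has_vector_derivative_real_field refl | simp)+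
  from vector_diff_chain_within[OF assms[unfolded has_real_derivative_iff_has_vector_derivative] this]
  show ?thesis by (simp add: o_def scaleR_conv_of_real mult_ac)
qed

lemma slow_deriv:
  "m \<in> slow \<Longrightarrow> \<exists>m'\<in>slow. \<forall>x. (m has_vector_derivative m' x) (at x)"
proof (induction rule: slow.induct)
  case (slow_const c)
  show ?case by (rule bexI[of _ "\<lambda>_. 0"]) (auto intro: slow.intros)
next
  case slow_ident
  show ?case
    by (rule bexI[of _ "\<lambda>_. 1"])
      (use has_vector_derivative_of_real[OF DERIV_ident] in \<open>auto intro: slow.intros\<close>)
next
  case (slow_cis a)
  show ?case
    by (rule bexI[of _ "\<lambda>x. (\<i> * of_real a) * cis (a * x)"])
      (auto intro!: slow.intros derivative_eq_intros)
next
  case (slow_chirp a)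
  show ?case
    by (rule bexI[of _ "\<lambda>x. ((2 * \<i> * of_real a) * of_real x) * cis (a * x\<^sup>2)"])
      (auto intro!: slow.intros derivative_eq_intros)
next
  case (slow_bracket a)
  have "((\<lambda>x. (1 + x\<^sup>2) powr a) has_real_derivative (2 * a * x * (1 + x\<^sup>2) powr (a - 1))) (at x)" for x
  proof -
    have "1 + x\<^sup>2 > 0" by (simp add: add_pos_nonneg)
    then show ?thesis
      by (auto intro!: derivative_eq_intros simp: powr_diff field_simps)
  qed
  note * = has_vector_derivative_of_real[OF this]
  show ?case
    by (rule bexI[of _ "\<lambda>x. (2 * of_real a * of_real x) * of_real ((1 + x\<^sup>2) powr (a - 1))"])
      (use * in \<open>auto intro!: slow.intros simp: mult_ac\<close>)
next
  case (slow_add m m')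
  then obtain d d' where "d \<in> slow" "d' \<in> slow"
    and "\<And>x. (m has_vector_derivative d x) (at x)" "\<And>x. (m' has_vector_derivative d' x) (at x)" by blast
  then show ?case
    by (intro bexI[of _ "\<lambda>x. d x + d' x"]) (auto intro!: slow.intros derivative_eq_intros)
next
  case (slow_mult m m')
  then obtain d d' where d: "d \<in> slow" "d' \<in> slow"
    and "\<And>x. (m has_vector_derivative d x) (at x)" "\<And>x. (m' has_vector_derivative d' x) (at x)" by blast
  then have "\<forall>x. ((\<lambda>x. m x * m' x) has_vector_derivative (m x * d' x + d x * m' x)) (at x)"
    by (auto intro!: has_vector_derivative_mult)
  then show ?case
    using slow_mult d by (intro bexI[of _ "\<lambda>x. m x * d' x + d x * m' x"]) (auto intro!: slow.intros)
qed

lemma slow_bound: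
  "m \<in> slow \<Longrightarrow> \<exists>B N. B \<ge> 0 \<and> (\<forall>x. norm (m x) \<le> B * (1 + \<bar>x\<bar>) ^ N)"
proof (induction rule: slow.induct)
  case (slow_const c)
  show ?case by (rule exI[of _ "norm c"], rule exI[of _ 0]) auto
next
  case slow_ident
  show ?case by (rule exI[of _ 1], rule exI[of _ 1]) auto
next
  case (slow_cis a)
  show ?case by (rule exI[of _ 1], rule exI[of _ 0]) auto
next
  case (slow_chirp a)
  show ?case by (rule exI[of _ 1], rule exI[of _ 0]) auto
next
  case (slow_bracket a)
  define n where "n = nat \<lceil>\<bar>a\<bar>\<rceil>"
  have "(1 + x\<^sup>2) powr a \<le> 1 * (1 + \<bar>x\<bar>) ^ (2 * n)" for x :: real
  proof -
    have "(1 + x\<^sup>2) powr a \<le> (1 + x\<^sup>2) powr (real n)"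
      by (intro powr_mono) (auto simp: n_def, linarith)
    also have "\<dots> = (1 + x\<^sup>2) ^ n" by (simp add: powr_realpow add_pos_nonneg)
    also have "\<dots> \<le> ((1 + \<bar>x\<bar>)\<^sup>2) ^ n"
      by (intro power_mono) (auto simp: power2_eq_square algebra_simps)
    finally show ?thesis by (simp add: power_mult)
  qed
  then show ?case by (intro exI[of _ 1] exI[of _ "2 * n"]) auto
next
  case (slow_add m m')
  then obtain B N B' N' where B: "B \<ge> 0" "\<And>x. norm (m x) \<le> B * (1 + \<bar>x\<bar>) ^ N"
    and B': "B' \<ge> 0" "\<And>x. norm (m' x) \<le> B' * (1 + \<bar>x\<bar>) ^ N'" by blast
  have "norm (m x + m' x) \<le> (B + B') * (1 + \<bar>x\<bar>) ^ (N + N')" for x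
  proof -
    have "norm (m x) \<le> B * (1 + \<bar>x\<bar>) ^ (N + N')"
      by (rule order_trans[OF B(2)]) (intro mult_left_mono power_increasing, use B in auto)
    moreover have "norm (m' x) \<le> B' * (1 + \<bar>x\<bar>) ^ (N + N')"
      by (rule order_trans[OF B'(2)]) (intro mult_left_mono power_increasing, use B' in auto)
    ultimately show ?thesis
      using norm_triangle_ineq[of "m x" "m' x"] by (simp add: algebra_simps)
  qed
  then show ?case using B(1) B'(1) by (intro exI[of _ "B + B'"] exI[of _ "N + N'"]) auto
next
  case (slow_mult m m')
  then obtain B N B' N' where B: "B \<ge> 0" "\<And>x. norm (m x) \<le> B * (1 + \<bar>x\<bar>) ^ N"
    and B': "B' \<ge> 0" "\<And>x. norm (m' x) \<le> B' * (1 + \<bar>x\<bar>) ^ N'" by blast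
  have "norm (m x * m' x) \<le> (B * B') * (1 + \<bar>x\<bar>) ^ (N + N')" for x
    using mult_mono[OF B(2)[of x] B'(2)[of x]] B by (simp add: norm_mult power_add mult_ac)
  then show ?case using B(1) B'(1) by (intro exI[of _ "B * B'"] exI[of _ "N + N'"]) auto
qed

text \<open>The product rule turns one product into a sum of two, so single products are not closed
  under differentiation while finite sums of them are. This is the class fed to
  \<open>schwartz_coinduct\<close>.\<close>

inductive_set slow_span :: "(real \<Rightarrow> complex) set" where
  base: "m \<in> slow \<Longrightarrow> f \<in> schwartz \<Longrightarrow> (\<lambda>x. m x * f x) \<in> slow_span"
| add: "g \<in> slow_span \<Longrightarrow> h \<in> slow_span \<Longrightarrow> (\<lambda>x. g x + h x) \<in> slow_span"

lemma slow_span_schwartz: "f \<in> slow_span \<Longrightarrow> f \<in> schwartz"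
proof (rule schwartz_coinduct[of _ slow_span])
  show "\<exists>g'\<in>slow_span. \<forall>x. (g has_vector_derivative g' x) (at x)" if "g \<in> slow_span" for g
    using that
  proof induction
    case (base m f)
    obtain m' where m': "m' \<in> slow" "\<And>x. (m has_vector_derivative m' x) (at x)"
      using slow_deriv[OF base(1)] by blast
    obtain f' where f': "f' \<in> schwartz" "\<And>x. (f has_vector_derivative f' x) (at x)"
      using schwartz_deriv[OF base(2)] by blast
    have "\<forall>x. ((\<lambda>x. m x * f x) has_vector_derivative (m x * f' x + m' x * f x)) (at x)"
      using m' f' by (auto intro!: has_vector_derivative_mult)
    then show ?case
      using base m' f' by (intro bexI[of _ "\<lambda>x. m x * f' x + m' x * f x"]) (auto intro!: slow_span.intros)
  next
    case (add g h)
    then obtain d d' where "d \<in> slow_span" "d' \<in> slow_span"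
      and "\<And>x. (g has_vector_derivative d x) (at x)" "\<And>x. (h has_vector_derivative d' x) (at x)" by blast
    then show ?case
      by (intro bexI[of _ "\<lambda>x. d x + d' x"]) (auto intro!: slow_span.intros derivative_eq_intros)
  qed
  show "\<exists>B. \<forall>x. \<bar>x\<bar> ^ k * norm (g x) \<le> B" if "g \<in> slow_span" for g k
    using that
  proof induction
    case (base m f)
    obtain B N where B: "B \<ge> 0" "\<And>x. norm (m x) \<le> B * (1 + \<bar>x\<bar>) ^ N"
      using slow_bound[OF base(1)] by blast
    \<comment> \<open>The extra \<open>N\<close> powers of decay of \<open>f\<close> pay for the
      growth of \<open>m\<close>.\<close>
    obtain B' where B': "B' \<ge> 0" "\<And>x. (1 + \<bar>x\<bar>) ^ (k + N) * norm (f x) \<le> B'"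
      using schwartz_decay'[OF base(2)] by blast
    have "\<bar>x\<bar> ^ k * norm (m x * f x) \<le> B * B'" for x
    proof -
      have "\<bar>x\<bar> ^ k * norm (m x * f x) \<le> (1 + \<bar>x\<bar>) ^ k * (B * (1 + \<bar>x\<bar>) ^ N * norm (f x))"
        unfolding norm_mult using B
        by (intro mult_mono B power_mono) auto
      also have "\<dots> = B * ((1 + \<bar>x\<bar>) ^ (k + N) * norm (f x))" by (simp add: power_add mult_ac)
      also have "\<dots> \<le> B * B'" using B B' by (intro mult_left_mono) auto
      finally show ?thesis .
    qed
    then show ?case by blast
  next
    case (add g h)
    then obtain B B' where B: "\<And>x. \<bar>x\<bar> ^ k * norm (g x) \<le> B" "\<And>x. \<bar>x\<bar> ^ k * norm (h x) \<le> B'" by blast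
    have "\<bar>x\<bar> ^ k * norm (g x + h x) \<le> B + B'" for x
    proof -
      have "\<bar>x\<bar> ^ k * norm (g x + h x) \<le> \<bar>x\<bar> ^ k * (norm (g x) + norm (h x))"
        by (intro mult_left_mono norm_triangle_ineq) auto
      then show ?thesis using B[of x] by (simp add: algebra_simps)
    qed
    then show ?case by blast
  qed
qed auto

lemma schwartz_slow_mult: "m \<in> slow \<Longrightarrow> f \<in> schwartz \<Longrightarrow> (\<lambda>x. m x * f x) \<in> schwartz"
  by (rule slow_span_schwartz) (rule slow_span.base)

lemma schwartz_cmult: "f \<in> schwartz \<Longrightarrow> (\<lambda>x. c * f x) \<in> schwartz"
  by (rule schwartz_slow_mult[OF slow_const])

lemma schwartz_add:
  assumes "f \<in> schwartz" "g \<in> schwartz"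
  shows "(\<lambda>x. f x + g x) \<in> schwartz"
proof -
  have "(\<lambda>x. 1 * f x + 1 * g x) \<in> slow_span"
    using assms by (intro slow_span.intros slow.intros)
  then show ?thesis using slow_span_schwartz by simp
qed

lemma schwartz_diff:
  assumes "f \<in> schwartz" "g \<in> schwartz"
  shows "(\<lambda>x. f x - g x) \<in> schwartz"
  using schwartz_add[OF assms(1) schwartz_cmult[OF assms(2), of "-1"]] by simp

lemma schwartz_reflect:
  assumes "f \<in> schwartz"
  shows "(\<lambda>x. f (- x)) \<in> schwartz"
proof (rule schwartz_coinduct[of _ "{\<lambda>x. g (- x) |g. g \<in> schwartz}"])
  fix h assume "h \<in> {\<lambda>x. g (- x) |g. g \<in> schwartz}"
  then obtain g where g: "g \<in> schwartz" and h: "h = (\<lambda>x. g (- x))" by blast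
  obtain g' where g': "g' \<in> schwartz" "\<And>x. (g has_vector_derivative g' x) (at x)"
    using schwartz_deriv[OF g] by blast
  have "(h has_vector_derivative (-1) *\<^sub>R g' (- x)) (at x)" for x
    unfolding h using g'(2)
    by (intro vector_diff_chain_at[unfolded o_def]) (auto intro!: derivative_eq_intros)
  moreover have "(\<lambda>x. (-1) *\<^sub>R g' (- x)) \<in> {\<lambda>x. g (- x) |g. g \<in> schwartz}"
    using schwartz_cmult[OF g'(1), of "-1"] by (auto intro!: exI[of _ "\<lambda>x. - g' x"])
  ultimately show "\<exists>g'\<in>{\<lambda>x. g (- x) |g. g \<in> schwartz}. \<forall>x. (h has_vector_derivative g' x) (at x)"
    by (intro bexI[of _ "\<lambda>x. (-1) *\<^sub>R g' (- x)"] allI)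
  fix k
  obtain B where "\<And>x. \<bar>x\<bar> ^ k * norm (g x) \<le> B" using schwartz_decay[OF g] by blast
  from this[of "- _"] show "\<exists>B. \<forall>x. \<bar>x\<bar> ^ k * norm (h x) \<le> B" by (auto simp: h)
qed (use assms in auto)

text \<open>A single term of the exponential series is at most its sum.\<close>

lemma power_mult_exp_neg_le:
  fixes y :: real
  assumes "y \<ge> 0"
  shows "y ^ n * exp (- y) \<le> fact n"
proof -
  have "y ^ n / fact n \<le> exp y"
    using assms sum_le_suminf[OF summable_exp_generic[of y], of "{n}"]
    by (auto simp: exp_def field_simps)
  then show ?thesis by (simp add: exp_minus field_simps)
qed

lemma schwartz_gauss:
  assumes "\<tau> > 0"
  shows "(\<lambda>x. complex_of_real (exp (- \<tau> * x\<^sup>2))) \<in> schwartz"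
proof -
  define E where "E = (\<lambda>x. complex_of_real (exp (- \<tau> * x\<^sup>2)))"
  have E': "(E has_vector_derivative (-2 * of_real \<tau> * of_real x) * E x) (at x)" for x
  proof -
    have "((\<lambda>x. exp (- \<tau> * x\<^sup>2)) has_real_derivative (- 2 * \<tau> * x * exp (- \<tau> * x\<^sup>2))) (at x)"
      by (auto intro!: derivative_eq_intros)
    from has_vector_derivative_of_real[OF this] show ?thesis by (simp add: E_def)
  qed
  have "(\<lambda>x. 1 * E x) \<in> schwartz"
  proof (rule schwartz_coinduct[of _ "{\<lambda>x. m x * E x |m. m \<in> slow}"])
    fix h assume "h \<in> {\<lambda>x. m x * E x |m. m \<in> slow}"
    then obtain m where m: "m \<in> slow" and h: "h = (\<lambda>x. m x * E x)" by blast
    obtain m' where m': "m' \<in> slow" "\<And>x. (m has_vector_derivative m' x) (at x)"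
      using slow_deriv[OF m] by blast
    have hd: "(h has_vector_derivative (m x * ((-2 * of_real \<tau> * of_real x) * E x) + m' x * E x)) (at x)" for x
      unfolding h by (intro has_vector_derivative_mult m' E')
    have "(h has_vector_derivative (m x * ((-2 * of_real \<tau>) * of_real x) + m' x) * E x) (at x)" for x
      using hd[of x] by (simp add: algebra_simps)
    moreover have "(\<lambda>x. m x * ((-2 * of_real \<tau>) * of_real x) + m' x) \<in> slow"
      using m m' by (intro slow.intros)
    ultimately show "\<exists>g'\<in>{\<lambda>x. m x * E x |m. m \<in> slow}. \<forall>x. (h has_vector_derivative g' x) (at x)"
      by (intro bexI[of _ "\<lambda>x. (m x * ((-2 * of_real \<tau>) * of_real x) + m' x) * E x"] allI) auto
    fix k
    obtain B N where B: "B \<ge> 0" "\<And>x. norm (m x) \<le> B * (1 + \<bar>x\<bar>) ^ N"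
      using slow_bound[OF m] by blast
    have "\<bar>x\<bar> ^ k * norm (h x) \<le> B * (2 ^ (k + N) * (2 + fact (k + N) / \<tau> ^ (k + N)))" for x
    proof -
      let ?n = "k + N"
      have 1: "exp (- \<tau> * x\<^sup>2) \<le> 1" using assms by simp
      \<comment> \<open>Passing to powers of \<open>x^2\<close> makes
        \<open>power_mult_exp_neg_le\<close> applicable with
        \<open>y = \<tau> * x^2\<close>.\<close>
      have "\<bar>x\<bar> ^ ?n \<le> 1 + (x\<^sup>2) ^ ?n"
      proof (cases "\<bar>x\<bar> \<le> 1")
        case True then show ?thesis by (meson abs_ge_zero add_increasing2 power_le_one zero_le_power zero_le_power2)
      next
        case False
        then have "\<bar>x\<bar> ^ ?n \<le> \<bar>x\<bar> ^ (2 * ?n)" by (intro power_increasing) auto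
        then show ?thesis unfolding power_mult by simp
      qed
      then have "(1 + \<bar>x\<bar> ^ ?n) * exp (- \<tau> * x\<^sup>2) \<le> (2 + (x\<^sup>2) ^ ?n) * exp (- \<tau> * x\<^sup>2)"
        by (intro mult_right_mono) auto
      also have "\<dots> = 2 * exp (- \<tau> * x\<^sup>2) + (\<tau> * x\<^sup>2) ^ ?n * exp (- (\<tau> * x\<^sup>2)) / \<tau> ^ ?n"
        using assms by (simp add: power_mult_distrib field_simps)
      also have "\<dots> \<le> 2 * 1 + fact ?n / \<tau> ^ ?n"
        using assms by (intro add_mono mult_left_mono divide_right_mono power_mult_exp_neg_le 1) auto
      finally have *: "(1 + \<bar>x\<bar> ^ ?n) * exp (- \<tau> * x\<^sup>2) \<le> 2 + fact ?n / \<tau> ^ ?n" by simp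
      have "\<bar>x\<bar> ^ k * norm (h x) \<le> (1 + \<bar>x\<bar>) ^ k * (B * (1 + \<bar>x\<bar>) ^ N * exp (- \<tau> * x\<^sup>2))"
        unfolding h norm_mult using B by (intro mult_mono B power_mono) (auto simp: E_def)
      also have "\<dots> = B * ((1 + \<bar>x\<bar>) ^ ?n * exp (- \<tau> * x\<^sup>2))" by (simp add: power_add mult_ac)
      also have "\<dots> \<le> B * ((2 ^ ?n * (1 + \<bar>x\<bar> ^ ?n)) * exp (- \<tau> * x\<^sup>2))"
        using B by (intro mult_left_mono mult_right_mono one_plus_power_le) auto
      also have "\<dots> \<le> B * (2 ^ ?n * (2 + fact ?n / \<tau> ^ ?n))"
        using B * by (simp only: mult.assoc) (intro mult_left_mono, auto)
      finally show ?thesis .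
    qed
    then show "\<exists>B. \<forall>x. \<bar>x\<bar> ^ k * norm (h x) \<le> B" by blast
  qed (intro CollectI exI[of _ "\<lambda>_. 1"] conjI refl slow_const)
  then show ?thesis by (simp add: E_def)
qed

lemma schwartz_continuous: "f \<in> schwartz \<Longrightarrow> continuous_on UNIV f"
  by (metis schwartz_deriv continuous_on_eq_continuous_at has_vector_derivative_continuous open_UNIV)

lemma schwartz_borel [measurable_dest]: "f \<in> schwartz \<Longrightarrow> f \<in> borel_measurable borel"
  by (intro borel_measurable_continuous_onI schwartz_continuous)

lemma schwartz_bounded:
  assumes "f \<in> schwartz"
  obtains B where "B \<ge> 0" "\<And>x. norm (f x) \<le> B"
  using schwartz_decay[OF assms, of 0] by auto

lemma integrable_inverse_1_plus_square_lborel: "integrable lborel (\<lambda>x::real. inverse (1 + x\<^sup>2))"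
  using integrable_inverse_1_plus_square by (simp add: set_integrable_def)

lemma schwartz_integrable:
  assumes "f \<in> schwartz"
  shows "integrable lborel f"
proof -
  obtain B where B: "B \<ge> 0" "\<And>x. (1 + \<bar>x\<bar>) ^ 2 * norm (f x) \<le> B" using schwartz_decay'[OF assms] by blast
  show ?thesis
  proof (rule Bochner_Integration.integrable_bound)
    show "integrable lborel (\<lambda>x::real. B * inverse (1 + x\<^sup>2))"
      by (intro integrable_mult_right integrable_inverse_1_plus_square_lborel)
    have "norm (f x) \<le> B * inverse (1 + x\<^sup>2)" for x
    proof -
      have "(1 + x\<^sup>2) * norm (f x) \<le> (1 + \<bar>x\<bar>) ^ 2 * norm (f x)"
        by (intro mult_right_mono) (auto simp: power2_eq_square algebra_simps)
      also note B(2)[of x]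
      finally show ?thesis by (simp add: field_simps add_pos_nonneg)
    qed
    then show "AE x in lborel. norm (f x) \<le> norm (B * inverse (1 + x\<^sup>2))"
      using B by (auto simp: abs_mult add_nonneg_nonneg)
  qed (use assms in measurable)
qed

section \<open>The Fourier transform on the Schwartz space\<close>

lemma continuous_on_cis' [continuous_intros]:
  "continuous_on S f \<Longrightarrow> continuous_on S (\<lambda>x. cis (f x))"
  unfolding cis_conv_exp by (intro continuous_intros)

lemma measurable_cis [measurable]: "cis \<in> borel_measurable borel"
  by (intro borel_measurable_continuous_onI continuous_on_cis' continuous_on_id)

lemma integrable_cis_mult:
  assumes "integrable lborel f" "h \<in> borel_measurable borel"
  shows "integrable lborel (\<lambda>x. cis (h x) * f x)"
  by (rule Bochner_Integration.integrable_bound[OF assms(1)])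
    (use assms in \<open>auto simp: norm_mult intro!: borel_measurable_times\<close>)

lemma norm_fourier_le: "norm (fourier f \<xi>) \<le> (LINT x|lborel. norm (f x))"
  unfolding fourier_def by (rule order_trans[OF integral_norm_bound]) (simp add: norm_mult)

lemma fourier_measurable [measurable]:
  assumes [measurable]: "f \<in> borel_measurable borel"
  shows "fourier f \<in> borel_measurable borel"
  unfolding fourier_def by measurable

lemma fourier_inv_eq: "fourier_inv g x = of_real (1 / (2 * pi)) * fourier g (- x)"
  by (simp add: fourier_inv_def fourier_def mult.commute)

text \<open>The second-order Taylor bound |e^(iy) - 1 - iy| \<le> y^2 / 2 makes the error of the
  linear approximation at most \<open>K * h^2\<close>, where \<open>K\<close> is half the second
  moment of |f|. This replaces differentiation under the integral sign by one explicit
  estimate.\<close>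

lemma fourier_deriv:
  assumes f: "f \<in> schwartz"
  shows "(fourier f has_vector_derivative fourier (\<lambda>x. (- \<i> * of_real x) * f x) \<xi>) (at \<xi>)"
proof -
  note [measurable] = schwartz_borel[OF f]
  define g where "g = (\<lambda>x. (- \<i> * of_real x) * f x)"
  have g: "g \<in> schwartz"
    unfolding g_def by (intro schwartz_slow_mult slow.intros f)
  have "(\<lambda>x. (of_real x * of_real x) * f x) \<in> schwartz"
    by (intro schwartz_slow_mult slow.intros f)
  from integrable_norm[OF schwartz_integrable[OF this]]
  have i2: "integrable lborel (\<lambda>x. x\<^sup>2 * norm (f x))"
    by (simp add: norm_mult power2_eq_square flip: abs_mult)
  define K where "K = (LINT x|lborel. x\<^sup>2 * norm (f x)) / 2"
  have eq: "cis (- (x * (\<xi> + h))) * f x - cis (- (x * \<xi>)) * f x - h *\<^sub>R (cis (- (x * \<xi>)) * g x) =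
      cis (- (x * \<xi>)) * (cis (- (x * h)) - (1 + \<i> * of_real (- (x * h)))) * f x" for x h
  proof -
    have "cis (- (x * (\<xi> + h))) = cis (- (x * \<xi>)) * cis (- (x * h))"
      by (simp add: cis_mult distrib_left)
    then show ?thesis by (simp add: g_def algebra_simps scaleR_conv_of_real)
  qed
  have bound: "norm (fourier f (\<xi> + h) - fourier f \<xi> - h *\<^sub>R fourier g \<xi>) \<le> K * h\<^sup>2" for h
  proof -
    have "fourier f (\<xi> + h) - fourier f \<xi> - h *\<^sub>R fourier g \<xi> =
      (LINT x|lborel. cis (- (x * (\<xi> + h))) * f x - cis (- (x * \<xi>)) * f x - h *\<^sub>R (cis (- (x * \<xi>)) * g x))"
      unfolding fourier_def using schwartz_integrable[OF f] schwartz_integrable[OF g]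
      by (simp add: integrable_cis_mult)
    also have "\<dots> = (LINT x|lborel. cis (- (x * \<xi>)) * (cis (- (x * h)) - (1 + \<i> * of_real (- (x * h)))) * f x)"
      by (simp only: eq)
    also have "norm \<dots> \<le> (LINT x|lborel. (x\<^sup>2 * norm (f x)) * (h\<^sup>2 / 2))"
    proof (rule order_trans[OF integral_norm_bound integral_mono], goal_cases)
      case 1
      have "integrable lborel (\<lambda>x. cis (- (x * (\<xi> + h))) * f x - cis (- (x * \<xi>)) * f x - h *\<^sub>R (cis (- (x * \<xi>)) * g x))"
        using schwartz_integrable[OF f] schwartz_integrable[OF g] by (simp add: integrable_cis_mult)
      then show ?case by (simp only: eq integrable_norm)
    next
      case 2
      show ?case using i2 by simp
    next
      case (3 x)
      have "norm (cis (- (x * h)) - (1 + \<i> * of_real (- (x * h)))) \<le> (x * h)\<^sup>2 / 2"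
        using iexp_approx1[of "- (x * h)" 1] by (simp add: cis_conv_exp power2_eq_square)
      from mult_right_mono[OF this, of "norm (f x)"] show ?case
        by (simp add: norm_mult power_mult_distrib mult_ac)
    qed
    also have "\<dots> = K * h\<^sup>2" unfolding K_def by (subst integral_mult_left_zero) simp
    finally show ?thesis .
  qed
  have *: "norm (fourier f (\<xi> + h) - fourier f \<xi> - h *\<^sub>R fourier g \<xi>) / norm h \<le> K * \<bar>h\<bar>" for h
  proof (cases "h = 0")
    case False
    have "K * h\<^sup>2 / norm h = K * \<bar>h\<bar>"
      using False by (cases "h > 0") (auto simp: power2_eq_square)
    then show ?thesis using divide_right_mono[OF bound[of h], of "norm h"] by simp
  qed simp
  have "((\<lambda>h. norm (fourier f (\<xi> + h) - fourier f \<xi> - h *\<^sub>R fourier g \<xi>) / norm h) \<longlongrightarrow> 0) (at 0)"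
  proof (rule tendsto_sandwich[of "\<lambda>_. 0" _ _ "\<lambda>h. K * \<bar>h\<bar>"])
    show "((\<lambda>h. K * \<bar>h\<bar>) \<longlongrightarrow> 0) (at 0)" by (auto intro!: tendsto_eq_intros)
  qed (use * in auto)
  then show ?thesis
    unfolding has_vector_derivative_def has_derivative_at g_def
    by (auto intro!: bounded_linear_scaleR_left)
qed

lemma schwartz_tendsto_0:
  assumes "f \<in> schwartz"
  shows "(f \<longlongrightarrow> 0) at_infinity"
proof -
  obtain B where B: "B \<ge> 0" "\<And>x. \<bar>x\<bar> ^ 1 * norm (f x) \<le> B"
    using schwartz_decay[OF assms] by blast
  show ?thesis
  proof (rule tendsto_norm_zero_cancel, rule tendsto_sandwich[of "\<lambda>_. 0" _ _ "\<lambda>x. B / norm x"])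
    have "norm (f x) \<le> B / norm x" if "x \<noteq> 0" for x
      using B(2)[of x] that by (simp add: field_simps)
    then show "\<forall>\<^sub>F x in at_infinity. norm (f x) \<le> B / norm x"
      using eventually_not_equal_at_infinity[of 0] by (auto elim: eventually_mono)
    show "((\<lambda>x::real. B / norm x) \<longlongrightarrow> 0) at_infinity"
      by (intro tendsto_divide_0[OF tendsto_const] filterlim_at_top_imp_at_infinity filterlim_norm_at_top)
  qed auto
qed

lemma integral_schwartz_deriv:
  assumes "f \<in> schwartz" "f' \<in> schwartz" "\<And>x. (f has_vector_derivative f' x) (at x)"
  shows "(LINT x|lborel. f' x) = 0"
proof -
  have "(LBINT x=-\<infinity>..\<infinity>. f' x) = 0 - 0"
  proof (rule interval_integral_FTC_integrable)
    show "((f \<circ> real_of_ereal) \<longlongrightarrow> 0) (at_right (-\<infinity>))"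
      unfolding ereal_tendsto_simps
      using schwartz_tendsto_0[OF assms(1)] by (rule tendsto_mono[OF at_bot_le_at_infinity])
    show "((f \<circ> real_of_ereal) \<longlongrightarrow> 0) (at_left \<infinity>)"
      unfolding ereal_tendsto_simps
      using schwartz_tendsto_0[OF assms(1)] by (rule tendsto_mono[OF at_top_le_at_infinity])
    show "set_integrable lborel (einterval (-\<infinity>) \<infinity>) f'"
      using schwartz_integrable[OF assms(2)] by (simp add: set_integrable_def)
    show "isCont f' x" for x
      using schwartz_continuous[OF assms(2)] by (simp add: continuous_on_eq_continuous_at)
  qed (use assms in auto)
  then show ?thesis
    by (simp add: interval_lebesgue_integral_def set_lebesgue_integral_def)
qed

text \<open>Integration by parts in the form that the derivative of
  \<open>cis (- \<xi> * x) * f x\<close>, itself a Schwartz function, has integral 0.\<close>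

lemma fourier_of_deriv:
  assumes f: "f \<in> schwartz" and f': "f' \<in> schwartz" "\<And>x. (f has_vector_derivative f' x) (at x)"
  shows "fourier f' \<xi> = \<i> * of_real \<xi> * fourier f \<xi>"
proof -
  have "(LINT x|lborel. cis (- \<xi> * x) * f' x + (- \<i> * of_real \<xi>) * (cis (- \<xi> * x) * f x)) = 0"
  proof (rule integral_schwartz_deriv)
    show "(\<lambda>x. cis (- \<xi> * x) * f x) \<in> schwartz"
      by (intro schwartz_slow_mult slow.intros f)
    show "(\<lambda>x. cis (- \<xi> * x) * f' x + (- \<i> * of_real \<xi>) * (cis (- \<xi> * x) * f x)) \<in> schwartz"
      by (intro schwartz_add schwartz_cmult schwartz_slow_mult slow.intros f f')
    show "((\<lambda>x. cis (- \<xi> * x) * f x) has_vector_derivative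
        (cis (- \<xi> * x) * f' x + (- \<i> * of_real \<xi>) * (cis (- \<xi> * x) * f x))) (at x)" for x
      by (rule has_vector_derivative_mult[THEN has_vector_derivative_eq_rhs, OF _ f'(2)])
        (auto intro!: derivative_eq_intros)
  qed
  moreover have "integrable lborel (\<lambda>x. cis (- \<xi> * x) * f' x)" "integrable lborel (\<lambda>x. cis (- \<xi> * x) * f x)"
    by (intro integrable_cis_mult schwartz_integrable f f'; simp)+
  ultimately have "(LINT x|lborel. cis (- \<xi> * x) * f' x) + (- \<i> * of_real \<xi>) * (LINT x|lborel. cis (- \<xi> * x) * f x) = 0"
    by simp
  then show ?thesis
    by (simp add: fourier_def mult.commute[of \<xi>] add_eq_0_iff)
qed

text \<open>The coinductive class is the set of all Fourier images: differentiating one multiplies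
  the original by a linear factor. For decay, each power of \<xi> is traded for a derivative of the
  original function.\<close>

lemma fourier_schwartz:
  assumes "f \<in> schwartz"
  shows "fourier f \<in> schwartz"
proof (rule schwartz_coinduct[of _ "fourier ` schwartz"])
  fix h k assume "h \<in> fourier ` schwartz"
  then obtain g where g: "g \<in> schwartz" and h: "h = fourier g" by blast
  have "(\<lambda>x. (- \<i> * of_real x) * g x) \<in> schwartz"
    by (intro schwartz_slow_mult slow.intros g)
  then show "\<exists>g'\<in>fourier ` schwartz. \<forall>x. (h has_vector_derivative g' x) (at x)"
    using fourier_deriv[OF g] h by blast
  have "\<exists>B. \<forall>\<xi>. \<bar>\<xi>\<bar> ^ k * norm (fourier g \<xi>) \<le> B"
    using g
  proof (induction k arbitrary: g)
    case 0
    then show ?case using norm_fourier_le[of g] by auto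
  next
    case (Suc k)
    obtain g' where g': "g' \<in> schwartz" "\<And>x. (g has_vector_derivative g' x) (at x)"
      using schwartz_deriv[OF Suc.prems] by blast
    obtain B where B: "\<And>\<xi>. \<bar>\<xi>\<bar> ^ k * norm (fourier g' \<xi>) \<le> B"
      using Suc.IH[OF g'(1)] by blast
    have "\<bar>\<xi>\<bar> ^ Suc k * norm (fourier g \<xi>) \<le> B" for \<xi>
      using B[of \<xi>] by (simp add: fourier_of_deriv[OF Suc.prems g'] norm_mult mult_ac)
    then show ?case by blast
  qed
  then show "\<exists>B. \<forall>\<xi>. \<bar>\<xi>\<bar> ^ k * norm (h \<xi>) \<le> B" by (simp add: h)
qed (use assms in auto)

lemma fourier_inv_schwartz:
  assumes "f \<in> schwartz"
  shows "fourier_inv f \<in> schwartz"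
proof -
  have "(\<lambda>x. of_real (1 / (2 * pi)) * fourier f (- x)) \<in> schwartz"
    by (intro schwartz_cmult schwartz_reflect fourier_schwartz assms)
  then show ?thesis by (simp add: fourier_inv_eq[abs_def])
qed

section \<open>Heat kernel, Gaussian transforms and Fourier inversion\<close>

definition heat :: "real \<Rightarrow> real \<Rightarrow> real" where
  "heat \<tau> = normal_density 0 (sqrt (2 * \<tau>))"

lemma heat_eq: "\<tau> > 0 \<Longrightarrow> heat \<tau> x = 1 / sqrt (4 * pi * \<tau>) * exp (- x\<^sup>2 / (4 * \<tau>))"
  by (simp add: heat_def normal_density_def mult_ac)

lemma heat_nonneg: "heat \<tau> x \<ge> 0"
  by (simp add: heat_def)

lemma heat_measurable [measurable]: "heat \<tau> \<in> borel_measurable borel"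
  by (simp add: heat_def)

lemma heat_minus: "heat \<tau> (- x) = heat \<tau> x"
  by (simp add: heat_def normal_density_def)

lemma heat_commute: "heat \<tau> (x - y) = heat \<tau> (y - x)"
  by (metis heat_minus minus_diff_eq)

lemma nn_integral_heat_translate:
  assumes "\<tau> > 0"
  shows "(\<integral>\<^sup>+x. heat \<tau> (x - y) \<partial>lborel) = 1" "(\<integral>\<^sup>+x. heat \<tau> (y - x) \<partial>lborel) = 1"
proof -
  have "(\<integral>\<^sup>+x. heat \<tau> (x - y) \<partial>lborel) = (\<integral>\<^sup>+x. heat \<tau> x \<partial>lborel)"
    using nn_integral_real_affine[of "\<lambda>x. ennreal (heat \<tau> x)" 1 "- y"] by simp
  also have "\<dots> = ennreal (LINT x|lborel. heat \<tau> x)"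
    using assms by (intro nn_integral_eq_integral) (auto simp: heat_def)
  also have "\<dots> = 1" using assms by (simp add: heat_def)
  finally show "(\<integral>\<^sup>+x. heat \<tau> (x - y) \<partial>lborel) = 1" .
  then show "(\<integral>\<^sup>+x. heat \<tau> (y - x) \<partial>lborel) = 1" by (simp add: heat_commute[of \<tau> y])
qed

text \<open>Read off from the characteristic function of the standard normal law by the substitution
  \<open>z = sqrt (2 * \<tau>) * \<xi>\<close>; the point \<open>t\<close> is chosen so that
  \<open>t * z = - x * \<xi>\<close>.\<close>

lemma fourier_gauss:
  assumes "\<tau> > 0"
  shows "fourier (\<lambda>\<xi>. of_real (exp (- \<tau> * \<xi>\<^sup>2))) x = of_real (2 * pi * heat \<tau> x)"
proof -
  define t where "t = - x / sqrt (2 * \<tau>)"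
  have "of_real (exp (- t\<^sup>2 / 2)) = char std_normal_distribution t"
    by (simp add: char_std_normal_distribution)
  also have "\<dots> = (LINT z|lborel. std_normal_density z *\<^sub>R iexp (t * z))"
    by (simp add: char_def integral_density)
  also have "\<dots> = sqrt (2 * \<tau>) *\<^sub>R (LINT \<xi>|lborel. std_normal_density (sqrt (2 * \<tau>) * \<xi>) *\<^sub>R iexp (t * (sqrt (2 * \<tau>) * \<xi>)))"
    using assms lborel_integral_real_affine[of "sqrt (2 * \<tau>)" "\<lambda>z. std_normal_density z *\<^sub>R iexp (t * z)" 0] by simp
  also have "(\<lambda>\<xi>. std_normal_density (sqrt (2 * \<tau>) * \<xi>) *\<^sub>R iexp (t * (sqrt (2 * \<tau>) * \<xi>))) =
      (\<lambda>\<xi>. (1 / sqrt (2 * pi)) *\<^sub>R (cis (- (\<xi> * x)) * of_real (exp (- \<tau> * \<xi>\<^sup>2))))"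
    using assms by (auto simp: fun_eq_iff normal_density_def t_def cis_conv_exp power_mult_distrib scaleR_conv_of_real mult_ac)
  also have "(LINT \<xi>|lborel. (1 / sqrt (2 * pi)) *\<^sub>R (cis (- (\<xi> * x)) * of_real (exp (- \<tau> * \<xi>\<^sup>2)))) =
      (1 / sqrt (2 * pi)) *\<^sub>R fourier (\<lambda>\<xi>. of_real (exp (- \<tau> * \<xi>\<^sup>2))) x"
    by (simp only: integral_scaleR_right fourier_def)
  finally have "fourier (\<lambda>\<xi>. of_real (exp (- \<tau> * \<xi>\<^sup>2))) x = of_real (sqrt (2 * pi) / sqrt (2 * \<tau>) * exp (- t\<^sup>2 / 2))"
    using assms by (simp add: scaleR_conv_of_real field_simps)
  also have "sqrt (2 * pi) / sqrt (2 * \<tau>) = 2 * pi / sqrt (4 * pi * \<tau>)"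
  proof -
    have "2 * pi = sqrt (2 * pi) * sqrt (2 * pi)" by simp
    moreover have "sqrt (4 * pi * \<tau>) = sqrt (2 * pi) * sqrt (2 * \<tau>)"
      by (simp flip: real_sqrt_mult)
    ultimately show ?thesis using assms by (simp add: field_simps)
  qed
  also have "2 * pi / sqrt (4 * pi * \<tau>) * exp (- t\<^sup>2 / 2) = 2 * pi * heat \<tau> x"
    using assms by (simp add: heat_eq t_def power_divide)
  finally show ?thesis .
qed

lemma fourier_inv_gauss:
  "\<tau> > 0 \<Longrightarrow> fourier_inv (\<lambda>\<xi>. of_real (exp (- \<tau> * \<xi>\<^sup>2))) x = of_real (heat \<tau> x)"
  by (simp only: fourier_inv_eq fourier_gauss heat_minus) simp

text \<open>The substitution \<open>y = x + sqrt (2 * \<tau>) * z\<close> freezes the kernel and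
  moves \<tau> into the argument of \<open>f\<close>, so dominated convergence needs only
  boundedness and continuity at the one point \<open>x\<close>. That generality lets it act on
  indicators of intervals later.\<close>

lemma heat_approximate_identity:
  fixes f :: "real \<Rightarrow> complex"
  assumes [measurable]: "f \<in> borel_measurable borel" and B: "\<And>y. norm (f y) \<le> B" and "isCont f x"
    and \<tau>: "\<And>n. \<tau> n > 0" "\<tau> \<longlonglongrightarrow> 0"
  shows "(\<lambda>n. LINT y|lborel. f y * of_real (heat (\<tau> n) (x - y))) \<longlonglongrightarrow> f x"
proof -
  have eq: "(LINT y|lborel. f y * of_real (heat \<tau> (x - y))) =
      (LINT z|lborel. f (x + sqrt (2 * \<tau>) * z) * of_real (std_normal_density z))" if "\<tau> > 0" for \<tau>
  proof -
    have "sqrt (2 * \<tau>) * heat \<tau> (sqrt (2 * \<tau>) * z) = std_normal_density z" for z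
      using that by (simp add: heat_def normal_density_def real_sqrt_mult field_simps)
    then have *: "of_real (sqrt (2 * \<tau>)) * (of_real (heat \<tau> (sqrt (2 * \<tau>) * z)) :: complex) = of_real (std_normal_density z)" for z
      by (metis of_real_mult)
    have "(LINT y|lborel. f y * of_real (heat \<tau> (x - y))) =
        (LINT z|lborel. of_real (sqrt (2 * \<tau>)) * (f (x + sqrt (2 * \<tau>) * z) * of_real (heat \<tau> (sqrt (2 * \<tau>) * z))))"
      using that lborel_integral_real_affine[of "sqrt (2 * \<tau>)" "\<lambda>y. f y * of_real (heat \<tau> (x - y))" x]
      by (simp add: heat_minus scaleR_conv_of_real)
    also have "\<dots> = (LINT z|lborel. f (x + sqrt (2 * \<tau>) * z) * of_real (std_normal_density z))"
      by (simp only: mult.left_commute[of "of_real _" "f _"] *)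
    finally show ?thesis .
  qed
  have "(\<lambda>n. LINT z|lborel. f (x + sqrt (2 * \<tau> n) * z) * of_real (std_normal_density z))
      \<longlonglongrightarrow> (LINT z|lborel. f x * of_real (std_normal_density z))"
  proof (rule integral_dominated_convergence[where w = "\<lambda>z. B * std_normal_density z"])
    show "AE z in lborel. (\<lambda>n. f (x + sqrt (2 * \<tau> n) * z) * of_real (std_normal_density z)) \<longlonglongrightarrow> f x * of_real (std_normal_density z)"
    proof (intro AE_I2 tendsto_mult tendsto_const isCont_tendsto_compose[OF \<open>isCont f x\<close>])
      fix z
      have "(\<lambda>n. x + sqrt (2 * \<tau> n) * z) \<longlonglongrightarrow> x + sqrt (2 * 0) * z"
        by (intro tendsto_intros \<tau>)
      then show "(\<lambda>n. x + sqrt (2 * \<tau> n) * z) \<longlonglongrightarrow> x" by simp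
    qed
    show "AE z in lborel. norm (f (x + sqrt (2 * \<tau> n) * z) * of_real (std_normal_density z)) \<le> B * std_normal_density z" for n
      using B by (auto simp: norm_mult intro!: mult_right_mono)
  qed auto
  also have "(LINT z|lborel. f x * complex_of_real (std_normal_density z)) = f x"
    by (simp add: integral_complex_of_real)
  finally show ?thesis using eq \<tau> by simp
qed

lemma integrable_product_lborel:
  fixes f g :: "real \<Rightarrow> complex" and h :: "real \<Rightarrow> real \<Rightarrow> real"
  assumes f: "integrable lborel f" and g: "integrable lborel g"
    and h: "(\<lambda>(x, y). h x y) \<in> borel_measurable (borel \<Otimes>\<^sub>M borel)"
  shows "integrable (lborel \<Otimes>\<^sub>M lborel) (\<lambda>(x, y). cis (h x y) * f x * g y)"
proof (rule lborel_pair.Fubini_integrable)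
  have [measurable]: "f \<in> borel_measurable borel" "g \<in> borel_measurable borel"
    using f g by auto
  note [measurable] = h
  show "(\<lambda>(x, y). cis (h x y) * f x * g y) \<in> borel_measurable (lborel \<Otimes>\<^sub>M lborel)"
    by measurable
  show "integrable lborel (\<lambda>x. LINT y|lborel. norm (case (x, y) of (x, y) \<Rightarrow> cis (h x y) * f x * g y))"
    using f by (simp add: norm_mult integrable_norm)
  show "AE x in lborel. integrable lborel (\<lambda>y. case (x, y) of (x, y) \<Rightarrow> cis (h x y) * f x * g y)"
  proof (rule AE_I2)
    fix x
    have "integrable lborel (\<lambda>y. f x * (cis (h x y) * g y))"
      by (intro integrable_mult_right integrable_cis_mult g) (use h in measurable)
    then show "integrable lborel (\<lambda>y. case (x, y) of (x, y) \<Rightarrow> cis (h x y) * f x * g y)"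
      by (simp add: mult_ac)
  qed
qed

text \<open>Convolution theorem by Fubini. With \<open>g\<close> merely integrable the product with
  the bounded \<open>fourier g\<close> stays integrable because \<open>m\<close> is.\<close>

lemma fourier_inv_mult_fourier:
  assumes m: "integrable lborel m" and g: "integrable lborel g"
  shows "fourier_inv (\<lambda>\<xi>. m \<xi> * fourier g \<xi>) x = (LINT y|lborel. g y * fourier_inv m (x - y))"
proof -
  define c where "c = complex_of_real (1 / (2 * pi))"
  have "fourier_inv (\<lambda>\<xi>. m \<xi> * fourier g \<xi>) x = c * (LINT \<xi>|lborel. LINT y|lborel. cis (x * \<xi> - y * \<xi>) * m \<xi> * g y)"
    unfolding fourier_inv_def fourier_def c_def
    by (subst integral_mult_right_zero[symmetric])
      (simp add: mult_ac cis_mult flip: integral_mult_right_zero)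
  also have "\<dots> = c * (LINT y|lborel. LINT \<xi>|lborel. cis (x * \<xi> - y * \<xi>) * m \<xi> * g y)"
    by (subst lborel_pair.Fubini_integral)
      (use integrable_product_lborel[OF m g, of "\<lambda>\<xi> y. x * \<xi> - y * \<xi>"] in auto)
  also have "\<dots> = (LINT y|lborel. g y * fourier_inv m (x - y))"
    unfolding fourier_inv_def c_def
    by (simp add: algebra_simps flip: integral_mult_right_zero)
  finally show ?thesis .
qed

text \<open>The transposed convolution theorem: the kernel occurs with reversed argument, which is
  the form in which \<open>conv_pairing\<close> puts a convolution on the test function.\<close>

lemma fourier_mult_fourier_inv:
  assumes m: "integrable lborel m" and g: "integrable lborel g"
  shows "fourier (\<lambda>\<xi>. m \<xi> * fourier_inv g \<xi>) x = (LINT y|lborel. g y * fourier_inv m (y - x))"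
proof -
  define c where "c = complex_of_real (1 / (2 * pi))"
  have "fourier (\<lambda>\<xi>. m \<xi> * fourier_inv g \<xi>) x = c * (LINT \<xi>|lborel. LINT y|lborel. cis (y * \<xi> - x * \<xi>) * m \<xi> * g y)"
    unfolding fourier_inv_def fourier_def c_def
    by (simp add: mult_ac cis_mult flip: integral_mult_right_zero)
  also have "\<dots> = c * (LINT y|lborel. LINT \<xi>|lborel. cis (y * \<xi> - x * \<xi>) * m \<xi> * g y)"
    by (subst lborel_pair.Fubini_integral)
      (use integrable_product_lborel[OF m g, of "\<lambda>\<xi> y. y * \<xi> - x * \<xi>"] in auto)
  also have "\<dots> = (LINT y|lborel. g y * fourier_inv m (y - x))"
    unfolding fourier_inv_def c_def
    by (simp add: algebra_simps flip: integral_mult_right_zero)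
  finally show ?thesis .
qed

text \<open>A Gaussian factor on the Fourier side is a heat smoothing of \<open>f\<close> in space.
  Letting \<tau> tend to 0 removes the factor on one side by dominated convergence and the smoothing
  on the other by the approximate identity.\<close>

theorem fourier_inversion:
  assumes f: "f \<in> schwartz"
  shows "fourier_inv (fourier f) = f"
proof
  fix x
  note [measurable] = schwartz_borel[OF f]
  define \<tau> where "\<tau> = (\<lambda>n. inverse (real (Suc n)))"
  have \<tau>: "\<tau> n > 0" "\<tau> \<longlonglongrightarrow> 0" for n
    unfolding \<tau>_def by (simp, rule LIMSEQ_inverse_real_of_nat)
  obtain B where "\<And>x. norm (f x) \<le> B" using schwartz_bounded[OF f] by blast
  then have "(\<lambda>n. LINT y|lborel. f y * of_real (heat (\<tau> n) (x - y))) \<longlonglongrightarrow> f x"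
    using schwartz_continuous[OF f]
    by (intro heat_approximate_identity \<tau>) (auto simp: continuous_on_eq_continuous_at)
  moreover have "(LINT y|lborel. f y * of_real (heat (\<tau> n) (x - y))) =
      fourier_inv (\<lambda>\<xi>. of_real (exp (- \<tau> n * \<xi>\<^sup>2)) * fourier f \<xi>) x" for n
    by (subst fourier_inv_mult_fourier)
      (simp_all only: schwartz_integrable[OF f] schwartz_integrable[OF schwartz_gauss[OF \<tau>(1)]] fourier_inv_gauss[OF \<tau>(1)])
  moreover have "(\<lambda>n. fourier_inv (\<lambda>\<xi>. of_real (exp (- \<tau> n * \<xi>\<^sup>2)) * fourier f \<xi>) x) \<longlonglongrightarrow> fourier_inv (fourier f) x"
    unfolding fourier_inv_def
  proof (intro tendsto_mult tendsto_const integral_dominated_convergence[where w = "\<lambda>\<xi>. norm (fourier f \<xi>)"])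
    show "integrable lborel (\<lambda>\<xi>. norm (fourier f \<xi>))"
      by (intro integrable_norm schwartz_integrable fourier_schwartz f)
    show "AE \<xi> in lborel. (\<lambda>n. cis (x * \<xi>) * (of_real (exp (- \<tau> n * \<xi>\<^sup>2)) * fourier f \<xi>)) \<longlonglongrightarrow> cis (x * \<xi>) * fourier f \<xi>"
    proof (rule AE_I2)
      fix \<xi>
      have "(\<lambda>n. cis (x * \<xi>) * (of_real (exp (- \<tau> n * \<xi>\<^sup>2)) * fourier f \<xi>)) \<longlonglongrightarrow> cis (x * \<xi>) * (of_real (exp (- 0 * \<xi>\<^sup>2)) * fourier f \<xi>)"
        by (intro tendsto_intros \<tau>)
      then show "(\<lambda>n. cis (x * \<xi>) * (of_real (exp (- \<tau> n * \<xi>\<^sup>2)) * fourier f \<xi>)) \<longlonglongrightarrow> cis (x * \<xi>) * fourier f \<xi>" by simp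
    qed
    show "AE \<xi> in lborel. norm (cis (x * \<xi>) * (of_real (exp (- \<tau> n * \<xi>\<^sup>2)) * fourier f \<xi>)) \<le> norm (fourier f \<xi>)" for n
      using \<tau>(1)[of n] by (auto simp: norm_mult intro!: mult_left_le_one_le)
  qed auto
  ultimately show "fourier_inv (fourier f) x = f x"
    using LIMSEQ_unique by auto
qed

section \<open>Plancherel's inequality and convolutions\<close>

text \<open>For a non-integrable \<open>f\<close> the left side is 0 by convention, so the bound may
  be applied before integrability is known.\<close>

lemma ennreal_norm_integral_le:
  fixes f :: "'a \<Rightarrow> 'b::{banach, second_countable_topology}"
  shows "ennreal (norm (integral\<^sup>L M f)) \<le> (\<integral>\<^sup>+x. ennreal (norm (f x)) \<partial>M)"
  by (cases "integrable M f") (auto intro: integral_norm_bound_ennreal simp: not_integrable_integral_eq)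

lemma bounded_fourier_mult_integrable:
  assumes m: "integrable lborel m" and g: "integrable lborel g"
  shows "integrable lborel (\<lambda>\<xi>. m \<xi> * fourier g \<xi>)"
proof (rule Bochner_Integration.integrable_bound)
  have [measurable]: "m \<in> borel_measurable borel" "g \<in> borel_measurable borel"
    using m g by auto
  show "integrable lborel (\<lambda>\<xi>. (LINT x|lborel. norm (g x)) * norm (m \<xi>))"
    by (intro integrable_mult_right integrable_norm m)
  show "(\<lambda>\<xi>. m \<xi> * fourier g \<xi>) \<in> borel_measurable lborel" by measurable
  show "AE \<xi> in lborel. norm (m \<xi> * fourier g \<xi>) \<le> norm ((LINT x|lborel. norm (g x)) * norm (m \<xi>))"
    using norm_fourier_le[of g] by (auto simp: norm_mult abs_mult mult.commute intro!: mult_left_mono)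
qed

text \<open>The Gaussian weight makes the double integral absolutely convergent for \<open>g\<close>
  in L^1; exchanging the integrals turns |fourier g|^2 into the quadratic form of the heat
  kernel.\<close>

lemma gauss_weighted_plancherel:
  assumes g: "integrable lborel g" and "\<epsilon> > 0"
  shows "(LINT \<xi>|lborel. of_real (exp (- \<epsilon> * \<xi>\<^sup>2) * (norm (fourier g \<xi>))\<^sup>2)) =
    of_real (2 * pi) * (LINT y|lborel. cnj (g y) * (LINT x|lborel. g x * of_real (heat \<epsilon> (y - x))))"
proof -
  have [measurable]: "g \<in> borel_measurable borel" using g by auto
  define E where "E = (\<lambda>\<xi>. complex_of_real (exp (- \<epsilon> * \<xi>\<^sup>2)))"
  have E: "integrable lborel E"
    unfolding E_def by (intro schwartz_integrable schwartz_gauss assms)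
  define h where "h = (\<lambda>\<xi>. E \<xi> * fourier g \<xi>)"
  have h: "integrable lborel h"
    unfolding h_def by (intro bounded_fourier_mult_integrable E g)
  have "cnj (fourier g \<xi>) = (LINT y|lborel. cis (y * \<xi>) * cnj (g y))" for \<xi>
  proof -
    have "(LINT y|lborel. cis (y * \<xi>) * cnj (g y)) = (LINT y|lborel. cnj (cis (- (y * \<xi>)) * g y))"
      by (simp add: cis_cnj del: Bochner_Integration.integral_cnj)
    also have "\<dots> = cnj (LINT y|lborel. cis (- (y * \<xi>)) * g y)"
      by (rule Bochner_Integration.integral_cnj)
    finally show ?thesis unfolding fourier_def by (rule sym)
  qed
  moreover have "of_real (exp (- \<epsilon> * \<xi>\<^sup>2) * (norm (fourier g \<xi>))\<^sup>2) = h \<xi> * cnj (fourier g \<xi>)" for \<xi>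
    unfolding h_def E_def by (simp add: complex_norm_square[unfolded of_real_power] mult_ac)
  ultimately have "(LINT \<xi>|lborel. of_real (exp (- \<epsilon> * \<xi>\<^sup>2) * (norm (fourier g \<xi>))\<^sup>2)) =
      (LINT \<xi>|lborel. LINT y|lborel. cis (y * \<xi>) * h \<xi> * cnj (g y))"
    by (simp add: mult_ac flip: integral_mult_right_zero)
  also have "\<dots> = (LINT y|lborel. LINT \<xi>|lborel. cis (y * \<xi>) * h \<xi> * cnj (g y))"
    by (subst lborel_pair.Fubini_integral)
      (use integrable_product_lborel[OF h, of "\<lambda>y. cnj (g y)" "\<lambda>\<xi> y. y * \<xi>"] g in auto)
  also have "\<dots> = (LINT y|lborel. of_real (2 * pi) * (cnj (g y) * fourier_inv h y))"
  proof (intro Bochner_Integration.integral_cong refl)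
    fix y
    have "of_real (2 * pi) * (cnj (g y) * fourier_inv h y) = cnj (g y) * (LINT \<xi>|lborel. cis (y * \<xi>) * h \<xi>)"
      by (simp add: fourier_inv_def)
    also have "\<dots> = (LINT \<xi>|lborel. cis (y * \<xi>) * h \<xi> * cnj (g y))"
      by (simp add: mult_ac flip: integral_mult_right_zero)
    finally show "(LINT \<xi>|lborel. cis (y * \<xi>) * h \<xi> * cnj (g y)) = of_real (2 * pi) * (cnj (g y) * fourier_inv h y)" ..
  qed
  also have "\<dots> = of_real (2 * pi) * (LINT y|lborel. cnj (g y) * fourier_inv h y)"
    by (simp only: integral_mult_right_zero)
  also have "fourier_inv h = (\<lambda>y. LINT x|lborel. g x * of_real (heat \<epsilon> (y - x)))"
    unfolding h_def fourier_inv_mult_fourier[OF E g, abs_def] unfolding E_def fourier_inv_gauss[OF \<open>\<epsilon> > 0\<close>] ..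
  finally show ?thesis .
qed

text \<open>Schur's test: \<open>2 a b \<le> a^2 + b^2\<close> decouples the two factors, and the
  kernel has unit mass in either variable.\<close>

lemma heat_quadratic_form_le:
  fixes g :: "real \<Rightarrow> complex"
  assumes [measurable]: "g \<in> borel_measurable borel" and "\<epsilon> > 0"
  shows "(\<integral>\<^sup>+y. \<integral>\<^sup>+x. ennreal (norm (g y) * norm (g x) * heat \<epsilon> (y - x)) \<partial>lborel \<partial>lborel)
    \<le> (\<integral>\<^sup>+y. ennreal ((norm (g y))\<^sup>2) \<partial>lborel)"
proof -
  let ?N = "\<integral>\<^sup>+y. ennreal ((norm (g y))\<^sup>2) \<partial>lborel"
  let ?a = "\<lambda>y x. ennreal ((norm (g y))\<^sup>2) * ennreal (heat \<epsilon> (y - x))"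
  let ?b = "\<lambda>y x. ennreal ((norm (g x))\<^sup>2) * ennreal (heat \<epsilon> (y - x))"
  have [measurable]: "(\<lambda>(y, x). heat \<epsilon> (y - x)) \<in> borel_measurable (borel \<Otimes>\<^sub>M borel)"
    by measurable
  have a: "(\<integral>\<^sup>+y. \<integral>\<^sup>+x. ?a y x \<partial>lborel \<partial>lborel) = ?N"
    using assms(2) by (simp add: nn_integral_cmult nn_integral_heat_translate)
  have "(\<integral>\<^sup>+y. \<integral>\<^sup>+x. ?b y x \<partial>lborel \<partial>lborel) = (\<integral>\<^sup>+x. \<integral>\<^sup>+y. ?b y x \<partial>lborel \<partial>lborel)"
    by (intro lborel_pair.Fubini') measurable
  also have "\<dots> = ?N"
    using assms(2) by (simp add: nn_integral_cmult nn_integral_heat_translate)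
  finally have b: "(\<integral>\<^sup>+y. \<integral>\<^sup>+x. ?b y x \<partial>lborel \<partial>lborel) = ?N" .
  have "(\<integral>\<^sup>+y. \<integral>\<^sup>+x. ennreal (norm (g y) * norm (g x) * heat \<epsilon> (y - x)) \<partial>lborel \<partial>lborel)
    \<le> (\<integral>\<^sup>+y. \<integral>\<^sup>+x. ennreal (1/2) * (?a y x + ?b y x) \<partial>lborel \<partial>lborel)"
  proof (intro nn_integral_mono)
    fix x y
    have "norm (g y) * norm (g x) \<le> 1/2 * ((norm (g y))\<^sup>2 + (norm (g x))\<^sup>2)"
      using sum_squares_bound[of "norm (g y)" "norm (g x)"] by simp
    then have "norm (g y) * norm (g x) * heat \<epsilon> (y - x) \<le> 1/2 * ((norm (g y))\<^sup>2 * heat \<epsilon> (y - x) + (norm (g x))\<^sup>2 * heat \<epsilon> (y - x))"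
      using mult_right_mono[OF _ heat_nonneg[of \<epsilon> "y - x"]] by (metis distrib_right mult.assoc)
    then have "ennreal (norm (g y) * norm (g x) * heat \<epsilon> (y - x)) \<le> ennreal (1/2 * ((norm (g y))\<^sup>2 * heat \<epsilon> (y - x) + (norm (g x))\<^sup>2 * heat \<epsilon> (y - x)))"
      by (rule ennreal_leI)
    also have "\<dots> = ennreal (1/2) * (?a y x + ?b y x)"
      by (subst ennreal_mult') (auto simp: ennreal_mult heat_nonneg)
    finally show "ennreal (norm (g y) * norm (g x) * heat \<epsilon> (y - x)) \<le> ennreal (1/2) * (?a y x + ?b y x)" .
  qed
  also have "\<dots> = ennreal (1/2) * (?N + ?N)"
    using assms(2) a b by (simp add: nn_integral_cmult nn_integral_add nn_integral_heat_translate del: ennreal_half)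
  also have "\<dots> = (ennreal (1/2) * ennreal 2) * ?N"
    by (simp only: mult.assoc ennreal_numeral mult_2)
  also have "ennreal (1/2) * ennreal 2 = 1"
    by (subst ennreal_mult[symmetric]) auto
  finally show ?thesis by simp
qed

text \<open>The weighted bound is uniform in the weight, so Fatou's lemma removes it. This yields
  one inequality of Plancherel's theorem; if \<open>g\<close> is not square integrable the right
  side is infinite.\<close>

lemma fourier_L2_le:
  assumes g: "integrable lborel g"
  shows "(\<integral>\<^sup>+\<xi>. ennreal ((norm (fourier g \<xi>))\<^sup>2) \<partial>lborel) \<le> ennreal (2 * pi) * (\<integral>\<^sup>+y. ennreal ((norm (g y))\<^sup>2) \<partial>lborel)"
proof -
  have [measurable]: "g \<in> borel_measurable borel" using g by auto
  let ?N = "\<integral>\<^sup>+y. ennreal ((norm (g y))\<^sup>2) \<partial>lborel"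
  define \<tau> where "\<tau> = (\<lambda>n. inverse (real (Suc n)))"
  have \<tau>: "\<tau> n > 0" "\<tau> \<longlonglongrightarrow> 0" for n
    unfolding \<tau>_def by (simp, rule LIMSEQ_inverse_real_of_nat)
  define e where "e = (\<lambda>n \<xi>. exp (- \<tau> n * \<xi>\<^sup>2) * (norm (fourier g \<xi>))\<^sup>2)"
  have e_nn: "e n \<xi> \<ge> 0" for n \<xi> by (simp add: e_def)
  have bound: "(\<integral>\<^sup>+\<xi>. ennreal (e n \<xi>) \<partial>lborel) \<le> ennreal (2 * pi) * ?N" for n
  proof -
    have "integrable lborel (\<lambda>\<xi>. complex_of_real (exp (- \<tau> n * \<xi>\<^sup>2)) * fourier g \<xi>)"
      by (intro bounded_fourier_mult_integrable schwartz_integrable schwartz_gauss \<tau> g)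
    then have "integrable lborel (\<lambda>\<xi>. norm (complex_of_real (exp (- \<tau> n * \<xi>\<^sup>2)) * fourier g \<xi>) * (LINT x|lborel. norm (g x)))"
      by (intro integrable_mult_left integrable_norm)
    \<comment> \<open>One of the two factors |fourier g| is bounded by the L^1 norm of
      \<open>g\<close>; the other is integrable against the Gaussian.\<close>
    then have int: "integrable lborel (e n)"
      by (rule Bochner_Integration.integrable_bound)
        (auto simp: e_def norm_mult power2_eq_square mult.assoc norm_fourier_le intro!: mult_left_mono AE_I2)
    have "(\<integral>\<^sup>+\<xi>. ennreal (e n \<xi>) \<partial>lborel) = ennreal (LINT \<xi>|lborel. e n \<xi>)"
      by (intro nn_integral_eq_integral int AE_I2 e_nn)
    also have "\<dots> = ennreal (norm (complex_of_real (LINT \<xi>|lborel. e n \<xi>)))"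
      by (simp add: e_nn)
    also have "complex_of_real (LINT \<xi>|lborel. e n \<xi>) = (LINT \<xi>|lborel. of_real (e n \<xi>))"
      by (simp only: integral_complex_of_real)
    also have "\<dots> = of_real (2 * pi) * (LINT y|lborel. cnj (g y) * (LINT x|lborel. g x * of_real (heat (\<tau> n) (y - x))))"
      unfolding e_def by (rule gauss_weighted_plancherel[OF g \<tau>(1)])
    also have "norm \<dots> = 2 * pi * norm (LINT y|lborel. cnj (g y) * (LINT x|lborel. g x * of_real (heat (\<tau> n) (y - x))))"
      by (simp add: norm_mult)
    also have "ennreal \<dots> = ennreal (2 * pi) * ennreal (norm (LINT y|lborel. cnj (g y) * (LINT x|lborel. g x * of_real (heat (\<tau> n) (y - x)))))"
      by (simp add: ennreal_mult)
    also have "\<dots> \<le> ennreal (2 * pi) * (\<integral>\<^sup>+y. ennreal (norm (g y) * norm (LINT x|lborel. g x * of_real (heat (\<tau> n) (y - x)))) \<partial>lborel)"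
      by (intro mult_left_mono order_trans[OF ennreal_norm_integral_le]) (auto simp: norm_mult)
    also have "\<dots> \<le> ennreal (2 * pi) * (\<integral>\<^sup>+y. \<integral>\<^sup>+x. ennreal (norm (g y) * norm (g x) * heat (\<tau> n) (y - x)) \<partial>lborel \<partial>lborel)"
    proof (intro mult_left_mono nn_integral_mono)
      fix y
      have "ennreal (norm (g y) * norm (LINT x|lborel. g x * of_real (heat (\<tau> n) (y - x)))) \<le>
          ennreal (norm (g y)) * (\<integral>\<^sup>+x. ennreal (norm (g x * of_real (heat (\<tau> n) (y - x)))) \<partial>lborel)"
        by (subst ennreal_mult) (auto intro!: mult_left_mono ennreal_norm_integral_le)
      also have "\<dots> = (\<integral>\<^sup>+x. ennreal (norm (g y) * norm (g x) * heat (\<tau> n) (y - x)) \<partial>lborel)"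
        by (subst nn_integral_cmult[symmetric])
          (auto simp: norm_mult heat_nonneg mult.assoc ennreal_mult')
      finally show "ennreal (norm (g y) * norm (LINT x|lborel. g x * of_real (heat (\<tau> n) (y - x)))) \<le> \<dots>" .
    qed auto
    also have "\<dots> \<le> ennreal (2 * pi) * ?N"
      by (intro mult_left_mono heat_quadratic_form_le \<tau>) auto
    finally show ?thesis .
  qed
  have "(\<lambda>n. ennreal (e n \<xi>)) \<longlonglongrightarrow> ennreal ((norm (fourier g \<xi>))\<^sup>2)" for \<xi>
  proof -
    have "(\<lambda>n. e n \<xi>) \<longlonglongrightarrow> exp (- 0 * \<xi>\<^sup>2) * (norm (fourier g \<xi>))\<^sup>2"
      unfolding e_def by (intro tendsto_intros \<tau>)
    then show ?thesis by (intro tendsto_ennrealI) simp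
  qed
  then have "(\<integral>\<^sup>+\<xi>. ennreal ((norm (fourier g \<xi>))\<^sup>2) \<partial>lborel) = (\<integral>\<^sup>+\<xi>. liminf (\<lambda>n. ennreal (e n \<xi>)) \<partial>lborel)"
    by (intro nn_integral_cong lim_imp_Liminf[symmetric]) auto
  also have "\<dots> \<le> liminf (\<lambda>n. \<integral>\<^sup>+\<xi>. ennreal (e n \<xi>) \<partial>lborel)"
    by (rule nn_integral_liminf) (simp add: e_def)
  also have "\<dots> \<le> ennreal (2 * pi) * ?N"
    by (intro Liminf_le) (use bound in auto)
  finally show ?thesis .
qed

section \<open>Convolution with Schwartz kernels\<close>

definition conv :: "(real \<Rightarrow> complex) \<Rightarrow> (real \<Rightarrow> complex) \<Rightarrow> real \<Rightarrow> complex" where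
  "conv k f x = (LINT y|lborel. f y * k (x - y))"

lemma conv_measurable [measurable]:
  assumes [measurable]: "k \<in> borel_measurable borel" "f \<in> borel_measurable borel"
  shows "conv k f \<in> borel_measurable borel"
  unfolding conv_def by measurable

lemma le_one_plus_powr:
  fixes a p :: real
  assumes "a \<ge> 0" "p \<ge> 1"
  shows "a \<le> 1 + a powr p"
proof (cases "a \<le> 1")
  case False
  then have "a powr 1 \<le> a powr p" using assms by (intro powr_mono) auto
  then show ?thesis using False by simp
qed (simp add: add_increasing2)

lemma schwartz_integrable_translate:
  assumes "k \<in> schwartz"
  shows "integrable lborel (\<lambda>y. k (x - y))"
  using lborel_integrable_real_affine[OF schwartz_integrable[OF assms], of "-1" x] by simp

lemma nn_integral_powr_integrable:
  fixes f :: "real \<Rightarrow> complex"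
  assumes [measurable]: "f \<in> borel_measurable borel"
    and "(\<integral>\<^sup>+x. ennreal (norm (f x) powr p) \<partial>lborel) < \<infinity>"
  shows "integrable lborel (\<lambda>x. norm (f x) powr p)"
  using assms by (intro integrableI_bounded) auto

text \<open>Takes the place of Hoelder's inequality: since \<open>a \<le> 1 + a powr p\<close>, the
  summand 1 is absorbed by integrability of \<open>k\<close> and the summand |f|^p by its
  boundedness.\<close>

lemma schwartz_integrable_mult:
  fixes f :: "real \<Rightarrow> complex"
  assumes [measurable]: "f \<in> borel_measurable borel" and k: "k \<in> borel_measurable borel" "integrable lborel k"
    "\<And>x. norm (k x) \<le> B"
    and p: "p \<ge> 1" and f: "integrable lborel (\<lambda>x. norm (f x) powr p)"
  shows "integrable lborel (\<lambda>y. f y * k y)"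
proof (rule Bochner_Integration.integrable_bound)
  note [measurable] = k(1)
  show "integrable lborel (\<lambda>y. norm (k y) + B * norm (f y) powr p)"
    by (intro Bochner_Integration.integrable_add integrable_norm k integrable_mult_right f)
  have "norm (f y * k y) \<le> norm (k y) + B * norm (f y) powr p" for y
  proof -
    have "norm (f y * k y) \<le> (1 + norm (f y) powr p) * norm (k y)"
      unfolding norm_mult using p by (intro mult_right_mono le_one_plus_powr) auto
    also have "\<dots> \<le> norm (k y) + B * norm (f y) powr p"
      using mult_right_mono[OF k(3)[of y], of "norm (f y) powr p"] by (simp add: algebra_simps)
    finally show ?thesis .
  qed
  then show "AE y in lborel. norm (f y * k y) \<le> norm (norm (k y) + B * norm (f y) powr p)"
    by (intro AE_I2) (metis abs_ge_self order_trans real_norm_def)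
  show "(\<lambda>y. f y * k y) \<in> borel_measurable lborel" by measurable
qed

lemma conv_integrable:
  assumes f: "f \<in> borel_measurable borel" and "p \<ge> 1"
    and "integrable lborel (\<lambda>x. norm (f x) powr p)" and k: "k \<in> schwartz"
  shows "integrable lborel (\<lambda>y. f y * k (x - y))"
proof -
  note [measurable] = schwartz_borel[OF k]
  obtain B where B: "\<And>x. norm (k x) \<le> B" using schwartz_bounded[OF k] by blast
  show ?thesis
    by (rule schwartz_integrable_mult[OF f _ schwartz_integrable_translate[OF k] B assms(2,3)]) measurable
qed

text \<open>Plancherel's inequality is used twice, for the inverse transform of
  \<open>m * fourier g\<close> and for \<open>g\<close> itself. The two factors 2 pi cancel the
  square of the 1 / (2 pi) in \<open>fourier_inv\<close>, so the constant is exactly the bound on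
  the symbol.\<close>

lemma conv_L2_integrable:
  assumes m: "m \<in> schwartz" and A: "\<And>\<xi>. norm (m \<xi>) \<le> A" and g: "integrable lborel g"
  shows "(\<integral>\<^sup>+x. ennreal ((norm (conv (fourier_inv m) g x))\<^sup>2) \<partial>lborel) \<le> ennreal (A\<^sup>2) * (\<integral>\<^sup>+x. ennreal ((norm (g x))\<^sup>2) \<partial>lborel)"
proof -
  have [measurable]: "g \<in> borel_measurable borel" "m \<in> borel_measurable borel"
    using g schwartz_borel[OF m] by auto
  define h where "h = (\<lambda>\<xi>. m \<xi> * fourier g \<xi>)"
  have h: "integrable lborel h"
    unfolding h_def by (intro bounded_fourier_mult_integrable schwartz_integrable m g)
  then have [measurable]: "h \<in> borel_measurable borel" by auto
  have "conv (fourier_inv m) g x = fourier_inv h x" for x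
    unfolding conv_def fourier_inv_mult_fourier[OF schwartz_integrable[OF m] g, symmetric] h_def ..
  then have "conv (fourier_inv m) g x = of_real (1 / (2 * pi)) * fourier h (- x)" for x
    by (simp only: fourier_inv_eq)
  then have "(\<integral>\<^sup>+x. ennreal ((norm (conv (fourier_inv m) g x))\<^sup>2) \<partial>lborel) =
      (\<integral>\<^sup>+x. ennreal ((1 / (2 * pi))\<^sup>2) * ennreal ((norm (fourier h (- x)))\<^sup>2) \<partial>lborel)"
    by (simp add: norm_mult power_mult_distrib norm_divide power_divide flip: ennreal_mult)
  also have "\<dots> = ennreal ((1 / (2 * pi))\<^sup>2) * (\<integral>\<^sup>+x. ennreal ((norm (fourier h (- x)))\<^sup>2) \<partial>lborel)"
    by (intro nn_integral_cmult) measurable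
  also have "(\<integral>\<^sup>+x. ennreal ((norm (fourier h (- x)))\<^sup>2) \<partial>lborel) = (\<integral>\<^sup>+x. ennreal ((norm (fourier h x))\<^sup>2) \<partial>lborel)"
    using nn_integral_real_affine[of "\<lambda>x. ennreal ((norm (fourier h x))\<^sup>2)" "-1" 0] by simp
  also have "ennreal ((1 / (2 * pi))\<^sup>2) * \<dots> \<le> ennreal ((1 / (2 * pi))\<^sup>2) * (ennreal (2 * pi) * (\<integral>\<^sup>+x. ennreal ((norm (h x))\<^sup>2) \<partial>lborel))"
    by (intro mult_left_mono fourier_L2_le h) auto
  also have "(\<integral>\<^sup>+x. ennreal ((norm (h x))\<^sup>2) \<partial>lborel) \<le> (\<integral>\<^sup>+x. ennreal (A\<^sup>2) * ennreal ((norm (fourier g x))\<^sup>2) \<partial>lborel)"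
  proof (intro nn_integral_mono)
    fix \<xi>
    have "(norm (h \<xi>))\<^sup>2 \<le> A\<^sup>2 * (norm (fourier g \<xi>))\<^sup>2"
      unfolding h_def norm_mult power_mult_distrib
      by (intro mult_right_mono power_mono A) auto
    then show "ennreal ((norm (h \<xi>))\<^sup>2) \<le> ennreal (A\<^sup>2) * ennreal ((norm (fourier g \<xi>))\<^sup>2)"
      by (simp add: ennreal_leI flip: ennreal_mult)
  qed
  also have "\<dots> = ennreal (A\<^sup>2) * (\<integral>\<^sup>+x. ennreal ((norm (fourier g x))\<^sup>2) \<partial>lborel)"
    by (intro nn_integral_cmult) measurable
  also have "\<dots> \<le> ennreal (A\<^sup>2) * (ennreal (2 * pi) * (\<integral>\<^sup>+x. ennreal ((norm (g x))\<^sup>2) \<partial>lborel))"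
    by (intro mult_left_mono fourier_L2_le g) auto
  also have "ennreal ((1 / (2 * pi))\<^sup>2) * (ennreal (2 * pi) * (ennreal (A\<^sup>2) * (ennreal (2 * pi) * (\<integral>\<^sup>+x. ennreal ((norm (g x))\<^sup>2) \<partial>lborel))))
      = ennreal ((1 / (2 * pi))\<^sup>2 * (2 * pi) * A\<^sup>2 * (2 * pi)) * (\<integral>\<^sup>+x. ennreal ((norm (g x))\<^sup>2) \<partial>lborel)"
    by (simp only: ennreal_mult' zero_le_power2 mult_nonneg_nonneg pi_ge_zero zero_le_numeral mult.assoc)
  also have "(1 / (2 * pi))\<^sup>2 * (2 * pi) * A\<^sup>2 * (2 * pi) = A\<^sup>2"
    by (simp add: power2_eq_square)
  finally show ?thesis by (simp add: mult_left_mono)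
qed

text \<open>The convolution theorem needs an integrable function, so \<open>g\<close> is truncated
  to bounded intervals: there \<open>\<bar>g\<bar> \<le> 1 + \<bar>g\<bar>^2\<close> is integrable.
  The truncated convolutions converge pointwise and Fatou's lemma keeps the bound.\<close>

lemma conv_L2:
  assumes m: "m \<in> schwartz" and A: "\<And>\<xi>. norm (m \<xi>) \<le> A"
    and [measurable]: "g \<in> borel_measurable borel" and g: "(\<integral>\<^sup>+x. ennreal ((norm (g x))\<^sup>2) \<partial>lborel) < \<infinity>"
  shows "(\<integral>\<^sup>+x. ennreal ((norm (conv (fourier_inv m) g x))\<^sup>2) \<partial>lborel) \<le> ennreal (A\<^sup>2) * (\<integral>\<^sup>+x. ennreal ((norm (g x))\<^sup>2) \<partial>lborel)"
proof -
  define k where "k = fourier_inv m"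
  have k: "k \<in> schwartz" unfolding k_def by (intro fourier_inv_schwartz m)
  note [measurable] = schwartz_borel[OF k]
  define G where "G = (\<lambda>n::nat. \<lambda>x. indicator {- real n..real n} x * g x)"
  have [measurable]: "G n \<in> borel_measurable borel" for n unfolding G_def by measurable
  have sq: "norm (g x) powr 2 = (norm (g x))\<^sup>2" for x by (simp add: powr_numeral)
  have g2: "integrable lborel (\<lambda>x. norm (g x) powr 2)"
    using g by (intro nn_integral_powr_integrable) (auto simp: sq)
  have G_le: "norm (G n x) \<le> norm (g x)" for n x
    by (auto simp: G_def indicator_def)
  have G: "integrable lborel (G n)" for n
  proof (rule Bochner_Integration.integrable_bound)
    show "integrable lborel (\<lambda>x. indicator {- real n..real n} x + norm (g x) powr 2)"
      by (intro Bochner_Integration.integrable_add g2) simp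
    show "AE x in lborel. norm (G n x) \<le> norm (indicator {- real n..real n} x + norm (g x) powr 2)"
      using le_one_plus_powr[of "norm (g _)" 2]
      by (intro AE_I2) (auto simp: G_def indicator_def)
  qed measurable
  have bound: "(\<integral>\<^sup>+x. ennreal ((norm (conv k (G n) x))\<^sup>2) \<partial>lborel) \<le> ennreal (A\<^sup>2) * (\<integral>\<^sup>+x. ennreal ((norm (g x))\<^sup>2) \<partial>lborel)" for n
    unfolding k_def
    by (rule order_trans[OF conv_L2_integrable[OF m A G]])
      (intro mult_left_mono nn_integral_mono ennreal_leI power_mono G_le; simp)
  have lim: "(\<lambda>n. conv k (G n) x) \<longlonglongrightarrow> conv k g x" for x
    unfolding conv_def
  proof (rule integral_dominated_convergence[where w = "\<lambda>y. norm (g y * k (x - y))"])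
    show "integrable lborel (\<lambda>y. norm (g y * k (x - y)))"
      by (intro integrable_norm conv_integrable[OF _ _ g2 k]) auto
    show "AE y in lborel. norm (G n y * k (x - y)) \<le> norm (g y * k (x - y))" for n
      using G_le by (auto simp: norm_mult intro!: mult_right_mono)
    show "AE y in lborel. (\<lambda>n. G n y * k (x - y)) \<longlonglongrightarrow> g y * k (x - y)"
    proof (rule AE_I2)
      fix y
      have "\<forall>\<^sub>F n in sequentially. G n y * k (x - y) = g y * k (x - y)"
        using eventually_ge_at_top[of "nat \<lceil>\<bar>y\<bar>\<rceil>"]
      proof eventually_elim
        case (elim n)
        then have "\<bar>y\<bar> \<le> real n" by linarith
        then show ?case by (simp add: G_def indicator_def abs_le_iff minus_le_iff)
      qed
      then show "(\<lambda>n. G n y * k (x - y)) \<longlonglongrightarrow> g y * k (x - y)"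
        by (rule tendsto_eventually)
    qed
  qed measurable
  have "(\<integral>\<^sup>+x. ennreal ((norm (conv k g x))\<^sup>2) \<partial>lborel) = (\<integral>\<^sup>+x. liminf (\<lambda>n. ennreal ((norm (conv k (G n) x))\<^sup>2)) \<partial>lborel)"
    by (intro nn_integral_cong lim_imp_Liminf[symmetric] tendsto_ennrealI tendsto_intros lim) simp
  also have "\<dots> \<le> liminf (\<lambda>n. \<integral>\<^sup>+x. ennreal ((norm (conv k (G n) x))\<^sup>2) \<partial>lborel)"
    by (rule nn_integral_liminf) measurable
  also have "\<dots> \<le> ennreal (A\<^sup>2) * (\<integral>\<^sup>+x. ennreal ((norm (g x))\<^sup>2) \<partial>lborel)"
    by (intro Liminf_le) (use bound in auto)
  finally show ?thesis by (simp add: k_def)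
qed

section \<open>Minkowski's integral inequality and vanishing averages\<close>

text \<open>Young's inequality, with equality at \<open>a = c\<close>. It bounds \<open>a\<close> by
  an affine function of \<open>a powr p\<close> with a free parameter \<open>c\<close>; optimising
  \<open>c\<close> after integration recovers Jensen's and Hoelder's inequalities.\<close>

lemma powr_tangent_le:
  fixes a c p :: real
  assumes "a \<ge> 0" "c > 0" "p \<ge> 1"
  shows "a \<le> a powr p * c powr (1 - p) / p + (1 - 1 / p) * c"
proof (cases "a = 0")
  case True
  then show ?thesis using assms by simp
next
  case False
  then have "(a powr p * c powr (1 - p)) powr (1 / p) * c powr (1 - 1 / p)
      \<le> (1 / p) * (a powr p * c powr (1 - p)) + (1 - 1 / p) * c"
    using assms by (intro Youngs_inequality_0) auto
  also have "(a powr p * c powr (1 - p)) powr (1 / p) * c powr (1 - 1 / p) = a * c powr ((1 - p) / p + (1 - 1 / p))"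
    using assms False by (simp add: powr_mult powr_powr powr_add)
  also have "(1 - p) / p + (1 - 1 / p) = 0" using assms by (simp add: field_simps)
  finally show ?thesis using assms by simp
qed

text \<open>The proof is Jensen's inequality for the measure with density \<open>N\<close>.\<close>

lemma minkowski_integral:
  fixes g :: "'a \<Rightarrow> 'b \<Rightarrow> real" and N :: "'a \<Rightarrow> real"
  assumes "sigma_finite_measure M" "sigma_finite_measure L"
    and meas [measurable]: "(\<lambda>(\<tau>, x). g \<tau> x) \<in> borel_measurable (M \<Otimes>\<^sub>M L)"
    and g: "\<And>\<tau> x. g \<tau> x \<ge> 0" and N: "\<And>\<tau>. N \<tau> \<ge> 0" "integrable M N" and p: "p \<ge> 1"
    and bound: "AE \<tau> in M. (\<integral>\<^sup>+x. ennreal (g \<tau> x powr p) \<partial>L) \<le> ennreal (N \<tau> powr p)"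
  shows "AE x in L. integrable M (\<lambda>\<tau>. g \<tau> x)"
    and "(\<integral>\<^sup>+x. ennreal ((LINT \<tau>|M. g \<tau> x) powr p) \<partial>L) \<le> ennreal ((LINT \<tau>|M. N \<tau>) powr p)"
proof -
  interpret pair_sigma_finite M L
    using assms(1,2) by (simp add: pair_sigma_finite_def)
  have Nmeas [measurable]: "N \<in> borel_measurable M" using N(2) by auto
  define S where "S = (LINT \<tau>|M. N \<tau>)"
  \<comment> \<open>On \<open>N > 0\<close> this is \<open>(g / N) powr p * N\<close>, the integrand
    of Jensen's inequality. Where \<open>N = 0\<close> it is 0 by the convention for
    \<open>powr\<close>.\<close>
  define W where "W = (\<lambda>\<tau> x. g \<tau> x powr p * N \<tau> powr (1 - p))"
  have Wmeas [measurable]: "(\<lambda>(\<tau>, x). W \<tau> x) \<in> borel_measurable (M \<Otimes>\<^sub>M L)"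
    unfolding W_def by measurable
  have W_nn: "W \<tau> x \<ge> 0" for \<tau> x by (simp add: W_def)
  have "(\<integral>\<^sup>+x. \<integral>\<^sup>+\<tau>. ennreal (W \<tau> x) \<partial>M \<partial>L) = (\<integral>\<^sup>+\<tau>. \<integral>\<^sup>+x. ennreal (W \<tau> x) \<partial>L \<partial>M)"
    by (rule Fubini') measurable
  also have "\<dots> = (\<integral>\<^sup>+\<tau>. ennreal (N \<tau> powr (1 - p)) * (\<integral>\<^sup>+x. ennreal (g \<tau> x powr p) \<partial>L) \<partial>M)"
  proof (intro nn_integral_cong)
    fix \<tau> assume "\<tau> \<in> space M"
    then have "(\<lambda>x. g \<tau> x) \<in> borel_measurable L" using meas by measurable
    then show "(\<integral>\<^sup>+x. ennreal (W \<tau> x) \<partial>L) = ennreal (N \<tau> powr (1 - p)) * (\<integral>\<^sup>+x. ennreal (g \<tau> x powr p) \<partial>L)"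
      by (subst nn_integral_cmult[symmetric]) (auto simp: W_def ennreal_mult mult.commute)
  qed
  also have "\<dots> \<le> (\<integral>\<^sup>+\<tau>. ennreal (N \<tau>) \<partial>M)"
  proof (intro nn_integral_mono_AE)
    show "AE \<tau> in M. ennreal (N \<tau> powr (1 - p)) * (\<integral>\<^sup>+x. ennreal (g \<tau> x powr p) \<partial>L) \<le> ennreal (N \<tau>)"
      using bound
    proof eventually_elim
      case (elim \<tau>)
      have "ennreal (N \<tau> powr (1 - p)) * (\<integral>\<^sup>+x. ennreal (g \<tau> x powr p) \<partial>L) \<le> ennreal (N \<tau> powr (1 - p)) * ennreal (N \<tau> powr p)"
        by (intro mult_left_mono elim) simp
      also have "\<dots> = ennreal (N \<tau>)"
        using N(1)[of \<tau>] by (simp add: powr_add[symmetric] flip: ennreal_mult)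
      finally show ?case .
    qed
  qed
  also have "\<dots> = ennreal S"
    unfolding S_def by (intro nn_integral_eq_integral N AE_I2)
  finally have W_le: "(\<integral>\<^sup>+x. \<integral>\<^sup>+\<tau>. ennreal (W \<tau> x) \<partial>M \<partial>L) \<le> ennreal S" .
  have "AE x in L. (\<integral>\<^sup>+\<tau>. ennreal (W \<tau> x) \<partial>M) \<noteq> \<infinity>"
  proof (rule nn_integral_PInf_AE)
    show "(\<lambda>x. \<integral>\<^sup>+\<tau>. ennreal (W \<tau> x) \<partial>M) \<in> borel_measurable L" by measurable
    show "(\<integral>\<^sup>+x. \<integral>\<^sup>+\<tau>. ennreal (W \<tau> x) \<partial>M \<partial>L) \<noteq> \<infinity>"
      using W_le by (metis ennreal_neq_top infinity_ennreal_def neq_top_trans)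
  qed
  then have W_int: "AE x in L. integrable M (\<lambda>\<tau>. W \<tau> x)"
    using AE_space
  proof eventually_elim
    case (elim x)
    have "(\<lambda>\<tau>. W \<tau> x) \<in> borel_measurable M" using Wmeas elim(2) by measurable
    then show ?case
      using elim(1) W_nn by (intro integrableI_bounded) (auto simp: less_top)
  qed
  \<comment> \<open>On the zero set of \<open>N\<close> the function \<open>W\<close> carries no
    information, so there \<open>g\<close> itself has to vanish for the tangent inequality to
    survive.\<close>
  have "AE \<tau> in M. AE x in L. N \<tau> = 0 \<longrightarrow> g \<tau> x = 0"
    using bound AE_space
  proof eventually_elim
    case (elim \<tau>)
    have [measurable]: "(\<lambda>x. g \<tau> x) \<in> borel_measurable L" using meas elim(2) by measurable
    show ?case
    proof (cases "N \<tau> = 0")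
      case True
      then have "(\<integral>\<^sup>+x. ennreal (g \<tau> x powr p) \<partial>L) = 0" using elim(1) by simp
      then have "AE x in L. ennreal (g \<tau> x powr p) = 0" by (subst (asm) nn_integral_0_iff_AE) auto
      then show ?thesis by eventually_elim (simp add: ennreal_eq_0_iff)
    qed simp
  qed
  then have zero: "AE x in L. AE \<tau> in M. N \<tau> = 0 \<longrightarrow> g \<tau> x = 0"
    by (subst (asm) AE_commute) measurable
  \<comment> \<open>The quantifier over \<open>c\<close> stands inside the first \<open>AE\<close>
    because the optimal \<open>c\<close> depends on \<open>x\<close>.\<close>
  have tangent: "AE x in L. \<forall>c>0. AE \<tau> in M. g \<tau> x \<le> W \<tau> x * c powr (1 - p) / p + (1 - 1 / p) * (N \<tau> * c)"
    using zero
  proof eventually_elim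
    case (elim x)
    show ?case
    proof (intro allI impI)
      fix c :: real assume "c > 0"
      show "AE \<tau> in M. g \<tau> x \<le> W \<tau> x * c powr (1 - p) / p + (1 - 1 / p) * (N \<tau> * c)"
        using elim
      proof eventually_elim
        case (elim \<tau>)
        show ?case
        proof (cases "N \<tau> = 0")
          case False
          then have "N \<tau> > 0" using N(1)[of \<tau>] by simp
          then show ?thesis
            using powr_tangent_le[of "g \<tau> x" "N \<tau> * c" p] g p \<open>c > 0\<close>
            by (simp add: W_def powr_mult mult.assoc)
        qed (use elim p in \<open>simp add: W_def\<close>)
      qed
    qed
  qed
  show int: "AE x in L. integrable M (\<lambda>\<tau>. g \<tau> x)"
    using W_int tangent AE_space
  proof eventually_elim
    case (elim x)
    have m: "(\<lambda>\<tau>. g \<tau> x) \<in> borel_measurable M" using meas elim(3) by measurable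
    show ?case
    proof (rule Bochner_Integration.integrable_bound[OF _ m])
      \<comment> \<open>Any fixed \<open>c\<close> gives an integrable majorant;
        \<open>c = 1\<close> is taken.\<close>
      show "integrable M (\<lambda>\<tau>. W \<tau> x * 1 powr (1 - p) / p + (1 - 1 / p) * (N \<tau> * 1))"
        using elim(1) N(2) by (intro Bochner_Integration.integrable_add integrable_mult_right integrable_mult_left integrable_divide)
      have "AE \<tau> in M. g \<tau> x \<le> W \<tau> x * 1 powr (1 - p) / p + (1 - 1 / p) * (N \<tau> * 1)"
        using elim(2) by (metis zero_less_one)
      then show "AE \<tau> in M. norm (g \<tau> x) \<le> norm (W \<tau> x * 1 powr (1 - p) / p + (1 - 1 / p) * (N \<tau> * 1))"
        by eventually_elim (use g in \<open>auto simp: abs_of_nonneg\<close>)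
    qed
  qed
  have "AE x in L. ennreal ((LINT \<tau>|M. g \<tau> x) powr p) \<le> ennreal (S powr (p - 1)) * (\<integral>\<^sup>+\<tau>. ennreal (W \<tau> x) \<partial>M)"
    using int W_int tangent
  proof eventually_elim
    case (elim x)
    define G where "G = (LINT \<tau>|M. g \<tau> x)"
    define P where "P = (LINT \<tau>|M. W \<tau> x)"
    have P: "(\<integral>\<^sup>+\<tau>. ennreal (W \<tau> x) \<partial>M) = ennreal P"
      unfolding P_def by (intro nn_integral_eq_integral elim AE_I2 W_nn)
    have "G \<ge> 0" "P \<ge> 0" "S \<ge> 0"
      unfolding G_def P_def S_def by (intro integral_nonneg_AE AE_I2 g W_nn N)+
    have c_bound: "G \<le> P * c powr (1 - p) / p + (1 - 1 / p) * (S * c)" if "c > 0" for c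
    proof -
      have "G \<le> (LINT \<tau>|M. W \<tau> x * c powr (1 - p) / p + (1 - 1 / p) * (N \<tau> * c))"
        unfolding G_def using elim that N(2)
        by (intro integral_mono_AE) (auto intro!: Bochner_Integration.integrable_add integrable_mult_right integrable_mult_left integrable_divide)
      also have "\<dots> = P * c powr (1 - p) / p + (1 - 1 / p) * (S * c)"
        unfolding P_def S_def using elim N(2) by simp
      finally show ?thesis .
    qed
    have "G powr p \<le> S powr (p - 1) * P"
    proof (cases "G = 0")
      case True then show ?thesis using \<open>P \<ge> 0\<close> by simp
    next
      case False
      then have "G > 0" using \<open>G \<ge> 0\<close> by simp
      have "S \<noteq> 0"
      proof
        assume "S = 0"
        then have "AE \<tau> in M. N \<tau> = 0"
          unfolding S_def using N by (subst (asm) integral_nonneg_eq_0_iff_AE) auto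
        then have "P = 0"
          unfolding P_def by (intro integral_eq_zero_AE) (auto simp: W_def elim!: eventually_mono)
        then show False using c_bound[of 1] \<open>S = 0\<close> \<open>G > 0\<close> by simp
      qed
      then have "S > 0" using \<open>S \<ge> 0\<close> by simp
      \<comment> \<open>At \<open>c = G / S\<close> the second term equals
        \<open>(1 - 1 / p) * G\<close>, so what remains on the left is \<open>G / p\<close> and the
        factor \<open>1 / p\<close> cancels.\<close>
      have "G \<le> P * (G / S) powr (1 - p) / p + (1 - 1 / p) * (S * (G / S))"
        using \<open>S > 0\<close> \<open>G > 0\<close> by (intro c_bound) simp
      then have "G \<le> P * (G / S) powr (1 - p)"
        using \<open>S > 0\<close> p by (simp add: field_simps)
      then have "G powr (p - 1) * G \<le> G powr (p - 1) * (P * (G / S) powr (1 - p))"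
        by (intro mult_left_mono) auto
      also have "\<dots> = S powr (p - 1) * P"
        using \<open>G > 0\<close> \<open>S > 0\<close> by (simp add: powr_divide powr_diff field_simps)
      also have "G powr (p - 1) * G = G powr p"
        using \<open>G > 0\<close> by (simp add: powr_diff)
      finally show ?thesis .
    qed
    then show ?case
      using \<open>P \<ge> 0\<close> by (simp add: P G_def ennreal_leI flip: ennreal_mult)
  qed
  then have "(\<integral>\<^sup>+x. ennreal ((LINT \<tau>|M. g \<tau> x) powr p) \<partial>L) \<le> (\<integral>\<^sup>+x. ennreal (S powr (p - 1)) * (\<integral>\<^sup>+\<tau>. ennreal (W \<tau> x) \<partial>M) \<partial>L)"
    by (rule nn_integral_mono_AE)
  also have "\<dots> = ennreal (S powr (p - 1)) * (\<integral>\<^sup>+x. \<integral>\<^sup>+\<tau>. ennreal (W \<tau> x) \<partial>M \<partial>L)"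
    by (intro nn_integral_cmult) measurable
  also have "\<dots> \<le> ennreal (S powr (p - 1)) * ennreal S"
    by (intro mult_left_mono W_le) simp
  also have "\<dots> = ennreal (S powr p)"
  proof -
    have "S \<ge> 0" unfolding S_def by (intro integral_nonneg_AE AE_I2 N)
    then show ?thesis using p by (cases "S = 0") (simp_all add: powr_diff flip: ennreal_mult)
  qed
  finally show "(\<integral>\<^sup>+x. ennreal ((LINT \<tau>|M. g \<tau> x) powr p) \<partial>L) \<le> ennreal ((LINT \<tau>|M. N \<tau>) powr p)"
    unfolding S_def .
qed

text \<open>Induction over the Borel sets generated by intervals shows that all set integrals
  vanish. The complement step needs the integral over the whole line, obtained by exhausting it with
  the intervals \<open>{- real n..real n}\<close>.\<close>

lemma AE_zero_if_interval_integrals_zero: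
  fixes f :: "real \<Rightarrow> 'a::{banach, second_countable_topology}"
  assumes f: "integrable lborel f"
    and zero: "\<And>a b. a \<le> b \<Longrightarrow> (LINT x:{a..b}|lborel. f x) = 0"
  shows "AE x in lborel. f x = 0"
proof (rule sigma_finite_measure.density_unique_banach[OF sigma_finite_lborel f])
  fix A :: "real set" assume "A \<in> sets lborel"
  then have "A \<in> sets borel" by simp
  have si: "set_integrable lborel B f" if "B \<in> sets borel" for B
    using f that unfolding set_integrable_def by (intro integrable_mult_indicator) auto
  have UN: "(\<Union>n::nat. {- real n..real n}) = UNIV"
  proof -
    have "\<exists>n::nat. - real n \<le> x \<and> x \<le> real n" for x
      by (rule exI[of _ "nat \<lceil>\<bar>x\<bar>\<rceil>"]) linarith
    then show ?thesis by auto
  qed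
  have "(\<lambda>n. LINT x:{- real n..real n}|lborel. f x) \<longlonglongrightarrow> (LINT x:(\<Union>n::nat. {- real n..real n})|lborel. f x)"
    by (rule set_integral_cont_up) (auto intro!: si simp: incseq_def)
  then have UNIV_0: "(LINT x:UNIV|lborel. f x) = 0"
    unfolding UN using zero by (simp add: LIMSEQ_const_iff)
  show "(LINT x:A|lborel. f x) = (LINT x:A|lborel. 0)"
    using \<open>A \<in> sets borel\<close>
  proof (induction rule: borel_set_induct)
    case (compl A)
    have "(LINT x:UNIV|lborel. f x) = (LINT x:A|lborel. f x) + (LINT x:-A|lborel. f x)"
      using compl(1) by (subst set_integral_Un[symmetric]) (auto intro!: si simp: Compl_partition)
    then show ?case using compl(2) UNIV_0 by simp
  next
    case (union F)
    have "(LINT x:(\<Union>i. F i)|lborel. f x) = (\<Sum>i. (LINT x:(F i)|lborel. f x))"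
      using union(1,2) by (intro lebesgue_integral_countable_add) (auto intro!: si simp: disjoint_family_on_def)
    then show ?case using union(3) by simp
  qed (simp_all add: zero, simp add: set_lebesgue_integral_def)
qed simp

text \<open>Integrating the hypothesis over \<open>y \<in> {a..b}\<close> smooths the indicator of the interval
  instead of \<open>g\<close>, so no differentiation theorem is needed.\<close>

lemma AE_zero_if_heat_averages_zero:
  fixes g :: "real \<Rightarrow> complex"
  assumes g: "integrable lborel g" and \<tau>: "\<And>n. \<tau> n > 0" "\<tau> \<longlonglongrightarrow> 0"
    and zero: "\<And>n. AE y in lborel. (LINT x|lborel. g x * of_real (heat (\<tau> n) (x - y))) = 0"
  shows "AE x in lborel. g x = 0"
proof (rule AE_zero_if_interval_integrals_zero[OF g])
  fix a b :: real assume "a \<le> b"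
  have [measurable]: "g \<in> borel_measurable borel" using g by auto
  define I where "I = (\<lambda>y. complex_of_real (indicator {a..b} y))"
  have [measurable]: "I \<in> borel_measurable borel" unfolding I_def by measurable
  have I_le: "norm (I y) \<le> 1" for y by (simp add: I_def indicator_def)
  define \<Phi> where "\<Phi> = (\<lambda>n x. LINT y|lborel. I y * of_real (heat (\<tau> n) (x - y)))"
  have [measurable]: "\<Phi> n \<in> borel_measurable borel" for n unfolding \<Phi>_def by measurable
  have heat_int: "integrable lborel (\<lambda>y. heat (\<tau> n) (x - y))" "(LINT y|lborel. heat (\<tau> n) (x - y)) = 1" for n x
    using nn_integral_heat_translate(2)[OF \<tau>(1)[of n], of x]
    by (auto intro!: integrableI_bounded simp: heat_nonneg integral_eq_nn_integral)
  have \<Phi>_le: "norm (\<Phi> n x) \<le> 1" for n x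
  proof -
    have "norm (\<Phi> n x) \<le> (LINT y|lborel. heat (\<tau> n) (x - y))"
      unfolding \<Phi>_def
    proof (rule order_trans[OF integral_norm_bound integral_mono'])
      show "norm (I y * of_real (heat (\<tau> n) (x - y))) \<le> heat (\<tau> n) (x - y)" for y
        using I_le[of y] heat_nonneg[of "\<tau> n" "x - y"] by (simp add: norm_mult mult_left_le_one_le)
    qed (use heat_int heat_nonneg in auto)
    then show ?thesis by (simp add: heat_int)
  qed
  have "(LINT x|lborel. g x * \<Phi> n x) = 0" for n
  proof -
    have int: "integrable (lborel \<Otimes>\<^sub>M lborel) (\<lambda>(x, y). g x * (I y * of_real (heat (\<tau> n) (x - y))))"
    proof (rule lborel_pair.Fubini_integrable)
      show "(\<lambda>(x, y). g x * (I y * of_real (heat (\<tau> n) (x - y)))) \<in> borel_measurable (lborel \<Otimes>\<^sub>M lborel)"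
        by measurable
      have i: "integrable lborel (\<lambda>y. I y * of_real (heat (\<tau> n) (x - y)))" for x
        by (rule Bochner_Integration.integrable_bound[OF heat_int(1)[of n x]])
          (use I_le heat_nonneg[of "\<tau> n"] in \<open>auto simp: norm_mult intro!: mult_left_le_one_le\<close>)
      show "AE x in lborel. integrable lborel (\<lambda>y. case (x, y) of (x, y) \<Rightarrow> g x * (I y * of_real (heat (\<tau> n) (x - y))))"
        using i by (intro AE_I2) (simp add: integrable_mult_right)
      show "integrable lborel (\<lambda>x. LINT y|lborel. norm (case (x, y) of (x, y) \<Rightarrow> g x * (I y * of_real (heat (\<tau> n) (x - y)))))"
      proof (rule Bochner_Integration.integrable_bound[OF g])
        show "(\<lambda>x. LINT y|lborel. norm (case (x, y) of (x, y) \<Rightarrow> g x * (I y * of_real (heat (\<tau> n) (x - y))))) \<in> borel_measurable lborel"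
          by measurable
        show "AE x in lborel. norm (LINT y|lborel. norm (case (x, y) of (x, y) \<Rightarrow> g x * (I y * of_real (heat (\<tau> n) (x - y))))) \<le> norm (g x)"
        proof (rule AE_I2)
          fix x
          have "norm (LINT y|lborel. norm (g x * (I y * of_real (heat (\<tau> n) (x - y))))) \<le> norm (g x) * (LINT y|lborel. heat (\<tau> n) (x - y))"
            unfolding norm_mult integral_mult_right_zero real_norm_def abs_mult
            using I_le heat_nonneg[of "\<tau> n"]
            by (auto intro!: mult_left_mono integral_mono' heat_int(1) mult_left_le_one_le simp: abs_of_nonneg)
          then show "norm (LINT y|lborel. norm (case (x, y) of (x, y) \<Rightarrow> g x * (I y * of_real (heat (\<tau> n) (x - y))))) \<le> norm (g x)"
            by (simp add: heat_int)
        qed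
      qed
    qed
    have "(LINT x|lborel. g x * \<Phi> n x) = (LINT x|lborel. LINT y|lborel. g x * (I y * of_real (heat (\<tau> n) (x - y))))"
      unfolding \<Phi>_def by simp
    also have "\<dots> = (LINT y|lborel. LINT x|lborel. g x * (I y * of_real (heat (\<tau> n) (x - y))))"
      by (rule lborel_pair.Fubini_integral[OF int, symmetric])
    also have "\<dots> = (LINT y|lborel. I y * (LINT x|lborel. g x * of_real (heat (\<tau> n) (x - y))))"
      by (subst integral_mult_right_zero[symmetric]) (simp add: mult_ac)
    also have "\<dots> = 0"
      using zero[of n] by (intro integral_eq_zero_AE) (auto elim: eventually_mono)
    finally show ?thesis .
  qed
  moreover have "(\<lambda>n. LINT x|lborel. g x * \<Phi> n x) \<longlonglongrightarrow> (LINT x|lborel. g x * I x)"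
  proof (rule integral_dominated_convergence[where w = "\<lambda>x. norm (g x)"])
    \<comment> \<open>Away from the two endpoints, a null set, the indicator is locally constant and
      hence continuous.\<close>
    have "(\<lambda>n. \<Phi> n x) \<longlonglongrightarrow> I x" if "x \<notin> {a, b}" for x
      unfolding \<Phi>_def
    proof (rule heat_approximate_identity[OF _ I_le _ \<tau>])
      have "open (- {a, b})" by (intro open_Compl finite_imp_closed) auto
      have "\<forall>\<^sub>F y in nhds x. (y < a) = (x < a) \<and> (y < b) = (x < b) \<and> y \<noteq> a \<and> y \<noteq> b"
      proof -
        have "\<forall>\<^sub>F y in nhds x. (y < c) = (x < c) \<and> y \<noteq> c" if "x \<noteq> c" for c
        proof (cases "x < c")
          case True
          then show ?thesis using eventually_nhds_in_open[of "{..<c}" x] by (auto elim: eventually_mono)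
        next
          case False
          then show ?thesis using that eventually_nhds_in_open[of "{c<..}" x] by (auto elim: eventually_mono)
        qed
        from this[of a] this[of b] that show ?thesis by (auto simp: eventually_conj_iff)
      qed
      then have "\<forall>\<^sub>F y in nhds x. I y = I x"
        by eventually_elim (use that in \<open>auto simp: I_def indicator_def\<close>)
      then show "isCont I x"
        unfolding isCont_def by (intro tendsto_eventually) (auto simp: eventually_at_filter elim: eventually_mono)
    qed measurable
    moreover have "AE x in lborel. x \<notin> {a, b}"
      by (intro AE_not_in finite_imp_null_set_lborel) simp
    ultimately show "AE x in lborel. (\<lambda>n. g x * \<Phi> n x) \<longlonglongrightarrow> g x * I x"
      by (elim eventually_mono) (auto intro!: tendsto_intros)
    show "AE x in lborel. norm (g x * \<Phi> n x) \<le> norm (g x)" for n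
      using \<Phi>_le by (auto simp: norm_mult intro!: mult_right_le_one_le)
  qed (use g in auto)
  ultimately have "(LINT x|lborel. g x * I x) = 0"
    by (simp add: LIMSEQ_const_iff)
  then show "(LINT x:{a..b}|lborel. g x) = 0"
    by (simp add: set_lebesgue_integral_def I_def scaleR_conv_of_real mult.commute)
qed

section \<open>Interpolation of convolution operators\<close>

lemma nn_integral_powr_from_0:
  assumes "r > 0" "a \<ge> 0"
  shows "(\<integral>\<^sup>+t. ennreal (r * t powr (r - 1)) * indicator {0<..<a} t \<partial>lborel) = ennreal (a powr r)"
proof -
  have "((\<lambda>t. r * t powr (r - 1)) has_integral r * (a powr (r - 1 + 1) / (r - 1 + 1))) {0..a}"
    using assms by (intro has_integral_mult_right has_integral_powr_from_0) auto
  then have "(\<integral>\<^sup>+t. ennreal (r * t powr (r - 1)) * indicator {0..a} t \<partial>lborel) = ennreal (a powr r)"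
    using assms by (subst nn_integral_has_integral_lebesgue'[where I = "a powr r"]) auto
  moreover have "AE t in lborel. t \<notin> {0, a}"
    by (intro AE_not_in finite_imp_null_set_lborel) simp
  then have "(\<integral>\<^sup>+t. ennreal (r * t powr (r - 1)) * indicator {0<..<a} t \<partial>lborel) =
      (\<integral>\<^sup>+t. ennreal (r * t powr (r - 1)) * indicator {0..a} t \<partial>lborel)"
  proof (intro nn_integral_cong_AE, eventually_elim)
    case (elim t)
    then show ?case by (auto split: split_indicator)
  qed
  ultimately show ?thesis by simp
qed

text \<open>The weight \<open>v\<close> serves two uses in the interpolation: with
  \<open>v = 1\<close> the norm of the output is unfolded into level sets, and with
  \<open>v = \<bar>f\<bar>^2\<close> and exponent \<open>p - 2\<close> the level sets of the input
  are folded back.\<close>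

lemma layer_cake_powr:
  fixes F :: "real \<Rightarrow> real"
  assumes [measurable]: "F \<in> borel_measurable borel" "v \<in> borel_measurable borel" and F: "\<And>x. F x \<ge> 0" and "r > 0"
  shows "(\<integral>\<^sup>+x. v x * ennreal (F x powr r) \<partial>lborel) =
    (\<integral>\<^sup>+t. ennreal (r * t powr (r - 1)) * indicator {0<..} t * (\<integral>\<^sup>+x. v x * indicator {x. t < F x} x \<partial>lborel) \<partial>lborel)"
proof -
  have "(\<integral>\<^sup>+x. v x * ennreal (F x powr r) \<partial>lborel) =
      (\<integral>\<^sup>+x. \<integral>\<^sup>+t. ennreal (r * t powr (r - 1)) * indicator {0<..} t * (v x * indicator {x. t < F x} x) \<partial>lborel \<partial>lborel)"
  proof (intro nn_integral_cong)
    fix x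
    have "v x * ennreal (F x powr r) = (\<integral>\<^sup>+t. v x * (ennreal (r * t powr (r - 1)) * indicator {0<..<F x} t) \<partial>lborel)"
      using assms by (simp add: nn_integral_cmult nn_integral_powr_from_0)
    also have "\<dots> = (\<integral>\<^sup>+t. ennreal (r * t powr (r - 1)) * indicator {0<..} t * (v x * indicator {x. t < F x} x) \<partial>lborel)"
      by (intro nn_integral_cong) (auto simp: mult_ac split: split_indicator)
    finally show "v x * ennreal (F x powr r) = \<dots>" .
  qed
  also have "\<dots> = (\<integral>\<^sup>+t. \<integral>\<^sup>+x. ennreal (r * t powr (r - 1)) * indicator {0<..} t * (v x * indicator {x. t < F x} x) \<partial>lborel \<partial>lborel)"
    by (rule lborel_pair.Fubini') measurable
  also have "\<dots> = (\<integral>\<^sup>+t. ennreal (r * t powr (r - 1)) * indicator {0<..} t * (\<integral>\<^sup>+x. v x * indicator {x. t < F x} x \<partial>lborel) \<partial>lborel)"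
    by (intro nn_integral_cong nn_integral_cmult) measurable
  finally show ?thesis .
qed

lemma norm_conv_le:
  assumes k: "k \<in> schwartz" and "\<And>y. norm (f y) \<le> c" "c \<ge> 0"
  shows "norm (conv k f x) \<le> c * (LINT y|lborel. norm (k y))"
proof -
  have ki: "integrable lborel (\<lambda>y. norm (k (x - y)))"
    by (intro integrable_norm schwartz_integrable_translate k)
  have "norm (conv k f x) \<le> (LINT y|lborel. c * norm (k (x - y)))"
    unfolding conv_def
    by (rule order_trans[OF integral_norm_bound integral_mono'])
      (use assms ki in \<open>auto simp: norm_mult intro!: mult_right_mono\<close>)
  also have "\<dots> = c * (LINT y|lborel. norm (k (x - y)))" by simp
  also have "(LINT y|lborel. norm (k (x - y))) = (LINT y|lborel. norm (k y))"
    using lborel_integral_real_affine[of "-1" "\<lambda>y. norm (k y)" x] by simp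
  finally show ?thesis .
qed

text \<open>The 4 is the Chebyshev loss at half the height, \<open>p / (p - 2)\<close> compares the
  two layer cake densities, and \<open>2 powr (p - 2)\<close> comes from the cut at
  \<open>t / (2 * B)\<close>. The case \<open>p = 2\<close> is separate because the L^2 bound
  applies directly and the quotient degenerates.\<close>

definition marcinkiewicz_const :: "real \<Rightarrow> real" where
  "marcinkiewicz_const p = (if p = 2 then 1 else 4 * p / (p - 2) * 2 powr (p - 2))"

lemma marcinkiewicz_const_pos: "p \<ge> 2 \<Longrightarrow> marcinkiewicz_const p > 0"
  by (auto simp: marcinkiewicz_const_def)

text \<open>At height \<open>t\<close> the function is cut at \<open>t / (2 * B)\<close>, so that the convolution of its bounded
  part contributes at most \<open>t / 2\<close>.\<close>

lemma conv_Lp_bound: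
  assumes m: "m \<in> schwartz" and A: "\<And>\<xi>. norm (m \<xi>) \<le> A"
    and B: "(LINT x|lborel. norm (fourier_inv m x)) \<le> B" "B > 0"
    and [measurable]: "f \<in> borel_measurable borel" and p: "p \<ge> 2"
    and f: "(\<integral>\<^sup>+x. ennreal (norm (f x) powr p) \<partial>lborel) < \<infinity>"
  shows "(\<integral>\<^sup>+x. ennreal (norm (conv (fourier_inv m) f x) powr p) \<partial>lborel)
    \<le> ennreal (marcinkiewicz_const p * A\<^sup>2 * B powr (p - 2)) * (\<integral>\<^sup>+x. ennreal (norm (f x) powr p) \<partial>lborel)"
proof (cases "p = 2")
  case True
  have sq: "norm z powr 2 = (norm z)\<^sup>2" for z :: complex by (simp add: powr_numeral)
  show ?thesis
    using conv_L2[OF m A, of f] f B unfolding True by (simp add: sq marcinkiewicz_const_def)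
next
  case False
  then have p: "p > 2" using p by simp
  define k where "k = fourier_inv m"
  have k: "k \<in> schwartz" unfolding k_def by (intro fourier_inv_schwartz m)
  note [measurable] = schwartz_borel[OF k]
  define big where "big = (\<lambda>t x. indicator {x. t < 2 * B * norm (f x)} x * f x)"
  define small where "small = (\<lambda>t x. indicator {x. \<not> t < 2 * B * norm (f x)} x * f x)"
  have [measurable]: "big t \<in> borel_measurable borel" "small t \<in> borel_measurable borel" for t
    unfolding big_def small_def by measurable
  have fp: "integrable lborel (\<lambda>x. norm (f x) powr p)"
    by (intro nn_integral_powr_integrable f) measurable
  have split: "conv k f x = conv k (big t) x + conv k (small t) x" for t x
  proof -
    have fi: "integrable lborel (\<lambda>y. f y * k (x - y))"
      using p by (intro conv_integrable[OF _ _ fp k]) auto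
    have "integrable lborel (\<lambda>y. big t y * k (x - y))" "integrable lborel (\<lambda>y. small t y * k (x - y))"
      by (rule Bochner_Integration.integrable_bound[OF fi]; auto simp: big_def small_def indicator_def)+
    then have "conv k (big t) x + conv k (small t) x = (LINT y|lborel. big t y * k (x - y) + small t y * k (x - y))"
      unfolding conv_def by simp
    also have "\<dots> = conv k f x"
      unfolding conv_def by (intro Bochner_Integration.integral_cong) (auto simp: big_def small_def indicator_def)
    finally show ?thesis ..
  qed
  have small: "norm (conv k (small t) x) \<le> t / 2" if "t > 0" for t x
  proof -
    have "norm (conv k (small t) x) \<le> t / (2 * B) * (LINT y|lborel. norm (k y))"
      using that B by (intro norm_conv_le k) (auto simp: small_def indicator_def field_simps)
    also have "\<dots> \<le> t / (2 * B) * B"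
      using that B by (intro mult_left_mono) (auto simp: k_def)
    finally show ?thesis using B by simp
  qed
  \<comment> \<open>Chebyshev in L^2: where the full convolution exceeds \<open>t\<close>, that of
    the large part is at least \<open>t / 2\<close>.\<close>
  have level: "(\<integral>\<^sup>+x. indicator {x. t < norm (conv k f x)} x \<partial>lborel) \<le>
      ennreal (4 * A\<^sup>2 / t\<^sup>2) * (\<integral>\<^sup>+x. ennreal ((norm (f x))\<^sup>2) * indicator {x. t < 2 * B * norm (f x)} x \<partial>lborel)"
    if t: "t > 0" for t
  proof -
    have big_sq: "ennreal ((norm (big t x))\<^sup>2) = ennreal ((norm (f x))\<^sup>2) * indicator {x. t < 2 * B * norm (f x)} x" for x
      by (auto simp: big_def norm_mult split: split_indicator)
    have "(\<integral>\<^sup>+x. indicator {x. t < norm (conv k f x)} x \<partial>lborel) \<le>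
        (\<integral>\<^sup>+x. ennreal (4 / t\<^sup>2) * ennreal ((norm (conv k (big t) x))\<^sup>2) \<partial>lborel)"
    proof (intro nn_integral_mono)
      fix x
      show "indicator {x. t < norm (conv k f x)} x \<le> ennreal (4 / t\<^sup>2) * ennreal ((norm (conv k (big t) x))\<^sup>2)"
      proof (cases "t < norm (conv k f x)")
        case True
        then have "t / 2 \<le> norm (conv k (big t) x)"
          using norm_triangle_ineq[of "conv k (big t) x" "conv k (small t) x"] small[OF t, of x]
          unfolding split[of x t] by linarith
        then have "(t / 2)\<^sup>2 \<le> (norm (conv k (big t) x))\<^sup>2"
          using t by (intro power_mono) auto
        then have "1 \<le> 4 / t\<^sup>2 * (norm (conv k (big t) x))\<^sup>2"
          using t by (simp add: power_divide field_simps)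
        then show ?thesis using True by (simp flip: ennreal_mult)
      qed simp
    qed
    also have "\<dots> = ennreal (4 / t\<^sup>2) * (\<integral>\<^sup>+x. ennreal ((norm (conv k (big t) x))\<^sup>2) \<partial>lborel)"
      by (intro nn_integral_cmult) measurable
    also have "\<dots> \<le> ennreal (4 / t\<^sup>2) * (ennreal (A\<^sup>2) * (\<integral>\<^sup>+x. ennreal ((norm (big t x))\<^sup>2) \<partial>lborel))"
    proof (intro mult_left_mono)
      \<comment> \<open>The large part is square integrable because above the cut
        \<open>\<bar>f\<bar>^2\<close> is at most a constant times
        \<open>\<bar>f\<bar> powr p\<close>; finiteness is what \<open>conv_L2\<close> asks
        for.\<close>
      have "(\<integral>\<^sup>+x. ennreal ((norm (big t x))\<^sup>2) \<partial>lborel) \<le> (\<integral>\<^sup>+x. ennreal ((t / (2 * B)) powr (2 - p)) * ennreal (norm (f x) powr p) \<partial>lborel)"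
      proof (intro nn_integral_mono)
        fix x
        have "(norm (big t x))\<^sup>2 \<le> (t / (2 * B)) powr (2 - p) * norm (f x) powr p"
        proof (cases "t < 2 * B * norm (f x)")
          case True
          then have lt: "t / (2 * B) < norm (f x)" and "t / (2 * B) > 0"
            using B t by (auto simp: field_simps)
          then have "norm (f x) powr (2 - p) * norm (f x) powr p \<le> (t / (2 * B)) powr (2 - p) * norm (f x) powr p"
            using p by (intro mult_right_mono powr_mono2') auto
          moreover have "norm (f x) powr (2 - p) * norm (f x) powr p = (norm (f x))\<^sup>2"
            using lt \<open>t / (2 * B) > 0\<close> by (simp flip: powr_add)
          ultimately show ?thesis using True by (simp add: big_def)
        qed (simp add: big_def)
        then show "ennreal ((norm (big t x))\<^sup>2) \<le> ennreal ((t / (2 * B)) powr (2 - p)) * ennreal (norm (f x) powr p)"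
          by (simp add: ennreal_leI flip: ennreal_mult)
      qed
      also have "\<dots> = ennreal ((t / (2 * B)) powr (2 - p)) * (\<integral>\<^sup>+x. ennreal (norm (f x) powr p) \<partial>lborel)"
        by (intro nn_integral_cmult) measurable
      also have "\<dots> < \<infinity>" using f by (simp add: ennreal_mult_less_top)
      finally show "(\<integral>\<^sup>+x. ennreal ((norm (conv k (big t) x))\<^sup>2) \<partial>lborel) \<le> ennreal (A\<^sup>2) * (\<integral>\<^sup>+x. ennreal ((norm (big t x))\<^sup>2) \<partial>lborel)"
        unfolding k_def by (intro conv_L2 m A) measurable
    qed simp
    also have "\<dots> = ennreal (4 * A\<^sup>2 / t\<^sup>2) * (\<integral>\<^sup>+x. ennreal ((norm (big t x))\<^sup>2) \<partial>lborel)"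
      by (simp add: mult.assoc[symmetric] flip: ennreal_mult)
    finally show ?thesis by (simp only: big_sq)
  qed
  define V where "V = (\<lambda>t. \<integral>\<^sup>+x. ennreal ((norm (f x))\<^sup>2) * indicator {x. t < 2 * B * norm (f x)} x \<partial>lborel)"
  have [measurable]: "V \<in> borel_measurable borel" unfolding V_def by measurable
  have "(\<integral>\<^sup>+x. ennreal (norm (conv k f x) powr p) \<partial>lborel) =
      (\<integral>\<^sup>+t. ennreal (p * t powr (p - 1)) * indicator {0<..} t * (\<integral>\<^sup>+x. indicator {x. t < norm (conv k f x)} x \<partial>lborel) \<partial>lborel)"
    using layer_cake_powr[of "\<lambda>x. norm (conv k f x)" "\<lambda>_. 1" p] p by simp
  \<comment> \<open>The factor \<open>1 / t^2\<close> lowers the exponent of the density from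
    \<open>p - 1\<close> to \<open>p - 3\<close>, which is the layer cake density for the exponent
    \<open>p - 2\<close>.\<close>
  also have "\<dots> \<le> (\<integral>\<^sup>+t. ennreal (4 * p / (p - 2) * A\<^sup>2) * (ennreal ((p - 2) * t powr (p - 2 - 1)) * indicator {0<..} t * V t) \<partial>lborel)"
  proof (intro nn_integral_mono)
    fix t :: real
    show "ennreal (p * t powr (p - 1)) * indicator {0<..} t * (\<integral>\<^sup>+x. indicator {x. t < norm (conv k f x)} x \<partial>lborel)
      \<le> ennreal (4 * p / (p - 2) * A\<^sup>2) * (ennreal ((p - 2) * t powr (p - 2 - 1)) * indicator {0<..} t * V t)"
    proof (cases "t > 0")
      case True
      have "ennreal (p * t powr (p - 1)) * (\<integral>\<^sup>+x. indicator {x. t < norm (conv k f x)} x \<partial>lborel)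
          \<le> ennreal (p * t powr (p - 1)) * (ennreal (4 * A\<^sup>2 / t\<^sup>2) * V t)"
        unfolding V_def by (intro mult_left_mono level True) simp
      also have "\<dots> = ennreal (p * t powr (p - 1) * (4 * A\<^sup>2 / t\<^sup>2)) * V t"
        using p True by (simp add: mult.assoc[symmetric] flip: ennreal_mult)
      also have "p * t powr (p - 1) * (4 * A\<^sup>2 / t\<^sup>2) = (4 * p / (p - 2) * A\<^sup>2) * ((p - 2) * t powr (p - 2 - 1))"
      proof -
        have "t powr (p - 2 - 1) = t powr (p - 1) / t\<^sup>2"
          using True powr_diff[of t "p - 1" 2] by (simp add: algebra_simps)
        then show ?thesis using p by simp
      qed
      also have "ennreal \<dots> = ennreal (4 * p / (p - 2) * A\<^sup>2) * ennreal ((p - 2) * t powr (p - 2 - 1))"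
        using p by (intro ennreal_mult) auto
      finally show ?thesis using True by (simp add: mult.assoc)
    qed simp
  qed
  also have "\<dots> = ennreal (4 * p / (p - 2) * A\<^sup>2) * (\<integral>\<^sup>+t. ennreal ((p - 2) * t powr (p - 2 - 1)) * indicator {0<..} t * V t \<partial>lborel)"
    by (intro nn_integral_cmult) measurable
  also have "(\<integral>\<^sup>+t. ennreal ((p - 2) * t powr (p - 2 - 1)) * indicator {0<..} t * V t \<partial>lborel) =
      (\<integral>\<^sup>+x. ennreal ((norm (f x))\<^sup>2) * ennreal ((2 * B * norm (f x)) powr (p - 2)) \<partial>lborel)"
    unfolding V_def using B p
    by (intro layer_cake_powr[of "\<lambda>x. 2 * B * norm (f x)" "\<lambda>x. ennreal ((norm (f x))\<^sup>2)" "p - 2", symmetric]) auto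
  also have "\<dots> = (\<integral>\<^sup>+x. ennreal ((2 * B) powr (p - 2)) * ennreal (norm (f x) powr p) \<partial>lborel)"
  proof (intro nn_integral_cong)
    fix x
    have "(norm (f x))\<^sup>2 * (2 * B * norm (f x)) powr (p - 2) = (2 * B) powr (p - 2) * norm (f x) powr p"
      using B p by (cases "f x = 0") (auto simp: powr_mult powr_diff)
    then show "ennreal ((norm (f x))\<^sup>2) * ennreal ((2 * B * norm (f x)) powr (p - 2)) = ennreal ((2 * B) powr (p - 2)) * ennreal (norm (f x) powr p)"
      by (simp flip: ennreal_mult)
  qed
  also have "\<dots> = ennreal ((2 * B) powr (p - 2)) * (\<integral>\<^sup>+x. ennreal (norm (f x) powr p) \<partial>lborel)"
    by (intro nn_integral_cmult) measurable
  also have "ennreal (4 * p / (p - 2) * A\<^sup>2) * (ennreal ((2 * B) powr (p - 2)) * (\<integral>\<^sup>+x. ennreal (norm (f x) powr p) \<partial>lborel)) =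
      ennreal (4 * p / (p - 2) * A\<^sup>2 * (2 * B) powr (p - 2)) * (\<integral>\<^sup>+x. ennreal (norm (f x) powr p) \<partial>lborel)"
    using p by (subst ennreal_mult) (auto simp: mult.assoc)
  also have "4 * p / (p - 2) * A\<^sup>2 * (2 * B) powr (p - 2) = marcinkiewicz_const p * A\<^sup>2 * B powr (p - 2)"
    using p B by (simp add: marcinkiewicz_const_def powr_mult)
  finally show ?thesis by (simp add: k_def)
qed

section \<open>Gaussian chirps\<close>

text \<open>The symbol of the free group at time \<open>t\<close> damped by the heat flow for time
  \<tau>, so that it becomes a Schwartz function.\<close>

definition chirp :: "real \<Rightarrow> real \<Rightarrow> real \<Rightarrow> complex" where
  "chirp t \<tau> \<xi> = cis (- (t * \<xi>\<^sup>2)) * of_real (exp (- \<tau> * \<xi>\<^sup>2))"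

lemma chirp_schwartz: "\<tau> > 0 \<Longrightarrow> chirp t \<tau> \<in> schwartz"
  unfolding chirp_def[abs_def]
  using schwartz_slow_mult[OF slow_chirp[of "- t"] schwartz_gauss[of \<tau>]] by simp

lemma norm_chirp: "norm (chirp t \<tau> \<xi>) = exp (- \<tau> * \<xi>\<^sup>2)"
  by (simp add: chirp_def norm_mult)

lemma norm_chirp_le: "\<tau> > 0 \<Longrightarrow> norm (chirp t \<tau> \<xi>) \<le> 1"
  by (simp add: norm_chirp)

lemma nn_integral_gauss:
  assumes "a > 0"
  shows "(\<integral>\<^sup>+x. ennreal (exp (- a * x\<^sup>2)) \<partial>lborel) = ennreal (sqrt (pi / a))"
proof -
  define \<tau> where "\<tau> = 1 / (4 * a)"
  have \<tau>: "\<tau> > 0" using assms by (simp add: \<tau>_def)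
  have "(\<integral>\<^sup>+x. ennreal (exp (- a * x\<^sup>2)) \<partial>lborel) = (\<integral>\<^sup>+x. ennreal (sqrt (pi / a)) * ennreal (heat \<tau> (x - 0)) \<partial>lborel)"
    using assms \<tau> by (intro nn_integral_cong)
      (simp add: heat_eq \<tau>_def mult_ac real_sqrt_divide flip: ennreal_mult)
  also have "\<dots> = ennreal (sqrt (pi / a)) * (\<integral>\<^sup>+x. ennreal (heat \<tau> (x - 0)) \<partial>lborel)"
    by (intro nn_integral_cmult) simp
  finally show ?thesis using nn_integral_heat_translate(1)[OF \<tau>, of 0] by simp
qed

text \<open>The transform solves \<open>f' = - x / (2 z) * f\<close> with \<open>z = \<tau> + i t\<close>, so it is a complex Gaussian;
  its value at \<open>0\<close> is estimated by Plancherel's inequality instead of being computed.\<close>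

lemma fourier_chirp:
  assumes "\<tau> > 0"
  shows "fourier (chirp t \<tau>) x = fourier (chirp t \<tau>) 0 * exp (- (of_real (x\<^sup>2) / (4 * Complex \<tau> t)))"
proof -
  define z where "z = Complex \<tau> t"
  have "Re z \<noteq> 0" using assms by (simp add: z_def)
  then have z: "z \<noteq> 0" by auto
  define f where "f = fourier (chirp t \<tau>)"
  define m where "m = chirp t \<tau>"
  have m: "m \<in> schwartz" unfolding m_def by (rule chirp_schwartz[OF assms])
  have m_eq: "m = (\<lambda>\<xi>. exp (- z * of_real (\<xi>\<^sup>2)))"
  proof
    fix \<xi>
    have "z = of_real \<tau> + \<i> * of_real t" by (simp add: z_def complex_eq_iff)
    then show "m \<xi> = exp (- z * of_real (\<xi>\<^sup>2))"
      by (simp add: m_def chirp_def cis_conv_exp exp_of_real[symmetric] exp_add[symmetric] algebra_simps)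
  qed
  define m' where "m' = (\<lambda>\<xi>. (- 2 * z * of_real \<xi>) * m \<xi>)"
  have m': "m' \<in> schwartz"
    unfolding m'_def by (intro schwartz_slow_mult slow.intros m)
  have m_deriv: "(m has_vector_derivative m' \<xi>) (at \<xi>)" for \<xi>
  proof -
    have "((\<lambda>w. exp (- z * w\<^sup>2)) has_field_derivative (- z * (2 * of_real \<xi>)) * exp (- z * (of_real \<xi>)\<^sup>2)) (at (of_real \<xi>))"
      by (auto intro!: derivative_eq_intros)
    from has_vector_derivative_real_field[OF this]
    show ?thesis by (simp add: m_eq m'_def mult_ac)
  qed
  have f_deriv: "(f has_vector_derivative (- of_real x / (2 * z)) * f x) (at x)" for x
  proof -
    \<comment> \<open>Multiplication by \<xi> is, up to a constant, differentiation of the Gaussian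
      \<open>m\<close>. Its transform is multiplication by \<open>x\<close>, which produces the
      differential equation.\<close>
    have "(\<lambda>\<xi>. (- \<i> * of_real \<xi>) * m \<xi>) = (\<lambda>\<xi>. \<i> / (2 * z) * m' \<xi>)"
      using z by (simp add: fun_eq_iff m'_def)
    then have "fourier (\<lambda>\<xi>. (- \<i> * of_real \<xi>) * m \<xi>) x = \<i> / (2 * z) * fourier m' x"
      by (simp add: fourier_def mult_ac flip: integral_mult_right_zero)
    also have "\<dots> = \<i> / (2 * z) * (\<i> * of_real x * f x)"
      by (simp add: fourier_of_deriv[OF m m' m_deriv] f_def m_def)
    also have "\<dots> = (- of_real x / (2 * z)) * f x"
      using z by (simp add: field_simps)
    finally show ?thesis
      using fourier_deriv[OF m, of x] by (simp add: f_def m_def)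
  qed
  \<comment> \<open>Integrating factor: the product with the inverse Gaussian is constant.\<close>
  have "((\<lambda>x. f x * exp (of_real (x\<^sup>2) / (4 * z))) has_vector_derivative 0) (at x)" for x
  proof -
    have "((\<lambda>w. exp (w\<^sup>2 / (4 * z))) has_field_derivative (of_real x / (2 * z)) * exp ((of_real x)\<^sup>2 / (4 * z))) (at (of_real x))"
      using z by (auto intro!: derivative_eq_intros simp: field_simps)
    from has_vector_derivative_mult[OF f_deriv has_vector_derivative_real_field[OF this]]
    show ?thesis by (simp add: mult_ac)
  qed
  then obtain C where C: "\<And>x. x \<in> UNIV \<Longrightarrow> f x * exp (of_real (x\<^sup>2) / (4 * z)) = C"
    by (rule has_vector_derivative_zero_constant[OF convex_UNIV]) blast
  have "f x * exp (of_real (x\<^sup>2) / (4 * z)) = f 0"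
    using C[of x] C[of 0] by simp
  then show ?thesis
    by (simp add: f_def z_def exp_minus field_simps)
qed

text \<open>The transform has modulus \<open>c * exp (- a * x^2)\<close> with \<open>a\<close> the
  real part of \<open>1 / (4 * z)\<close>. Plancherel's inequality gives
  \<open>c^2 * \<bar>z\<bar> \<le> pi\<close>, so the L^1 norm of the kernel is at most
  \<open>sqrt (\<bar>z\<bar> / \<tau>)\<close>, and
  \<open>\<bar>z\<bar> \<le> \<tau> + \<bar>t\<bar>\<close>.\<close>

lemma fourier_inv_chirp_L1_le:
  assumes \<tau>: "\<tau> > 0"
  shows "(LINT x|lborel. norm (fourier_inv (chirp t \<tau>) x)) \<le> sqrt (1 + \<bar>t\<bar> / \<tau>)"
proof -
  define z where "z = Complex \<tau> t"
  have "Re z \<noteq> 0" using assms by (simp add: z_def)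
  then have z: "norm z > 0" by auto
  define f where "f = fourier (chirp t \<tau>)"
  define c where "c = norm (f 0)"
  define a where "a = \<tau> / (4 * (norm z)\<^sup>2)"
  have a: "a > 0" using \<tau> z by (simp add: a_def)
  have Re: "Re (- (of_real (x\<^sup>2) / (4 * z))) = - a * x\<^sup>2" for x
  proof -
    have e: "of_real (x\<^sup>2) / (4 * z) = of_real (x\<^sup>2 / 4) * inverse z"
      using \<open>Re z \<noteq> 0\<close> by (auto simp: field_simps)
    have "Re (of_real (x\<^sup>2) / (4 * z)) = x\<^sup>2 / 4 * Re (inverse z)"
      unfolding e by (simp only: times_complex.sel Re_complex_of_real Im_complex_of_real)
    then show ?thesis by (simp add: a_def z_def cmod_power2)
  qed
  have nf: "norm (f x) = c * exp (- a * x\<^sup>2)" for x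
    unfolding f_def c_def
    by (subst fourier_chirp[OF \<tau>]) (simp only: norm_mult norm_exp_eq_Re Re z_def[symmetric])
  have "ennreal (c\<^sup>2) * ennreal (sqrt (pi / (2 * a))) = (\<integral>\<^sup>+x. ennreal (c\<^sup>2) * ennreal (exp (- (2 * a) * x\<^sup>2)) \<partial>lborel)"
    using a nn_integral_gauss[of "2 * a"] by (subst nn_integral_cmult) auto
  also have "\<dots> = (\<integral>\<^sup>+x. ennreal ((norm (f x))\<^sup>2) \<partial>lborel)"
    by (intro nn_integral_cong) (simp add: nf power_mult_distrib exp_double[symmetric] mult.assoc flip: ennreal_mult)
  also have "\<dots> \<le> ennreal (2 * pi) * (\<integral>\<^sup>+\<xi>. ennreal ((norm (chirp t \<tau> \<xi>))\<^sup>2) \<partial>lborel)"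
    unfolding f_def by (intro fourier_L2_le schwartz_integrable chirp_schwartz \<tau>)
  also have "(\<integral>\<^sup>+\<xi>. ennreal ((norm (chirp t \<tau> \<xi>))\<^sup>2) \<partial>lborel) = (\<integral>\<^sup>+\<xi>. ennreal (exp (- (2 * \<tau>) * \<xi>\<^sup>2)) \<partial>lborel)"
    by (intro nn_integral_cong) (simp add: norm_chirp exp_double[symmetric] mult.assoc)
  also have "\<dots> = ennreal (sqrt (pi / (2 * \<tau>)))"
    using \<tau> by (intro nn_integral_gauss) simp
  finally have "c\<^sup>2 * sqrt (pi / (2 * a)) \<le> 2 * pi * sqrt (pi / (2 * \<tau>))"
    using a \<tau> by (simp flip: ennreal_mult)
  moreover have "sqrt (pi / (2 * a)) = 2 * norm z * sqrt (pi / (2 * \<tau>))"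
  proof -
    have "pi / (2 * a) = (2 * norm z)\<^sup>2 * (pi / (2 * \<tau>))" using \<tau> z by (simp add: a_def field_simps)
    then show ?thesis using z by (simp only: real_sqrt_mult real_sqrt_abs)
  qed
  ultimately have "(c\<^sup>2 * norm z) * (2 * sqrt (pi / (2 * \<tau>))) \<le> pi * (2 * sqrt (pi / (2 * \<tau>)))"
    by (simp add: mult_ac)
  then have c_le: "c\<^sup>2 * norm z \<le> pi"
    using \<tau> by (subst (asm) mult_le_cancel_right_pos) auto
  have "(LINT x|lborel. norm (fourier_inv (chirp t \<tau>) x)) = (LINT x|lborel. c / (2 * pi) * exp (- a * x\<^sup>2))"
    by (intro Bochner_Integration.integral_cong refl)
      (simp add: fourier_inv_eq norm_mult norm_divide nf[unfolded f_def])
  also have "\<dots> = c / (2 * pi) * (LINT x|lborel. exp (- a * x\<^sup>2))" by simp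
  also have "(LINT x|lborel. exp (- a * x\<^sup>2)) = sqrt (pi / a)"
    using a nn_integral_gauss[OF a] by (subst integral_eq_nn_integral) auto
  also have "c / (2 * pi) * sqrt (pi / a) = sqrt (c\<^sup>2 * norm z * (norm z / (pi * \<tau>)))"
  proof -
    have "c \<ge> 0" by (simp add: c_def)
    have "pi / a = (2 * pi)\<^sup>2 * ((norm z)\<^sup>2 / (pi * \<tau>))" using \<tau> z by (simp add: a_def field_simps power2_eq_square)
    then have s: "sqrt (pi / a) = 2 * pi * sqrt ((norm z)\<^sup>2 / (pi * \<tau>))"
      by (simp only: real_sqrt_mult real_sqrt_abs) simp
    have "c / (2 * pi) * sqrt (pi / a) = c * sqrt ((norm z)\<^sup>2 / (pi * \<tau>))"
      unfolding s by simp
    also have "\<dots> = sqrt (c\<^sup>2) * sqrt ((norm z)\<^sup>2 / (pi * \<tau>))" using \<open>c \<ge> 0\<close> by simp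
    also have "\<dots> = sqrt (c\<^sup>2 * ((norm z)\<^sup>2 / (pi * \<tau>)))"
      by (simp only: real_sqrt_mult)
    also have "c\<^sup>2 * ((norm z)\<^sup>2 / (pi * \<tau>)) = c\<^sup>2 * norm z * (norm z / (pi * \<tau>))"
      by (simp add: power2_eq_square)
    finally show ?thesis .
  qed
  also have "\<dots> \<le> sqrt (pi * (norm z / (pi * \<tau>)))"
    using c_le \<tau> z by (intro real_sqrt_le_mono mult_right_mono) auto
  also have "\<dots> = sqrt (norm z / \<tau>)" by simp
  also have "\<dots> \<le> sqrt (1 + \<bar>t\<bar> / \<tau>)"
  proof (intro real_sqrt_le_mono)
    have "norm z \<le> \<tau> + \<bar>t\<bar>" using cmod_le[of z] \<tau> by (simp add: z_def)
    then show "norm z / \<tau> \<le> 1 + \<bar>t\<bar> / \<tau>" using \<tau> by (simp add: field_simps)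
  qed
  finally show ?thesis .
qed

text \<open>The phases differ by at most \<open>\<bar>r - t\<bar> * \<xi>^2\<close>, and
  \<open>\<xi>^2 * exp (- \<tau> * \<xi>^2) \<le> 1 / \<tau>\<close>. The first bound tends to 0 as
  \<open>r\<close> tends to \<open>t\<close> for fixed \<tau>; the constant 2 keeps a majorant that
  does not blow up as \<tau> tends to 0.\<close>

lemma norm_chirp_diff_le:
  assumes "\<tau> > 0"
  shows "norm (chirp r \<tau> \<xi> - chirp t \<tau> \<xi>) \<le> min 2 (\<bar>r - t\<bar> / \<tau>)"
proof -
  have "norm (cis (- (r * \<xi>\<^sup>2)) - cis (- (t * \<xi>\<^sup>2))) \<le> \<bar>r - t\<bar> * \<xi>\<^sup>2"
  proof -
    have "cis (- (r * \<xi>\<^sup>2)) - cis (- (t * \<xi>\<^sup>2)) = cis (- (t * \<xi>\<^sup>2)) * (cis (- ((r - t) * \<xi>\<^sup>2)) - 1)"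
      by (simp add: right_diff_distrib cis_mult algebra_simps)
    moreover have "norm (cis (- ((r - t) * \<xi>\<^sup>2)) - 1) \<le> \<bar>(r - t) * \<xi>\<^sup>2\<bar>"
      using iexp_approx1[of "- ((r - t) * \<xi>\<^sup>2)" 0] by (simp add: cis_conv_exp)
    ultimately show ?thesis by (simp add: norm_mult abs_mult)
  qed
  moreover have "chirp r \<tau> \<xi> - chirp t \<tau> \<xi> = (cis (- (r * \<xi>\<^sup>2)) - cis (- (t * \<xi>\<^sup>2))) * of_real (exp (- \<tau> * \<xi>\<^sup>2))"
    by (simp add: chirp_def left_diff_distrib)
  ultimately have "norm (chirp r \<tau> \<xi> - chirp t \<tau> \<xi>) \<le> \<bar>r - t\<bar> * \<xi>\<^sup>2 * exp (- \<tau> * \<xi>\<^sup>2)"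
    by (simp add: norm_mult mult_right_mono)
  also have "\<dots> = \<bar>r - t\<bar> / \<tau> * ((\<tau> * \<xi>\<^sup>2) ^ 1 * exp (- (\<tau> * \<xi>\<^sup>2)))"
    using assms by simp
  also have "\<dots> \<le> \<bar>r - t\<bar> / \<tau> * fact 1"
    using assms by (intro mult_left_mono power_mult_exp_neg_le) auto
  finally have "norm (chirp r \<tau> \<xi> - chirp t \<tau> \<xi>) \<le> \<bar>r - t\<bar> / \<tau>" by simp
  moreover have "norm (chirp r \<tau> \<xi> - chirp t \<tau> \<xi>) \<le> 1 + 1"
    by (rule order_trans[OF norm_triangle_ineq4]) (intro add_mono norm_chirp_le assms)
  ultimately show ?thesis by simp
qed

lemma fourier_inv_diff:
  assumes "integrable lborel m" "integrable lborel m'"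
  shows "fourier_inv (\<lambda>\<xi>. m \<xi> - m' \<xi>) x = fourier_inv m x - fourier_inv m' x"
proof -
  have "integrable lborel (\<lambda>\<xi>. cis (x * \<xi>) * m \<xi>)" "integrable lborel (\<lambda>\<xi>. cis (x * \<xi>) * m' \<xi>)"
    using assms by (auto intro!: integrable_cis_mult)
  then have "(LINT \<xi>|lborel. cis (x * \<xi>) * (m \<xi> - m' \<xi>)) = (LINT \<xi>|lborel. cis (x * \<xi>) * m \<xi>) - (LINT \<xi>|lborel. cis (x * \<xi>) * m' \<xi>)"
    by (subst Bochner_Integration.integral_diff[symmetric]) (auto simp: right_diff_distrib)
  then show ?thesis by (simp add: fourier_inv_def diff_divide_distrib)
qed

lemma fourier_inv_chirp_diff_L1_le:
  assumes \<tau>: "\<tau> > 0" and T: "\<bar>r\<bar> \<le> T" "\<bar>t\<bar> \<le> T"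
  shows "(LINT x|lborel. norm (fourier_inv (\<lambda>\<xi>. chirp r \<tau> \<xi> - chirp t \<tau> \<xi>) x)) \<le> 2 * sqrt (1 + T / \<tau>)"
proof -
  have i: "integrable lborel (\<lambda>x. norm (fourier_inv (chirp t \<tau>) x))" for t
    by (intro integrable_norm schwartz_integrable fourier_inv_schwartz chirp_schwartz \<tau>)
  have eq: "fourier_inv (\<lambda>\<xi>. chirp r \<tau> \<xi> - chirp t \<tau> \<xi>) x = fourier_inv (chirp r \<tau>) x - fourier_inv (chirp t \<tau>) x" for x
    by (intro fourier_inv_diff schwartz_integrable chirp_schwartz \<tau>)
  have "(LINT x|lborel. norm (fourier_inv (\<lambda>\<xi>. chirp r \<tau> \<xi> - chirp t \<tau> \<xi>) x)) \<le>
      (LINT x|lborel. norm (fourier_inv (chirp r \<tau>) x) + norm (fourier_inv (chirp t \<tau>) x))"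
    unfolding eq by (intro integral_mono' Bochner_Integration.integrable_add i norm_triangle_ineq4) auto
  also have "\<dots> = (LINT x|lborel. norm (fourier_inv (chirp r \<tau>) x)) + (LINT x|lborel. norm (fourier_inv (chirp t \<tau>) x))"
    by (intro Bochner_Integration.integral_add i)
  also have "\<dots> \<le> sqrt (1 + T / \<tau>) + sqrt (1 + T / \<tau>)"
    using T \<tau> by (intro add_mono order_trans[OF fourier_inv_chirp_L1_le[OF \<tau>]] real_sqrt_le_mono add_left_mono divide_right_mono) auto
  finally show ?thesis by simp
qed

section \<open>Averages of convolution operators\<close>

text \<open>The probability density of the Gamma law with shape \<sigma> and rate 1. Extension by 0
  turns all averages into integrals over the line, so that non-positive \<tau> contribute
  nothing.\<close>

definition gamma_weight :: "real \<Rightarrow> real \<Rightarrow> real" where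
  "gamma_weight \<sigma> \<tau> = (if \<tau> > 0 then \<tau> powr (\<sigma> - 1) * exp (- \<tau>) / Gamma \<sigma> else 0)"

lemma gamma_weight_measurable [measurable]: "gamma_weight \<sigma> \<in> borel_measurable borel"
  unfolding gamma_weight_def by measurable

lemma gamma_weight_nonneg: "\<sigma> > 0 \<Longrightarrow> gamma_weight \<sigma> \<tau> \<ge> 0"
  by (auto simp: gamma_weight_def intro!: mult_nonneg_nonneg divide_nonneg_nonneg less_imp_le[OF Gamma_real_pos])

lemma nn_integral_gamma_weight:
  assumes "\<sigma> > 0"
  shows "(\<integral>\<^sup>+\<tau>. ennreal (gamma_weight \<sigma> \<tau>) \<partial>lborel) = 1"
proof -
  have G: "Gamma \<sigma> > 0" using assms by (rule Gamma_real_pos)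
  have "(\<integral>\<^sup>+\<tau>. ennreal (gamma_weight \<sigma> \<tau>) \<partial>lborel) =
      (\<integral>\<^sup>+t. ennreal (1 / Gamma \<sigma>) * ennreal (indicator {0..} t * t powr (\<sigma> - 1) / exp t) \<partial>lborel)"
    using G by (intro nn_integral_cong)
      (auto simp: gamma_weight_def exp_minus field_simps split: split_indicator simp flip: ennreal_mult)
  also have "\<dots> = ennreal (1 / Gamma \<sigma>) * ennreal (Gamma \<sigma>)"
    unfolding Gamma_conv_nn_integral_real[OF assms] by (intro nn_integral_cmult) measurable
  also have "\<dots> = 1" using G by (simp flip: ennreal_mult)
  finally show ?thesis .
qed

lemma integrable_gamma_weight:
  assumes "\<sigma> > 0"
  shows "integrable lborel (gamma_weight \<sigma>)"
  by (rule integrableI_bounded) (use nn_integral_gamma_weight[OF assms] gamma_weight_nonneg[OF assms] in auto)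

lemma integral_gamma_weight:
  assumes "\<sigma> > 0"
  shows "(LINT \<tau>|lborel. gamma_weight \<sigma> \<tau>) = 1"
  by (subst integral_eq_nn_integral)
    (use nn_integral_gamma_weight[OF assms] gamma_weight_nonneg[OF assms] in auto)

text \<open>Laplace transform of the Gamma law, obtained by rescaling the identity that its total
  mass is 1 by the factor \<open>1 + b\<close>.\<close>

lemma integral_gamma_weight_exp:
  assumes "\<sigma> > 0" "b \<ge> 0"
  shows "(LINT \<tau>|lborel. gamma_weight \<sigma> \<tau> * exp (- \<tau> * b)) = (1 + b) powr (- \<sigma>)"
proof -
  have "1 = (LINT \<tau>|lborel. gamma_weight \<sigma> \<tau>)" using integral_gamma_weight[OF assms(1)] ..
  also have "\<dots> = (1 + b) * (LINT \<tau>|lborel. gamma_weight \<sigma> ((1 + b) * \<tau>))"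
    using assms lborel_integral_real_affine[of "1 + b" "gamma_weight \<sigma>" 0] by simp
  also have "(\<lambda>\<tau>. gamma_weight \<sigma> ((1 + b) * \<tau>)) = (\<lambda>\<tau>. (1 + b) powr (\<sigma> - 1) * (gamma_weight \<sigma> \<tau> * exp (- \<tau> * b)))"
  proof
    fix \<tau>
    have "exp (- ((1 + b) * \<tau>)) = exp (- \<tau>) * exp (- \<tau> * b)"
      by (simp add: algebra_simps flip: exp_add)
    then show "gamma_weight \<sigma> ((1 + b) * \<tau>) = (1 + b) powr (\<sigma> - 1) * (gamma_weight \<sigma> \<tau> * exp (- \<tau> * b))"
      using assms by (auto simp: gamma_weight_def powr_mult zero_less_mult_iff)
  qed
  also have "(1 + b) * (LINT \<tau>|lborel. (1 + b) powr (\<sigma> - 1) * (gamma_weight \<sigma> \<tau> * exp (- \<tau> * b))) =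
      (1 + b) powr \<sigma> * (LINT \<tau>|lborel. gamma_weight \<sigma> \<tau> * exp (- \<tau> * b))"
    using assms by (simp add: powr_diff)
  finally show ?thesis
    using assms by (simp add: powr_minus field_simps)
qed

text \<open>A negative power of \<tau> only shifts the shape parameter to
  \<open>\<sigma> - a\<close>, which has to remain positive. The condition on \<open>s\<close> ends
  up here.\<close>

lemma integrable_gamma_weight_powr:
  assumes "\<sigma> > a" "a \<ge> 0"
  shows "integrable lborel (\<lambda>\<tau>. gamma_weight \<sigma> \<tau> * \<tau> powr (- a))"
proof -
  have G: "Gamma (\<sigma> - a) > 0" using assms by (intro Gamma_real_pos) simp
  have "gamma_weight \<sigma> \<tau> * \<tau> powr (- a) = Gamma (\<sigma> - a) / Gamma \<sigma> * gamma_weight (\<sigma> - a) \<tau>" for \<tau>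
  proof (cases "\<tau> > 0")
    case True
    have "\<tau> powr (\<sigma> - 1) * \<tau> powr (- a) = \<tau> powr (\<sigma> - a - 1)"
      by (simp add: powr_add[symmetric] algebra_simps)
    moreover have "gamma_weight \<sigma> \<tau> * \<tau> powr (- a) = (\<tau> powr (\<sigma> - 1) * \<tau> powr (- a)) * exp (- \<tau>) / Gamma \<sigma>"
      using True by (simp add: gamma_weight_def)
    ultimately show ?thesis using True G by (simp add: gamma_weight_def)
  qed (simp add: gamma_weight_def)
  then show ?thesis using integrable_gamma_weight[of "\<sigma> - a"] assms by simp
qed

lemma norm_Lp_power_eq:
  fixes f :: "real \<Rightarrow> complex"
  assumes "f \<in> Lp p" "p \<ge> 1"
  shows "(\<integral>\<^sup>+x. ennreal (norm (f x) powr p) \<partial>lborel) = ennreal (Lp_norm p f powr p)"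
    and "f \<in> borel_measurable borel" "integrable lborel (\<lambda>x. norm (f x) powr p)"
proof -
  show i: "integrable lborel (\<lambda>x. norm (f x) powr p)" "f \<in> borel_measurable borel"
    using assms by (auto simp: Lp_def)
  have "(\<integral>\<^sup>+x. ennreal (norm (f x) powr p) \<partial>lborel) = ennreal (LINT x|lborel. norm (f x) powr p)"
    by (intro nn_integral_eq_integral i) auto
  also have "(LINT x|lborel. norm (f x) powr p) = Lp_norm p f powr p"
    using assms(2) by (simp add: Lp_norm_def powr_powr)
  finally show "(\<integral>\<^sup>+x. ennreal (norm (f x) powr p) \<partial>lborel) = ennreal (Lp_norm p f powr p)" .
qed

lemma Lp_norm_nonneg: "Lp_norm p f \<ge> 0"
  by (simp add: Lp_norm_def)

lemma Lp_normI:
  fixes f :: "real \<Rightarrow> complex"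
  assumes [measurable]: "f \<in> borel_measurable borel" and p: "p \<ge> 1" and "C \<ge> 0"
    and bound: "(\<integral>\<^sup>+x. ennreal (norm (f x) powr p) \<partial>lborel) \<le> ennreal (C powr p)"
  shows "f \<in> Lp p" "Lp_norm p f \<le> C"
proof -
  have "(\<integral>\<^sup>+x. ennreal (norm (f x) powr p) \<partial>lborel) < \<infinity>"
    using bound by (simp add: order_le_less_trans)
  then have "integrable lborel (\<lambda>x. norm (f x) powr p)"
    by (intro nn_integral_powr_integrable) measurable
  then show f: "f \<in> Lp p" by (simp add: Lp_def)
  have "Lp_norm p f powr p \<le> C powr p"
    using bound unfolding norm_Lp_power_eq(1)[OF f p] by simp
  then show "Lp_norm p f \<le> C"
    using p Lp_norm_nonneg[of p f] \<open>C \<ge> 0\<close> by (metis powr_mono_both' powr_less_mono2 linorder_not_le less_le_trans zero_less_one)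
qed

text \<open>An L^p-valued integral realised pointwise: Minkowski's inequality gives existence and
  the norm bound, and Fubini against Schwartz functions identifies the result as a distribution. It
  serves both for the Gamma averages over \<tau> and for the time integral of a derivative.\<close>

lemma Lp_average:
  fixes G :: "real \<Rightarrow> real \<Rightarrow> complex"
  assumes [measurable]: "(\<lambda>(\<tau>, x). G \<tau> x) \<in> borel_measurable (borel \<Otimes>\<^sub>M borel)"
    and N: "\<And>\<tau>. N \<tau> \<ge> 0" "integrable lborel N" and p: "p \<ge> 1"
    and bound: "AE \<tau> in lborel. (\<integral>\<^sup>+x. ennreal (norm (G \<tau> x) powr p) \<partial>lborel) \<le> ennreal (N \<tau> powr p)"
  defines "avg \<equiv> \<lambda>x. LINT \<tau>|lborel. G \<tau> x"
  shows "AE x in lborel. integrable lborel (\<lambda>\<tau>. G \<tau> x)"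
    and "avg \<in> Lp p" "Lp_norm p avg \<le> (LINT \<tau>|lborel. N \<tau>)"
    and "\<psi> \<in> schwartz \<Longrightarrow> (LINT x|lborel. avg x * \<psi> x) = (LINT \<tau>|lborel. LINT x|lborel. G \<tau> x * \<psi> x)"
    and "\<psi> \<in> schwartz \<Longrightarrow> integrable lborel (\<lambda>\<tau>. LINT x|lborel. G \<tau> x * \<psi> x)"
proof -
  \<comment> \<open>The integral of the norms lies in L^p as well, and this is what makes Fubini
    applicable after multiplication by \<psi>.\<close>
  define dom where "dom = (\<lambda>x. LINT \<tau>|lborel. norm (G \<tau> x))"
  have [measurable]: "dom \<in> borel_measurable borel" "avg \<in> borel_measurable borel"
    unfolding dom_def avg_def by measurable
  have dom_nn: "dom x \<ge> 0" for x unfolding dom_def by (intro integral_nonneg_AE) auto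
  have *: "(\<lambda>(\<tau>, x). norm (G \<tau> x)) \<in> borel_measurable (lborel \<Otimes>\<^sub>M lborel)" by measurable
  note mink = minkowski_integral[OF sigma_finite_lborel sigma_finite_lborel * norm_ge_zero N p bound]
  show int: "AE x in lborel. integrable lborel (\<lambda>\<tau>. G \<tau> x)"
    using mink(1) by eventually_elim (rule integrable_norm_cancel, assumption, measurable)
  have dom_bound: "(\<integral>\<^sup>+x. ennreal (dom x powr p) \<partial>lborel) \<le> ennreal ((LINT \<tau>|lborel. N \<tau>) powr p)"
    using mink(2) unfolding dom_def .
  have "(\<integral>\<^sup>+x. ennreal (norm (avg x) powr p) \<partial>lborel) \<le> (\<integral>\<^sup>+x. ennreal (dom x powr p) \<partial>lborel)"
    unfolding avg_def dom_def using p
    by (intro nn_integral_mono ennreal_leI powr_mono2 integral_norm_bound) auto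
  also note dom_bound
  finally have avg_bound: "(\<integral>\<^sup>+x. ennreal (norm (avg x) powr p) \<partial>lborel) \<le> ennreal ((LINT \<tau>|lborel. N \<tau>) powr p)" .
  have "(LINT \<tau>|lborel. N \<tau>) \<ge> 0" by (intro integral_nonneg_AE AE_I2 N)
  from Lp_normI[OF _ p this avg_bound]
  show "avg \<in> Lp p" "Lp_norm p avg \<le> (LINT \<tau>|lborel. N \<tau>)" by simp_all
  assume \<psi>: "\<psi> \<in> schwartz"
  note [measurable] = schwartz_borel[OF \<psi>]
  have int2: "integrable (lborel \<Otimes>\<^sub>M lborel) (\<lambda>(x, \<tau>). G \<tau> x * \<psi> x)"
  proof (rule lborel_pair.Fubini_integrable)
    show "(\<lambda>(x, \<tau>). G \<tau> x * \<psi> x) \<in> borel_measurable (lborel \<Otimes>\<^sub>M lborel)" by measurable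
    show "AE x in lborel. integrable lborel (\<lambda>\<tau>. case (x, \<tau>) of (x, \<tau>) \<Rightarrow> G \<tau> x * \<psi> x)"
      using int by eventually_elim simp
    obtain b where b: "\<And>x. norm (\<psi> x) \<le> b" using schwartz_bounded[OF \<psi>] by blast
    have "(\<integral>\<^sup>+x. ennreal (norm (complex_of_real (dom x)) powr p) \<partial>lborel) < \<infinity>"
      using dom_bound by (simp add: dom_nn order_le_less_trans)
    then have "integrable lborel (\<lambda>x. of_real (dom x) * \<psi> x)"
      by (intro schwartz_integrable_mult[OF _ schwartz_borel[OF \<psi>] schwartz_integrable[OF \<psi>] b p]
        nn_integral_powr_integrable) auto
    from integrable_norm[OF this]
    show "integrable lborel (\<lambda>x. LINT \<tau>|lborel. norm (case (x, \<tau>) of (x, \<tau>) \<Rightarrow> G \<tau> x * \<psi> x))"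
      using dom_nn by (simp add: norm_mult dom_def)
  qed
  show "integrable lborel (\<lambda>\<tau>. LINT x|lborel. G \<tau> x * \<psi> x)"
    using lborel_pair.integrable_snd[OF int2] .
  have "(LINT x|lborel. avg x * \<psi> x) = (LINT x|lborel. LINT \<tau>|lborel. G \<tau> x * \<psi> x)"
    by (simp add: avg_def)
  also have "\<dots> = (LINT \<tau>|lborel. LINT x|lborel. G \<tau> x * \<psi> x)"
    by (rule lborel_pair.Fubini_integral[OF int2, symmetric])
  finally show "(LINT x|lborel. avg x * \<psi> x) = (LINT \<tau>|lborel. LINT x|lborel. G \<tau> x * \<psi> x)" .
qed

text \<open>Instantiated with one chirp, which gives boundedness of the flow, and with a difference
  of two chirps, which gives continuity in time. \<open>A\<close> bounds the symbol (the L^2 side),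
  \<open>B\<close> the L^1 norm of the kernel (the L^infinity side), and \<open>N_int\<close> makes
  the interpolated operator norms integrable.\<close>

locale kernel_family =
  fixes m :: "real \<Rightarrow> real \<Rightarrow> complex" and A B :: "real \<Rightarrow> real" and p \<sigma> :: real
  assumes m_meas: "(\<lambda>(\<tau>, \<xi>). m \<tau> \<xi>) \<in> borel_measurable (borel \<Otimes>\<^sub>M borel)"
    and m_schwartz: "\<And>\<tau>. \<tau> > 0 \<Longrightarrow> m \<tau> \<in> schwartz"
    and A: "\<And>\<tau> \<xi>. \<tau> > 0 \<Longrightarrow> norm (m \<tau> \<xi>) \<le> A \<tau>"
    and B: "\<And>\<tau>. \<tau> > 0 \<Longrightarrow> (LINT x|lborel. norm (fourier_inv (m \<tau>) x)) \<le> B \<tau>" "\<And>\<tau>. \<tau> > 0 \<Longrightarrow> B \<tau> > 0"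
    and p: "p \<ge> 2" and \<sigma>: "\<sigma> > 0"
    and N_int: "integrable lborel (\<lambda>\<tau>. gamma_weight \<sigma> \<tau> * (marcinkiewicz_const p * (A \<tau>)\<^sup>2 * B \<tau> powr (p - 2)) powr (1 / p))"
begin

definition op_norm :: real where
  "op_norm = (LINT \<tau>|lborel. gamma_weight \<sigma> \<tau> * (marcinkiewicz_const p * (A \<tau>)\<^sup>2 * B \<tau> powr (p - 2)) powr (1 / p))"

definition integrand :: "(real \<Rightarrow> complex) \<Rightarrow> real \<Rightarrow> real \<Rightarrow> complex" where
  "integrand f \<tau> x = of_real (gamma_weight \<sigma> \<tau>) * conv (fourier_inv (m \<tau>)) f x"

definition average :: "(real \<Rightarrow> complex) \<Rightarrow> real \<Rightarrow> complex" where
  "average f x = (LINT \<tau>|lborel. integrand f \<tau> x)"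

lemma integrand_measurable [measurable]:
  assumes [measurable]: "f \<in> borel_measurable borel"
  shows "(\<lambda>(\<tau>, x). integrand f \<tau> x) \<in> borel_measurable (borel \<Otimes>\<^sub>M borel)"
proof -
  note [measurable] = m_meas
  have [measurable]: "(\<lambda>(\<tau>, x). fourier_inv (m \<tau>) x) \<in> borel_measurable (borel \<Otimes>\<^sub>M borel)"
    unfolding fourier_inv_def by measurable
  have [measurable]: "(\<lambda>(\<tau>, x). conv (fourier_inv (m \<tau>)) f x) \<in> borel_measurable (borel \<Otimes>\<^sub>M borel)"
    unfolding conv_def by measurable
  show ?thesis unfolding integrand_def by measurable
qed

lemma op_norm_nonneg: "op_norm \<ge> 0"
  unfolding op_norm_def using gamma_weight_nonneg[OF \<sigma>] by (intro integral_nonneg_AE AE_I2) simp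

context
  fixes f :: "real \<Rightarrow> complex"
  assumes f: "f \<in> Lp p"
begin

lemma f_meas [measurable]: "f \<in> borel_measurable borel"
  using f by (simp add: Lp_def)

lemma integrand_Lp_le:
  "(\<integral>\<^sup>+x. ennreal (norm (integrand f \<tau> x) powr p) \<partial>lborel) \<le>
    ennreal ((gamma_weight \<sigma> \<tau> * (marcinkiewicz_const p * (A \<tau>)\<^sup>2 * B \<tau> powr (p - 2)) powr (1 / p) * Lp_norm p f) powr p)"
proof (cases "\<tau> > 0")
  case True
  have p1: "p \<ge> 1" using p by simp
  define K where "K = marcinkiewicz_const p * (A \<tau>)\<^sup>2 * B \<tau> powr (p - 2)"
  have K: "K \<ge> 0" unfolding K_def using marcinkiewicz_const_pos[OF p] by simp
  have w: "gamma_weight \<sigma> \<tau> \<ge> 0" by (rule gamma_weight_nonneg[OF \<sigma>])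
  have [measurable]: "conv (fourier_inv (m \<tau>)) f \<in> borel_measurable borel"
    using schwartz_borel[OF fourier_inv_schwartz[OF m_schwartz[OF True]]] by measurable
  have "(\<integral>\<^sup>+x. ennreal (norm (integrand f \<tau> x) powr p) \<partial>lborel) =
      (\<integral>\<^sup>+x. ennreal (gamma_weight \<sigma> \<tau> powr p) * ennreal (norm (conv (fourier_inv (m \<tau>)) f x) powr p) \<partial>lborel)"
    using w by (intro nn_integral_cong) (simp add: integrand_def norm_mult powr_mult flip: ennreal_mult)
  also have "\<dots> = ennreal (gamma_weight \<sigma> \<tau> powr p) * (\<integral>\<^sup>+x. ennreal (norm (conv (fourier_inv (m \<tau>)) f x) powr p) \<partial>lborel)"
    by (intro nn_integral_cmult) measurable
  also have "\<dots> \<le> ennreal (gamma_weight \<sigma> \<tau> powr p) * (ennreal K * (\<integral>\<^sup>+x. ennreal (norm (f x) powr p) \<partial>lborel))"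
    unfolding K_def
    by (intro mult_left_mono conv_Lp_bound m_schwartz A B True p) (auto simp: norm_Lp_power_eq(1)[OF f p1])
  also have "\<dots> = ennreal ((gamma_weight \<sigma> \<tau> * K powr (1 / p) * Lp_norm p f) powr p)"
    unfolding norm_Lp_power_eq(1)[OF f p1] using w K p
    by (simp add: powr_mult powr_powr Lp_norm_nonneg mult.assoc flip: ennreal_mult)
  finally show ?thesis by (simp add: K_def)
qed (simp add: integrand_def gamma_weight_def)

lemma integrand_average:
  shows integrand_integrable: "AE x in lborel. integrable lborel (\<lambda>\<tau>. integrand f \<tau> x)"
    and average_Lp: "average f \<in> Lp p" "Lp_norm p (average f) \<le> op_norm * Lp_norm p f"
    and average_pairing: "\<psi> \<in> schwartz \<Longrightarrow>
      (LINT x|lborel. average f x * \<psi> x) = (LINT \<tau>|lborel. LINT x|lborel. integrand f \<tau> x * \<psi> x)"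
proof -
  let ?N = "\<lambda>\<tau>. gamma_weight \<sigma> \<tau> * (marcinkiewicz_const p * (A \<tau>)\<^sup>2 * B \<tau> powr (p - 2)) powr (1 / p) * Lp_norm p f"
  have N: "?N \<tau> \<ge> 0" for \<tau> using gamma_weight_nonneg[OF \<sigma>] Lp_norm_nonneg by simp
  have N': "integrable lborel ?N" by (intro integrable_mult_left N_int)
  have p1: "p \<ge> 1" using p by simp
  have eq: "(LINT \<tau>|lborel. ?N \<tau>) = op_norm * Lp_norm p f" by (simp add: op_norm_def)
  note avg = Lp_average[OF integrand_measurable[OF f_meas] N N' p1 AE_I2[OF integrand_Lp_le]]
  show "AE x in lborel. integrable lborel (\<lambda>\<tau>. integrand f \<tau> x)" by (rule avg(1))
  show "average f \<in> Lp p" using avg(2) by (simp add: average_def[abs_def])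
  show "Lp_norm p (average f) \<le> op_norm * Lp_norm p f" using avg(3) unfolding eq average_def[abs_def] .
  show "(LINT x|lborel. average f x * \<psi> x) = (LINT \<tau>|lborel. LINT x|lborel. integrand f \<tau> x * \<psi> x)"
    if "\<psi> \<in> schwartz" using avg(4)[OF that] unfolding average_def[abs_def] .
qed

end

end

section \<open>Duality: moving the averaged operator onto the test function\<close>

lemma conv_pairing:
  assumes [measurable]: "f \<in> borel_measurable borel" and p: "p \<ge> 1"
    and f: "integrable lborel (\<lambda>x. norm (f x) powr p)" and k: "k \<in> schwartz" and \<psi>: "\<psi> \<in> schwartz"
  shows "(LINT x|lborel. conv k f x * \<psi> x) = (LINT y|lborel. f y * (LINT x|lborel. \<psi> x * k (x - y)))"
proof -
  note [measurable] = schwartz_borel[OF k] schwartz_borel[OF \<psi>]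
  obtain b where b: "b \<ge> 0" "\<And>x. norm (k x) \<le> b" using schwartz_bounded[OF k] by blast
  define L where "L = (LINT y|lborel. norm (k y)) + b * (LINT y|lborel. norm (f y) powr p)"
  have kint: "integrable lborel (\<lambda>y. norm (k (x - y)))" for x
    by (intro integrable_norm schwartz_integrable_translate k)
  have int: "integrable lborel (\<lambda>y. f y * k (x - y))" for x
    by (rule conv_integrable[OF _ p f k]) measurable
  have L: "(LINT y|lborel. norm (f y * k (x - y))) \<le> L" for x
  proof -
    have "(LINT y|lborel. norm (f y * k (x - y))) \<le> (LINT y|lborel. norm (k (x - y)) + b * norm (f y) powr p)"
    proof (intro integral_mono integrable_norm int Bochner_Integration.integrable_add schwartz_integrable_translate k integrable_mult_right f)
      fix y
      have "norm (f y * k (x - y)) \<le> (1 + norm (f y) powr p) * norm (k (x - y))"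
        unfolding norm_mult using p by (intro mult_right_mono le_one_plus_powr) auto
      also have "\<dots> \<le> norm (k (x - y)) + b * norm (f y) powr p"
        using mult_right_mono[OF b(2)[of "x - y"], of "norm (f y) powr p"] by (simp add: algebra_simps)
      finally show "norm (f y * k (x - y)) \<le> norm (k (x - y)) + b * norm (f y) powr p" .
    qed
    also have "\<dots> = (LINT y|lborel. norm (k (x - y))) + b * (LINT y|lborel. norm (f y) powr p)"
      using kint f by simp
    also have "(LINT y|lborel. norm (k (x - y))) = (LINT y|lborel. norm (k y))"
      using lborel_integral_real_affine[of "-1" "\<lambda>y. norm (k y)" x] by simp
    finally show ?thesis by (simp add: L_def)
  qed
  have int2: "integrable (lborel \<Otimes>\<^sub>M lborel) (\<lambda>(x, y). f y * k (x - y) * \<psi> x)"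
  proof (rule lborel_pair.Fubini_integrable)
    show "(\<lambda>(x, y). f y * k (x - y) * \<psi> x) \<in> borel_measurable (lborel \<Otimes>\<^sub>M lborel)" by measurable
    show "AE x in lborel. integrable lborel (\<lambda>y. case (x, y) of (x, y) \<Rightarrow> f y * k (x - y) * \<psi> x)"
      using int by (intro AE_I2) simp
    show "integrable lborel (\<lambda>x. LINT y|lborel. norm (case (x, y) of (x, y) \<Rightarrow> f y * k (x - y) * \<psi> x))"
    proof (rule Bochner_Integration.integrable_bound)
      show "integrable lborel (\<lambda>x. L * norm (\<psi> x))"
        by (intro integrable_mult_right integrable_norm schwartz_integrable \<psi>)
      show "AE x in lborel. norm (LINT y|lborel. norm (case (x, y) of (x, y) \<Rightarrow> f y * k (x - y) * \<psi> x)) \<le> norm (L * norm (\<psi> x))"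
      proof (rule AE_I2)
        fix x
        have "(LINT y|lborel. norm (f y * k (x - y) * \<psi> x)) = (LINT y|lborel. norm (f y * k (x - y))) * norm (\<psi> x)"
          by (simp only: norm_mult[of _ "\<psi> x"] integral_mult_left_zero)
        moreover have "0 \<le> (LINT y|lborel. norm (f y * k (x - y)))" by (intro integral_nonneg_AE) auto
        ultimately show "norm (LINT y|lborel. norm (case (x, y) of (x, y) \<Rightarrow> f y * k (x - y) * \<psi> x)) \<le> norm (L * norm (\<psi> x))"
          using L[of x] by (simp add: abs_mult mult_right_mono)
      qed
    qed measurable
  qed
  have "(LINT x|lborel. conv k f x * \<psi> x) = (LINT x|lborel. LINT y|lborel. f y * k (x - y) * \<psi> x)"
    by (simp add: conv_def)
  also have "\<dots> = (LINT y|lborel. LINT x|lborel. f y * k (x - y) * \<psi> x)"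
    by (rule lborel_pair.Fubini_integral[OF int2, symmetric])
  also have "\<dots> = (LINT y|lborel. f y * (LINT x|lborel. \<psi> x * k (x - y)))"
    by (simp add: mult_ac flip: integral_mult_right_zero)
  finally show ?thesis .
qed

text \<open>The kernel is non-negative with unit mass, so smoothing increases neither the sup norm
  nor the L^1 norm. The bounds are uniform in \<tau>.\<close>

lemma heat_smoothing_bounds:
  assumes h: "h \<in> schwartz" and b: "\<And>y. norm (h y) \<le> b" and "\<tau> > 0"
  defines "\<eta> \<equiv> \<lambda>x. LINT y|lborel. h y * of_real (heat \<tau> (y - x))"
  shows "norm (\<eta> x) \<le> b" "(\<integral>\<^sup>+x. ennreal (norm (\<eta> x)) \<partial>lborel) \<le> (\<integral>\<^sup>+x. ennreal (norm (h x)) \<partial>lborel)"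
proof -
  note [measurable] = schwartz_borel[OF h]
  have le: "ennreal (norm (\<eta> x)) \<le> (\<integral>\<^sup>+y. ennreal (norm (h y)) * ennreal (heat \<tau> (y - x)) \<partial>lborel)" for x
    unfolding \<eta>_def
    by (rule order_trans[OF ennreal_norm_integral_le])
      (simp add: norm_mult heat_nonneg ennreal_mult)
  have b0: "b \<ge> 0" using b[of 0] norm_ge_zero order_trans by blast
  have "ennreal (norm (\<eta> x)) \<le> (\<integral>\<^sup>+y. ennreal b * ennreal (heat \<tau> (y - x)) \<partial>lborel)"
    by (rule order_trans[OF le]) (intro nn_integral_mono mult_right_mono ennreal_leI b; simp)
  also have "\<dots> = ennreal b"
    using nn_integral_heat_translate(1)[OF \<open>\<tau> > 0\<close>, of x] by (simp add: nn_integral_cmult)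
  finally show "norm (\<eta> x) \<le> b" using b0 by simp
  have "(\<integral>\<^sup>+x. ennreal (norm (\<eta> x)) \<partial>lborel) \<le> (\<integral>\<^sup>+x. \<integral>\<^sup>+y. ennreal (norm (h y)) * ennreal (heat \<tau> (y - x)) \<partial>lborel \<partial>lborel)"
    by (intro nn_integral_mono le)
  also have "\<dots> = (\<integral>\<^sup>+y. \<integral>\<^sup>+x. ennreal (norm (h y)) * ennreal (heat \<tau> (y - x)) \<partial>lborel \<partial>lborel)"
    by (rule lborel_pair.Fubini') measurable
  also have "\<dots> = (\<integral>\<^sup>+x. ennreal (norm (h x)) \<partial>lborel)"
    using nn_integral_heat_translate(2)[OF \<open>\<tau> > 0\<close>] by (simp add: nn_integral_cmult)
  finally show "(\<integral>\<^sup>+x. ennreal (norm (\<eta> x)) \<partial>lborel) \<le> (\<integral>\<^sup>+x. ennreal (norm (h x)) \<partial>lborel)" .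
qed

lemma measurable_chirp2 [measurable]: "(\<lambda>(\<tau>, \<xi>). chirp t \<tau> \<xi>) \<in> borel_measurable (borel \<Otimes>\<^sub>M borel)"
  unfolding chirp_def by measurable

text \<open>Here the Gamma integral of the damping factors is carried out, under the Fourier
  integral of a Schwartz function where everything converges absolutely.\<close>

lemma gamma_average_fourier_chirp:
  assumes \<kappa>: "\<kappa> \<in> schwartz" and \<sigma>: "\<sigma> > 0"
  shows "(LINT \<tau>|lborel. of_real (gamma_weight \<sigma> \<tau>) * fourier (\<lambda>\<xi>. chirp t \<tau> \<xi> * \<kappa> \<xi>) x) =
    fourier (\<lambda>\<xi>. cis (- (t * \<xi>\<^sup>2)) * of_real ((1 + \<xi>\<^sup>2) powr (- \<sigma>)) * \<kappa> \<xi>) x"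
proof -
  note [measurable] = schwartz_borel[OF \<kappa>]
  have int: "integrable (lborel \<Otimes>\<^sub>M lborel) (\<lambda>(\<tau>, \<xi>). of_real (gamma_weight \<sigma> \<tau>) * (cis (- (\<xi> * x)) * (chirp t \<tau> \<xi> * \<kappa> \<xi>)))"
  proof (rule Bochner_Integration.integrable_bound)
    \<comment> \<open>The trivial phase \<open>cis 0\<close> only brings the product into the shape
      of \<open>integrable_product_lborel\<close>.\<close>
    show "integrable (lborel \<Otimes>\<^sub>M lborel) (\<lambda>(\<tau>, \<xi>). cis 0 * complex_of_real (gamma_weight \<sigma> \<tau>) * \<kappa> \<xi>)"
      by (rule integrable_product_lborel[OF integrable_of_real[OF integrable_gamma_weight[OF \<sigma>]] schwartz_integrable[OF \<kappa>]]) simp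
    have "norm (of_real (gamma_weight \<sigma> \<tau>) * (cis (- (\<xi> * x)) * (chirp t \<tau> \<xi> * \<kappa> \<xi>))) \<le> norm (cis 0 * complex_of_real (gamma_weight \<sigma> \<tau>) * \<kappa> \<xi>)" for \<tau> \<xi>
    proof (cases "\<tau> > 0")
      case True
      then have "norm (chirp t \<tau> \<xi>) * norm (\<kappa> \<xi>) \<le> norm (\<kappa> \<xi>)"
        by (intro mult_left_le_one_le norm_chirp_le) auto
      then show ?thesis by (simp add: norm_mult mult_left_mono)
    qed (simp add: gamma_weight_def)
    then show "AE z in lborel \<Otimes>\<^sub>M lborel. norm (case z of (\<tau>, \<xi>) \<Rightarrow> of_real (gamma_weight \<sigma> \<tau>) * (cis (- (\<xi> * x)) * (chirp t \<tau> \<xi> * \<kappa> \<xi>)))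
        \<le> norm (case z of (\<tau>, \<xi>) \<Rightarrow> cis 0 * complex_of_real (gamma_weight \<sigma> \<tau>) * \<kappa> \<xi>)"
      by (intro AE_I2) (auto split: prod.split)
  qed measurable
  have "(LINT \<tau>|lborel. of_real (gamma_weight \<sigma> \<tau>) * fourier (\<lambda>\<xi>. chirp t \<tau> \<xi> * \<kappa> \<xi>) x) =
      (LINT \<tau>|lborel. LINT \<xi>|lborel. of_real (gamma_weight \<sigma> \<tau>) * (cis (- (\<xi> * x)) * (chirp t \<tau> \<xi> * \<kappa> \<xi>)))"
    by (simp add: fourier_def)
  also have "\<dots> = (LINT \<xi>|lborel. LINT \<tau>|lborel. of_real (gamma_weight \<sigma> \<tau>) * (cis (- (\<xi> * x)) * (chirp t \<tau> \<xi> * \<kappa> \<xi>)))"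
    by (rule lborel_pair.Fubini_integral[OF int, symmetric])
  also have "\<dots> = fourier (\<lambda>\<xi>. cis (- (t * \<xi>\<^sup>2)) * of_real ((1 + \<xi>\<^sup>2) powr (- \<sigma>)) * \<kappa> \<xi>) x"
    unfolding fourier_def
  proof (intro Bochner_Integration.integral_cong refl)
    fix \<xi>
    have "(LINT \<tau>|lborel. of_real (gamma_weight \<sigma> \<tau>) * (cis (- (\<xi> * x)) * (chirp t \<tau> \<xi> * \<kappa> \<xi>))) =
        (LINT \<tau>|lborel. (cis (- (\<xi> * x)) * cis (- (t * \<xi>\<^sup>2)) * \<kappa> \<xi>) * complex_of_real (gamma_weight \<sigma> \<tau> * exp (- \<tau> * \<xi>\<^sup>2)))"
      by (simp add: chirp_def mult_ac)
    also have "\<dots> = (cis (- (\<xi> * x)) * cis (- (t * \<xi>\<^sup>2)) * \<kappa> \<xi>) * of_real (LINT \<tau>|lborel. gamma_weight \<sigma> \<tau> * exp (- \<tau> * \<xi>\<^sup>2))"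
      by (simp only: integral_mult_right_zero integral_complex_of_real)
    also have "(LINT \<tau>|lborel. gamma_weight \<sigma> \<tau> * exp (- \<tau> * \<xi>\<^sup>2)) = (1 + \<xi>\<^sup>2) powr (- \<sigma>)"
      by (intro integral_gamma_weight_exp \<sigma>) simp
    finally show "(LINT \<tau>|lborel. of_real (gamma_weight \<sigma> \<tau>) * (cis (- (\<xi> * x)) * (chirp t \<tau> \<xi> * \<kappa> \<xi>))) =
        cis (- (\<xi> * x)) * (cis (- (t * \<xi>\<^sup>2)) * of_real ((1 + \<xi>\<^sup>2) powr (- \<sigma>)) * \<kappa> \<xi>)"
      by (simp add: mult_ac)
  qed
  finally show ?thesis .
qed

text \<open>Exchanging the integrals over \<tau> and \<open>x\<close> needs a bound on the dual
  functions \<open>\<eta> \<tau>\<close> that is uniform in \<tau>, whereas the kernel bound grows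
  as \<tau> tends to 0. Hence the oscillating phase, which does not depend on \<tau>, is first
  absorbed into one Schwartz function \<open>h\<close>; then \<open>\<eta> \<tau>\<close> is just a
  heat smoothing of \<open>h\<close>.\<close>

lemma chirp_duality:
  assumes f: "f \<in> Lp p" and p: "p \<ge> 1" and \<psi>: "\<psi> \<in> schwartz" and \<sigma>: "\<sigma> > 0"
  shows "(LINT \<tau>|lborel. LINT x|lborel. of_real (gamma_weight \<sigma> \<tau>) * conv (fourier_inv (chirp t \<tau>)) f x * \<psi> x) =
    (LINT x|lborel. f x * fourier (\<lambda>\<xi>. cis (- (t * \<xi>\<^sup>2)) * of_real ((1 + \<xi>\<^sup>2) powr (- \<sigma>)) * fourier_inv \<psi> \<xi>) x)"
proof -
  note f_int = norm_Lp_power_eq(3)[OF f p]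
  note [measurable] = norm_Lp_power_eq(2)[OF f p] schwartz_borel[OF \<psi>]
  have psi': "fourier_inv \<psi> \<in> schwartz" by (rule fourier_inv_schwartz[OF \<psi>])
  note [measurable] = schwartz_borel[OF psi']
  define \<eta> where "\<eta> = (\<lambda>\<tau>. fourier (\<lambda>\<xi>. chirp t \<tau> \<xi> * fourier_inv \<psi> \<xi>))"
  have [measurable]: "(\<lambda>(\<tau>, x). \<eta> \<tau> x) \<in> borel_measurable (borel \<Otimes>\<^sub>M borel)"
    unfolding \<eta>_def fourier_def by measurable
  define \<kappa> where "\<kappa> = (\<lambda>\<xi>. cis (- t * \<xi>\<^sup>2) * fourier_inv \<psi> \<xi>)"
  have \<kappa>: "\<kappa> \<in> schwartz" unfolding \<kappa>_def by (intro schwartz_slow_mult slow.intros psi')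
  define h where "h = fourier \<kappa>"
  have h: "h \<in> schwartz" unfolding h_def by (rule fourier_schwartz[OF \<kappa>])
  have h_inv: "fourier_inv h = \<kappa>" unfolding h_def by (rule fourier_inversion[OF \<kappa>])
  obtain b where b: "b \<ge> 0" "\<And>x. norm (h x) \<le> b" using schwartz_bounded[OF h] by blast
  have \<eta>_heat: "\<eta> \<tau> x = (LINT y|lborel. h y * of_real (heat \<tau> (y - x)))" if "\<tau> > 0" for \<tau> x
  proof -
    have "(\<lambda>\<xi>. chirp t \<tau> \<xi> * fourier_inv \<psi> \<xi>) = (\<lambda>\<xi>. of_real (exp (- \<tau> * \<xi>\<^sup>2)) * fourier_inv h \<xi>)"
      by (simp add: fun_eq_iff h_inv \<kappa>_def chirp_def mult_ac)
    then show ?thesis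
      unfolding \<eta>_def
      by (simp only: fourier_mult_fourier_inv[OF schwartz_integrable[OF schwartz_gauss[OF that]] schwartz_integrable[OF h]] fourier_inv_gauss[OF that])
  qed
  have \<eta>_le: "norm (\<eta> \<tau> x) \<le> b" if "\<tau> > 0" for \<tau> x
    using heat_smoothing_bounds(1)[OF h b(2) that, of x] by (simp add: \<eta>_heat[OF that])
  have \<eta>_L1: "(\<integral>\<^sup>+x. ennreal (norm (\<eta> \<tau> x)) \<partial>lborel) \<le> ennreal (LINT x|lborel. norm (h x))" if "\<tau> > 0" for \<tau>
  proof -
    have "(\<integral>\<^sup>+x. ennreal (norm (h x)) \<partial>lborel) = ennreal (LINT x|lborel. norm (h x))"
      by (intro nn_integral_eq_integral integrable_norm schwartz_integrable h) auto
    then show ?thesis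
      using heat_smoothing_bounds(2)[OF h b(2) that] by (simp add: \<eta>_heat[OF that])
  qed
  have \<eta>_int: "integrable lborel (\<eta> \<tau>)" if "\<tau> > 0" for \<tau>
    using \<eta>_L1[OF that] by (intro integrableI_bounded) (auto simp: order_le_less_trans)
  define L where "L = (LINT x|lborel. norm (h x)) + b * (LINT x|lborel. norm (f x) powr p)"
  have f\<eta>_int: "integrable lborel (\<lambda>x. f x * \<eta> \<tau> x)" if "\<tau> > 0" for \<tau>
    by (rule schwartz_integrable_mult[OF _ _ \<eta>_int[OF that] \<eta>_le[OF that] p f_int]) measurable
  have L: "(LINT x|lborel. norm (f x * \<eta> \<tau> x)) \<le> L" if "\<tau> > 0" for \<tau>
  proof -
    have "(LINT x|lborel. norm (f x * \<eta> \<tau> x)) \<le> (LINT x|lborel. norm (\<eta> \<tau> x) + b * norm (f x) powr p)"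
    proof (intro integral_mono integrable_norm f\<eta>_int that Bochner_Integration.integrable_add \<eta>_int integrable_mult_right f_int)
      fix x
      have "norm (f x * \<eta> \<tau> x) \<le> (1 + norm (f x) powr p) * norm (\<eta> \<tau> x)"
        unfolding norm_mult using p by (intro mult_right_mono le_one_plus_powr) auto
      also have "\<dots> \<le> norm (\<eta> \<tau> x) + b * norm (f x) powr p"
        using mult_right_mono[OF \<eta>_le[OF that, of x], of "norm (f x) powr p"] by (simp add: algebra_simps)
      finally show "norm (f x * \<eta> \<tau> x) \<le> norm (\<eta> \<tau> x) + b * norm (f x) powr p" .
    qed
    also have "\<dots> = (LINT x|lborel. norm (\<eta> \<tau> x)) + b * (LINT x|lborel. norm (f x) powr p)"
      using \<eta>_int[OF that] f_int by simp
    also have "(LINT x|lborel. norm (\<eta> \<tau> x)) \<le> (LINT x|lborel. norm (h x))"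
    proof -
      have "ennreal (LINT x|lborel. norm (\<eta> \<tau> x)) = (\<integral>\<^sup>+x. ennreal (norm (\<eta> \<tau> x)) \<partial>lborel)"
        by (intro nn_integral_eq_integral[symmetric] integrable_norm \<eta>_int that) auto
      also note \<eta>_L1[OF that]
      finally show ?thesis by (subst (asm) ennreal_le_iff) (auto intro: integral_nonneg_AE)
    qed
    finally show ?thesis by (simp add: L_def)
  qed
  have inner: "(LINT x|lborel. of_real (gamma_weight \<sigma> \<tau>) * conv (fourier_inv (chirp t \<tau>)) f x * \<psi> x) =
      (LINT x|lborel. of_real (gamma_weight \<sigma> \<tau>) * (f x * \<eta> \<tau> x))" for \<tau>
  proof (cases "\<tau> > 0")
    case True
    have k: "fourier_inv (chirp t \<tau>) \<in> schwartz" by (intro fourier_inv_schwartz chirp_schwartz True)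
    have "\<eta> \<tau> y = (LINT x|lborel. \<psi> x * fourier_inv (chirp t \<tau>) (x - y))" for y
      unfolding \<eta>_def by (intro fourier_mult_fourier_inv schwartz_integrable chirp_schwartz True \<psi>)
    then have "(LINT x|lborel. conv (fourier_inv (chirp t \<tau>)) f x * \<psi> x) = (LINT x|lborel. f x * \<eta> \<tau> x)"
      using conv_pairing[OF _ p f_int k \<psi>] by simp
    then show ?thesis by (simp add: mult.assoc)
  qed (simp add: gamma_weight_def)
  have int: "integrable (lborel \<Otimes>\<^sub>M lborel) (\<lambda>(\<tau>, x). of_real (gamma_weight \<sigma> \<tau>) * (f x * \<eta> \<tau> x))"
  proof (rule lborel_pair.Fubini_integrable)
    show "(\<lambda>(\<tau>, x). of_real (gamma_weight \<sigma> \<tau>) * (f x * \<eta> \<tau> x)) \<in> borel_measurable (lborel \<Otimes>\<^sub>M lborel)" by measurable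
    have "integrable lborel (\<lambda>x. of_real (gamma_weight \<sigma> \<tau>) * (f x * \<eta> \<tau> x))" for \<tau>
      using f\<eta>_int[of \<tau>] by (cases "\<tau> > 0") (auto simp: gamma_weight_def)
    then show "AE \<tau> in lborel. integrable lborel (\<lambda>x. case (\<tau>, x) of (\<tau>, x) \<Rightarrow> of_real (gamma_weight \<sigma> \<tau>) * (f x * \<eta> \<tau> x))"
      by (intro AE_I2) simp
    show "integrable lborel (\<lambda>\<tau>. LINT x|lborel. norm (case (\<tau>, x) of (\<tau>, x) \<Rightarrow> of_real (gamma_weight \<sigma> \<tau>) * (f x * \<eta> \<tau> x)))"
    proof (rule Bochner_Integration.integrable_bound)
      show "integrable lborel (\<lambda>\<tau>. gamma_weight \<sigma> \<tau> * L)" by (intro integrable_mult_left integrable_gamma_weight \<sigma>)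
      show "AE \<tau> in lborel. norm (LINT x|lborel. norm (case (\<tau>, x) of (\<tau>, x) \<Rightarrow> of_real (gamma_weight \<sigma> \<tau>) * (f x * \<eta> \<tau> x))) \<le> norm (gamma_weight \<sigma> \<tau> * L)"
      proof (rule AE_I2)
        fix \<tau>
        have "(LINT x|lborel. norm (of_real (gamma_weight \<sigma> \<tau>) * (f x * \<eta> \<tau> x))) = gamma_weight \<sigma> \<tau> * (LINT x|lborel. norm (f x * \<eta> \<tau> x))"
          using gamma_weight_nonneg[OF \<sigma>, of \<tau>] by (simp add: norm_mult[of "of_real _"])
        moreover have "0 \<le> (LINT x|lborel. norm (f x * \<eta> \<tau> x))" by (intro integral_nonneg_AE) auto
        moreover have "gamma_weight \<sigma> \<tau> * (LINT x|lborel. norm (f x * \<eta> \<tau> x)) \<le> gamma_weight \<sigma> \<tau> * L"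
        proof (cases "\<tau> > 0")
          case True
          then show ?thesis by (intro mult_left_mono L gamma_weight_nonneg \<sigma>)
        qed (simp add: gamma_weight_def)
        ultimately show "norm (LINT x|lborel. norm (case (\<tau>, x) of (\<tau>, x) \<Rightarrow> of_real (gamma_weight \<sigma> \<tau>) * (f x * \<eta> \<tau> x))) \<le> norm (gamma_weight \<sigma> \<tau> * L)"
          using gamma_weight_nonneg[OF \<sigma>, of \<tau>] by simp
      qed
    qed measurable
  qed
  have "(LINT \<tau>|lborel. LINT x|lborel. of_real (gamma_weight \<sigma> \<tau>) * conv (fourier_inv (chirp t \<tau>)) f x * \<psi> x) =
      (LINT \<tau>|lborel. LINT x|lborel. of_real (gamma_weight \<sigma> \<tau>) * (f x * \<eta> \<tau> x))"
    by (simp only: inner)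
  also have "\<dots> = (LINT x|lborel. LINT \<tau>|lborel. of_real (gamma_weight \<sigma> \<tau>) * (f x * \<eta> \<tau> x))"
    by (rule lborel_pair.Fubini_integral[OF int, symmetric])
  also have "\<dots> = (LINT x|lborel. f x * (LINT \<tau>|lborel. of_real (gamma_weight \<sigma> \<tau>) * \<eta> \<tau> x))"
    by (simp add: mult.left_commute[of _ "f _"])
  also have "\<dots> = (LINT x|lborel. f x * fourier (\<lambda>\<xi>. cis (- (t * \<xi>\<^sup>2)) * of_real ((1 + \<xi>\<^sup>2) powr (- \<sigma>)) * fourier_inv \<psi> \<xi>) x)"
    unfolding \<eta>_def by (simp only: gamma_average_fourier_chirp[OF psi' \<sigma>])
  finally show ?thesis .
qed

section \<open>The flow in the Bessel potential scale\<close>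

lemma integrable_gamma_weight_interpolated:
  assumes p: "p \<ge> 2" and \<sigma>: "\<sigma> > (1 - 2 / p) / 2" and "T \<ge> 0" "C \<ge> 0" "b \<ge> 0"
  shows "integrable lborel (\<lambda>\<tau>. gamma_weight \<sigma> \<tau> * (C * (b * sqrt (1 + T / \<tau>)) powr (p - 2)) powr (1 / p))"
proof -
  \<comment> \<open>Equal to \<open>(1 - 2 / p) / 2\<close>: the exponent \<open>(p - 2) / p\<close>
    of interpolation times the 1/2 of the square root in the kernel bound.\<close>
  define \<alpha> where "\<alpha> = (p - 2) / 2 * (1 / p)"
  have \<alpha>: "\<alpha> \<ge> 0" "\<sigma> > \<alpha>" using p \<sigma> by (auto simp: \<alpha>_def field_simps)
  have \<sigma>0: "\<sigma> > 0" using \<alpha> by simp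
  define K where "K = (C * b powr (p - 2)) powr (1 / p)"
  have eq: "(C * (b * sqrt (1 + T / \<tau>)) powr (p - 2)) powr (1 / p) = K * (1 + T / \<tau>) powr \<alpha>" if "\<tau> > 0" for \<tau>
  proof -
    have "1 + T / \<tau> \<ge> 0" using that assms by simp
    then have "sqrt (1 + T / \<tau>) powr (p - 2) = (1 + T / \<tau>) powr ((p - 2) / 2)"
      by (simp add: powr_half_sqrt[symmetric] powr_powr)
    then show ?thesis
      using assms that by (simp add: K_def \<alpha>_def powr_mult powr_powr mult.assoc)
  qed
  show ?thesis
  proof (rule Bochner_Integration.integrable_bound)
    show "integrable lborel (\<lambda>\<tau>. (K * 2 powr \<alpha>) * (gamma_weight \<sigma> \<tau> + T powr \<alpha> * (gamma_weight \<sigma> \<tau> * \<tau> powr (- \<alpha>))))"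
      by (intro integrable_mult_right Bochner_Integration.integrable_add integrable_gamma_weight integrable_gamma_weight_powr \<alpha> \<sigma>0)
    show "(\<lambda>\<tau>. gamma_weight \<sigma> \<tau> * (C * (b * sqrt (1 + T / \<tau>)) powr (p - 2)) powr (1 / p)) \<in> borel_measurable lborel"
      by measurable
    show "AE \<tau> in lborel. norm (gamma_weight \<sigma> \<tau> * (C * (b * sqrt (1 + T / \<tau>)) powr (p - 2)) powr (1 / p))
      \<le> norm ((K * 2 powr \<alpha>) * (gamma_weight \<sigma> \<tau> + T powr \<alpha> * (gamma_weight \<sigma> \<tau> * \<tau> powr (- \<alpha>))))"
    proof (rule AE_I2)
      fix \<tau> :: real
      show "norm (gamma_weight \<sigma> \<tau> * (C * (b * sqrt (1 + T / \<tau>)) powr (p - 2)) powr (1 / p))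
        \<le> norm ((K * 2 powr \<alpha>) * (gamma_weight \<sigma> \<tau> + T powr \<alpha> * (gamma_weight \<sigma> \<tau> * \<tau> powr (- \<alpha>))))"
      proof (cases "\<tau> > 0")
        case True
        define y where "y = T / \<tau>"
        have y: "y \<ge> 0" using True assms by (simp add: y_def)
        have w: "gamma_weight \<sigma> \<tau> \<ge> 0" by (rule gamma_weight_nonneg[OF \<sigma>0])
        have "(1 + y) powr \<alpha> \<le> (2 * max 1 y) powr \<alpha>" using y \<alpha> by (intro powr_mono2) auto
        also have "\<dots> = 2 powr \<alpha> * max 1 y powr \<alpha>" using y by (simp add: powr_mult)
        also have "\<dots> \<le> 2 powr \<alpha> * (1 + y powr \<alpha>)" by (intro mult_left_mono) (auto simp: max_def)
        also have "y powr \<alpha> = T powr \<alpha> * \<tau> powr (- \<alpha>)"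
          using True assms by (simp add: y_def powr_divide powr_minus_divide)
        finally have "(K * gamma_weight \<sigma> \<tau>) * (1 + T / \<tau>) powr \<alpha> \<le> (K * gamma_weight \<sigma> \<tau>) * (2 powr \<alpha> * (1 + T powr \<alpha> * \<tau> powr (- \<alpha>)))"
          using w by (intro mult_left_mono) (auto simp: y_def K_def)
        also have "\<dots> = (K * 2 powr \<alpha>) * (gamma_weight \<sigma> \<tau> + T powr \<alpha> * (gamma_weight \<sigma> \<tau> * \<tau> powr (- \<alpha>)))"
          by (simp add: algebra_simps)
        finally have "gamma_weight \<sigma> \<tau> * (K * (1 + T / \<tau>) powr \<alpha>) \<le> (K * 2 powr \<alpha>) * (gamma_weight \<sigma> \<tau> + T powr \<alpha> * (gamma_weight \<sigma> \<tau> * \<tau> powr (- \<alpha>)))"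
          by (simp only: mult_ac)
        then show ?thesis
          using w unfolding eq[OF True] by (simp add: K_def)
      qed (simp add: gamma_weight_def)
    qed
  qed
qed

lemma kernel_family_chirp:
  assumes p: "p \<ge> 2" and \<sigma>: "\<sigma> > (1 - 2 / p) / 2" and t: "\<bar>t\<bar> \<le> T"
  shows "kernel_family (chirp t) (\<lambda>_. 1) (\<lambda>\<tau>. sqrt (1 + T / \<tau>)) p \<sigma>"
proof
  have "(1 - 2 / p) / 2 \<ge> 0" using p by simp
  then show "\<sigma> > 0" using \<sigma> by linarith
  have T: "T \<ge> 0" using t by simp
  show "integrable lborel (\<lambda>\<tau>. gamma_weight \<sigma> \<tau> * (marcinkiewicz_const p * 1\<^sup>2 * sqrt (1 + T / \<tau>) powr (p - 2)) powr (1 / p))"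
    using integrable_gamma_weight_interpolated[OF p \<sigma> T, of "marcinkiewicz_const p" 1] marcinkiewicz_const_pos[OF p] by simp
  show "(LINT x|lborel. norm (fourier_inv (chirp t \<tau>) x)) \<le> sqrt (1 + T / \<tau>)" if "\<tau> > 0" for \<tau>
    using that t by (intro order_trans[OF fourier_inv_chirp_L1_le] real_sqrt_le_mono add_left_mono divide_right_mono) auto
  show "0 < sqrt (1 + T / \<tau>)" if "\<tau> > 0" for \<tau>
    using that T by (simp add: add_pos_nonneg)
qed (use p in \<open>auto intro: chirp_schwartz norm_chirp_le simp: measurable_chirp2\<close>)

lemma min_two_square_le: "d \<ge> 0 \<Longrightarrow> (min 2 d)\<^sup>2 \<le> (4 :: real)"
  using power_mono[of "min 2 d" 2 2] by simp

text \<open>The minimum is kept as the bound \<open>A\<close> because it tends to 0 with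
  \<open>r - t\<close>; for integrability alone it is replaced by 2, which reduces to the estimate
  for fixed constants.\<close>

lemma kernel_family_chirp_diff:
  assumes p: "p \<ge> 2" and \<sigma>: "\<sigma> > (1 - 2 / p) / 2" and t: "\<bar>t\<bar> \<le> T" and r: "\<bar>r\<bar> \<le> T"
  shows "kernel_family (\<lambda>\<tau> \<xi>. chirp r \<tau> \<xi> - chirp t \<tau> \<xi>) (\<lambda>\<tau>. min 2 (\<bar>r - t\<bar> / \<tau>)) (\<lambda>\<tau>. 2 * sqrt (1 + T / \<tau>)) p \<sigma>"
proof
  have "(1 - 2 / p) / 2 \<ge> 0" using p by simp
  then show \<sigma>0: "\<sigma> > 0" using \<sigma> by linarith
  have T: "T \<ge> 0" using t by simp
  note C = marcinkiewicz_const_pos[OF p]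
  show "integrable lborel (\<lambda>\<tau>. gamma_weight \<sigma> \<tau> * (marcinkiewicz_const p * (min 2 (\<bar>r - t\<bar> / \<tau>))\<^sup>2 * (2 * sqrt (1 + T / \<tau>)) powr (p - 2)) powr (1 / p))"
  proof (rule Bochner_Integration.integrable_bound)
    show "integrable lborel (\<lambda>\<tau>. gamma_weight \<sigma> \<tau> * (marcinkiewicz_const p * 2\<^sup>2 * (2 * sqrt (1 + T / \<tau>)) powr (p - 2)) powr (1 / p))"
      using C by (intro integrable_gamma_weight_interpolated p \<sigma> T) auto
    show "AE \<tau> in lborel. norm (gamma_weight \<sigma> \<tau> * (marcinkiewicz_const p * (min 2 (\<bar>r - t\<bar> / \<tau>))\<^sup>2 * (2 * sqrt (1 + T / \<tau>)) powr (p - 2)) powr (1 / p))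
      \<le> norm (gamma_weight \<sigma> \<tau> * (marcinkiewicz_const p * 2\<^sup>2 * (2 * sqrt (1 + T / \<tau>)) powr (p - 2)) powr (1 / p))"
    proof (rule AE_I2)
      fix \<tau> :: real
      show "norm (gamma_weight \<sigma> \<tau> * (marcinkiewicz_const p * (min 2 (\<bar>r - t\<bar> / \<tau>))\<^sup>2 * (2 * sqrt (1 + T / \<tau>)) powr (p - 2)) powr (1 / p))
        \<le> norm (gamma_weight \<sigma> \<tau> * (marcinkiewicz_const p * 2\<^sup>2 * (2 * sqrt (1 + T / \<tau>)) powr (p - 2)) powr (1 / p))"
      proof (cases "\<tau> > 0")
        case True
        then show ?thesis
          unfolding norm_mult using C p
          by (intro mult_left_mono) (auto intro!: powr_mono2 mult_right_mono mult_left_mono min_two_square_le)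
      qed (simp add: gamma_weight_def)
    qed
  qed measurable
  show "(LINT x|lborel. norm (fourier_inv (\<lambda>\<xi>. chirp r \<tau> \<xi> - chirp t \<tau> \<xi>) x)) \<le> 2 * sqrt (1 + T / \<tau>)" if "\<tau> > 0" for \<tau>
    by (rule fourier_inv_chirp_diff_L1_le[OF that r t])
  show "0 < 2 * sqrt (1 + T / \<tau>)" if "\<tau> > 0" for \<tau>
    using that T by (simp add: add_pos_nonneg)
  show "(\<lambda>(\<tau>, \<xi>). chirp r \<tau> \<xi> - chirp t \<tau> \<xi>) \<in> borel_measurable (borel \<Otimes>\<^sub>M borel)" by measurable
  show "(\<lambda>\<xi>. chirp r \<tau> \<xi> - chirp t \<tau> \<xi>) \<in> schwartz" if "\<tau> > 0" for \<tau>
    by (intro schwartz_diff chirp_schwartz that)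
qed (use p norm_chirp_diff_le in auto)

text \<open>For \<open>\<sigma> = - s / 2\<close> this is the function that represents the Bessel
  potential of order \<open>s\<close> applied to \<open>U(t) f\<close>, as
  \<open>bessel_flow_eq_td\<close> confirms.\<close>

definition bessel_flow :: "real \<Rightarrow> real \<Rightarrow> (real \<Rightarrow> complex) \<Rightarrow> real \<Rightarrow> complex" where
  "bessel_flow \<sigma> t f x = (LINT \<tau>|lborel. of_real (gamma_weight \<sigma> \<tau>) * conv (fourier_inv (chirp t \<tau>)) f x)"

lemma bessel_flow_bounded:
  assumes p: "p \<ge> 2" and \<sigma>: "\<sigma> > (1 - 2 / p) / 2"
  obtains C where "C \<ge> 0"
    "\<And>t f. \<bar>t\<bar> \<le> T \<Longrightarrow> f \<in> Lp p \<Longrightarrow> bessel_flow \<sigma> t f \<in> Lp p \<and> Lp_norm p (bessel_flow \<sigma> t f) \<le> C * Lp_norm p f"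
proof (cases "T \<ge> 0")
  case True
  define C where "C = kernel_family.op_norm (\<lambda>_. 1) (\<lambda>\<tau>. sqrt (1 + T / \<tau>)) p \<sigma>"
  \<comment> \<open>Non-negativity is stated together with the bound because it is available only
    inside an instance of the locale; the instance \<open>t = 0\<close> extracts it
    afterwards.\<close>
  have *: "C \<ge> 0 \<and> (f \<in> Lp p \<longrightarrow> bessel_flow \<sigma> t f \<in> Lp p \<and> Lp_norm p (bessel_flow \<sigma> t f) \<le> C * Lp_norm p f)" if t: "\<bar>t\<bar> \<le> T" for t f
  proof -
    interpret kernel_family "chirp t" "\<lambda>_. 1" "\<lambda>\<tau>. sqrt (1 + T / \<tau>)" p \<sigma>
      by (rule kernel_family_chirp[OF p \<sigma> t])
    have "bessel_flow \<sigma> t f = average f" by (simp add: fun_eq_iff bessel_flow_def average_def integrand_def)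
    then show ?thesis using average_Lp[of f] op_norm_nonneg by (simp add: C_def)
  qed
  show ?thesis using that[of C] * * [of 0] True by auto
next
  case False
  then show ?thesis using that[of 0] by auto
qed

lemma bessel_flow_pairing:
  assumes p: "p \<ge> 2" and \<sigma>: "\<sigma> > (1 - 2 / p) / 2" and f: "f \<in> Lp p" and \<psi>: "\<psi> \<in> schwartz"
  shows "(LINT x|lborel. bessel_flow \<sigma> t f x * \<psi> x) =
    (LINT x|lborel. f x * fourier (\<lambda>\<xi>. cis (- (t * \<xi>\<^sup>2)) * of_real ((1 + \<xi>\<^sup>2) powr (- \<sigma>)) * fourier_inv \<psi> \<xi>) x)"
proof -
  interpret kernel_family "chirp t" "\<lambda>_. 1" "\<lambda>\<tau>. sqrt (1 + \<bar>t\<bar> / \<tau>)" p \<sigma>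
    by (rule kernel_family_chirp[OF p \<sigma> order_refl])
  have "bessel_flow \<sigma> t f = average f" by (simp add: fun_eq_iff bessel_flow_def average_def integrand_def)
  then have "(LINT x|lborel. bessel_flow \<sigma> t f x * \<psi> x) =
      (LINT \<tau>|lborel. LINT x|lborel. of_real (gamma_weight \<sigma> \<tau>) * conv (fourier_inv (chirp t \<tau>)) f x * \<psi> x)"
    using average_pairing[OF f \<psi>] by (simp add: integrand_def)
  also have "\<dots> = (LINT x|lborel. f x * fourier (\<lambda>\<xi>. cis (- (t * \<xi>\<^sup>2)) * of_real ((1 + \<xi>\<^sup>2) powr (- \<sigma>)) * fourier_inv \<psi> \<xi>) x)"
    using p by (intro chirp_duality[OF f _ \<psi>] kernel_family.\<sigma>[OF kernel_family_axioms]) auto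
  finally show ?thesis .
qed

lemma conv_diff_kernel:
  assumes "integrable lborel (\<lambda>y. f y * k (x - y))" "integrable lborel (\<lambda>y. f y * k' (x - y))"
  shows "conv (\<lambda>x. k x - k' x) f x = conv k f x - conv k' f x"
  using assms by (simp add: conv_def right_diff_distrib)

text \<open>The gain \<open>\<bar>r - t\<bar> / \<tau>\<close> in the \<open>L\<^sup>2\<close> bound gives continuity in operator norm, so no
  density argument is needed.\<close>

lemma bessel_flow_continuous:
  assumes p: "p \<ge> 2" and \<sigma>: "\<sigma> > (1 - 2 / p) / 2" and t: "t \<in> {0..T}"
  obtains D where "(D \<longlongrightarrow> 0) (at t within {0..T})"
    "\<And>r f. r \<in> {0..T} \<Longrightarrow> f \<in> Lp p \<Longrightarrow> Lp_norm p (\<lambda>x. bessel_flow \<sigma> r f x - bessel_flow \<sigma> t f x) \<le> D r * Lp_norm p f"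
proof
  \<comment> \<open>The integrand of the operator norm of the difference family. It depends on
    \<open>r\<close> only through the minimum, so dominated convergence applies with the minimum
    replaced by 2.\<close>
  define N where "N = (\<lambda>r \<tau>. gamma_weight \<sigma> \<tau> * (marcinkiewicz_const p * (min 2 (\<bar>r - t\<bar> / \<tau>))\<^sup>2 * (2 * sqrt (1 + T / \<tau>)) powr (p - 2)) powr (1 / p))"
  define D where "D = (\<lambda>r. LINT \<tau>|lborel. N r \<tau>)"
  have T: "T \<ge> 0" "\<bar>t\<bar> \<le> T" using t by auto
  have "(1 - 2 / p) / 2 \<ge> 0" using p by simp
  then have \<sigma>0: "\<sigma> > 0" using \<sigma> by linarith
  note C = marcinkiewicz_const_pos[OF p]
  show "(D \<longlongrightarrow> 0) (at t within {0..T})"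
    unfolding tendsto_at_iff_sequentially comp_def
  proof (intro allI impI)
    fix X :: "nat \<Rightarrow> real"
    assume X: "\<forall>i. X i \<in> {0..T} - {t}" "X \<longlonglongrightarrow> t"
    have "(\<lambda>n. LINT \<tau>|lborel. N (X n) \<tau>) \<longlonglongrightarrow> (LINT \<tau>::real|lborel. 0::real)"
    proof (rule integral_dominated_convergence)
      show "integrable lborel (\<lambda>\<tau>. gamma_weight \<sigma> \<tau> * (marcinkiewicz_const p * 2\<^sup>2 * (2 * sqrt (1 + T / \<tau>)) powr (p - 2)) powr (1 / p))"
        using C by (intro integrable_gamma_weight_interpolated p \<sigma> T) auto
      show "AE \<tau> in lborel. norm (N (X n) \<tau>) \<le> gamma_weight \<sigma> \<tau> * (marcinkiewicz_const p * 2\<^sup>2 * (2 * sqrt (1 + T / \<tau>)) powr (p - 2)) powr (1 / p)" for n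
      proof (rule AE_I2)
        fix \<tau> :: real
        show "norm (N (X n) \<tau>) \<le> gamma_weight \<sigma> \<tau> * (marcinkiewicz_const p * 2\<^sup>2 * (2 * sqrt (1 + T / \<tau>)) powr (p - 2)) powr (1 / p)"
        proof (cases "\<tau> > 0")
          case True
          then show ?thesis
            unfolding N_def norm_mult using C p gamma_weight_nonneg[OF \<sigma>0, of \<tau>]
            by (intro mult_mono) (auto intro!: powr_mono2 mult_right_mono mult_left_mono min_two_square_le)
        qed (simp add: gamma_weight_def N_def)
      qed
      show "AE \<tau> in lborel. (\<lambda>n. N (X n) \<tau>) \<longlonglongrightarrow> 0"
      proof (rule AE_I2)
        fix \<tau> :: real
        show "(\<lambda>n. N (X n) \<tau>) \<longlonglongrightarrow> 0"
        proof (cases "\<tau> > 0")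
          case True
          have "(\<lambda>n. marcinkiewicz_const p * (min 2 (\<bar>X n - t\<bar> / \<tau>))\<^sup>2 * (2 * sqrt (1 + T / \<tau>)) powr (p - 2)) \<longlonglongrightarrow>
              marcinkiewicz_const p * (min 2 (\<bar>t - t\<bar> / \<tau>))\<^sup>2 * (2 * sqrt (1 + T / \<tau>)) powr (p - 2)"
            using True by (intro tendsto_intros X) auto
          then have "(\<lambda>n. (marcinkiewicz_const p * (min 2 (\<bar>X n - t\<bar> / \<tau>))\<^sup>2 * (2 * sqrt (1 + T / \<tau>)) powr (p - 2)) powr (1 / p)) \<longlonglongrightarrow> 0"
            using p C by (intro tendsto_zero_powrI[OF _ tendsto_const]) auto
          then show ?thesis unfolding N_def by (rule tendsto_mult_right_zero)
        qed (simp add: N_def gamma_weight_def)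
      qed
    qed (auto simp: N_def)
    then show "(\<lambda>n. D (X n)) \<longlonglongrightarrow> 0" by (simp add: D_def)
  qed
  show "Lp_norm p (\<lambda>x. bessel_flow \<sigma> r f x - bessel_flow \<sigma> t f x) \<le> D r * Lp_norm p f"
    if r: "r \<in> {0..T}" and f: "f \<in> Lp p" for r f
  proof -
    have r': "\<bar>r\<bar> \<le> T" using r by auto
    interpret R: kernel_family "chirp r" "\<lambda>_. 1" "\<lambda>\<tau>. sqrt (1 + T / \<tau>)" p \<sigma>
      by (rule kernel_family_chirp[OF p \<sigma> r'])
    interpret S: kernel_family "chirp t" "\<lambda>_. 1" "\<lambda>\<tau>. sqrt (1 + T / \<tau>)" p \<sigma>
      by (rule kernel_family_chirp[OF p \<sigma> T(2)])
    interpret D: kernel_family "\<lambda>\<tau> \<xi>. chirp r \<tau> \<xi> - chirp t \<tau> \<xi>" "\<lambda>\<tau>. min 2 (\<bar>r - t\<bar> / \<tau>)" "\<lambda>\<tau>. 2 * sqrt (1 + T / \<tau>)" p \<sigma>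
      by (rule kernel_family_chirp_diff[OF p \<sigma> T(2) r'])
    have p1: "p \<ge> 1" using p by simp
    note [measurable] = norm_Lp_power_eq(2)[OF f p1]
    note f_int = norm_Lp_power_eq(3)[OF f p1]
    have eq: "D.integrand f \<tau> x = R.integrand f \<tau> x - S.integrand f \<tau> x" for \<tau> x
    proof (cases "\<tau> > 0")
      case True
      have "fourier_inv (\<lambda>\<xi>. chirp r \<tau> \<xi> - chirp t \<tau> \<xi>) = (\<lambda>x. fourier_inv (chirp r \<tau>) x - fourier_inv (chirp t \<tau>) x)"
        by (intro ext fourier_inv_diff schwartz_integrable chirp_schwartz True)
      moreover have "integrable lborel (\<lambda>y. f y * fourier_inv (chirp t \<tau>) (x - y))" for t
        by (intro conv_integrable[OF _ p1 f_int] fourier_inv_schwartz chirp_schwartz True) measurable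
      ultimately show ?thesis
        by (simp add: D.integrand_def R.integrand_def S.integrand_def conv_diff_kernel right_diff_distrib)
    qed (simp add: D.integrand_def R.integrand_def S.integrand_def gamma_weight_def)
    \<comment> \<open>The average of the difference splits only where both averages converge
      absolutely, hence almost everywhere.\<close>
    have "AE x in lborel. D.average f x = bessel_flow \<sigma> r f x - bessel_flow \<sigma> t f x"
      using R.integrand_integrable[OF f] S.integrand_integrable[OF f]
    proof eventually_elim
      case (elim x)
      then have "D.average f x = R.average f x - S.average f x"
        by (simp add: D.average_def R.average_def S.average_def eq)
      then show ?case by (simp add: R.average_def S.average_def bessel_flow_def R.integrand_def S.integrand_def)
    qed
    moreover obtain K where "\<And>t f. \<bar>t\<bar> \<le> T \<Longrightarrow> f \<in> Lp p \<Longrightarrow>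
        bessel_flow \<sigma> t f \<in> Lp p \<and> Lp_norm p (bessel_flow \<sigma> t f) \<le> K * Lp_norm p f"
      using bessel_flow_bounded[OF p \<sigma>, of T] by blast
    then have "bessel_flow \<sigma> r f \<in> Lp p" "bessel_flow \<sigma> t f \<in> Lp p"
      using r' T(2) f by blast+
    note [measurable] = this[THEN norm_Lp_power_eq(2), OF p1] norm_Lp_power_eq(2)[OF D.average_Lp(1)[OF f] p1]
    ultimately have "Lp_norm p (\<lambda>x. bessel_flow \<sigma> r f x - bessel_flow \<sigma> t f x) = Lp_norm p (D.average f)"
      unfolding Lp_norm_def
      by (intro arg_cong[where f = "\<lambda>x. x powr _"] integral_cong_AE) (measurable, elim eventually_mono, simp)
    also have "\<dots> \<le> D r * Lp_norm p f"
      using D.average_Lp(2)[OF f] by (simp add: D.op_norm_def D_def N_def)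
    finally show ?thesis .
  qed
qed

section \<open>Distributions represented by functions\<close>

lemma schwartz_translate:
  assumes "f \<in> schwartz"
  shows "(\<lambda>x. f (x - a)) \<in> schwartz"
proof (rule schwartz_coinduct[of _ "{\<lambda>x. g (x - a) |g. g \<in> schwartz}"])
  fix h k assume "h \<in> {\<lambda>x. g (x - a) |g. g \<in> schwartz}"
  then obtain g where g: "g \<in> schwartz" and h: "h = (\<lambda>x. g (x - a))" by blast
  obtain g' where g': "g' \<in> schwartz" "\<And>x. (g has_vector_derivative g' x) (at x)"
    using schwartz_deriv[OF g] by blast
  have "(h has_vector_derivative 1 *\<^sub>R g' (x - a)) (at x)" for x
    unfolding h using g'(2)
    by (intro vector_diff_chain_at[unfolded o_def]) (auto intro!: derivative_eq_intros)
  then show "\<exists>g'\<in>{\<lambda>x. g (x - a) |g. g \<in> schwartz}. \<forall>x. (h has_vector_derivative g' x) (at x)"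
    using g'(1) by (intro bexI[of _ "\<lambda>x. g' (x - a)"]) auto
  obtain B where B: "B \<ge> 0" "\<And>x. (1 + \<bar>x\<bar>) ^ k * norm (g x) \<le> B" using schwartz_decay'[OF g] by blast
  have "\<bar>x\<bar> ^ k * norm (h x) \<le> (1 + \<bar>a\<bar>) ^ k * B" for x
  proof -
    have "\<bar>x\<bar> \<le> (1 + \<bar>a\<bar>) * (1 + \<bar>x - a\<bar>)"
    proof -
      have "(1 + \<bar>a\<bar>) * (1 + \<bar>x - a\<bar>) = 1 + \<bar>a\<bar> + \<bar>x - a\<bar> + \<bar>a\<bar> * \<bar>x - a\<bar>"
        by (simp add: distrib_left distrib_right)
      moreover have "\<bar>a\<bar> * \<bar>x - a\<bar> \<ge> 0" by simp
      ultimately show ?thesis by linarith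
    qed
    then have "\<bar>x\<bar> ^ k \<le> ((1 + \<bar>a\<bar>) * (1 + \<bar>x - a\<bar>)) ^ k" by (intro power_mono) auto
    then have "\<bar>x\<bar> ^ k * norm (h x) \<le> (1 + \<bar>a\<bar>) ^ k * ((1 + \<bar>x - a\<bar>) ^ k * norm (g (x - a)))"
      by (simp add: h power_mult_distrib mult_right_mono flip: mult.assoc)
    also have "\<dots> \<le> (1 + \<bar>a\<bar>) ^ k * B" by (intro mult_left_mono B) auto
    finally show ?thesis .
  qed
  then show "\<exists>B. \<forall>x. \<bar>x\<bar> ^ k * norm (h x) \<le> B" by blast
qed (use assms in auto)

text \<open>Testing \<open>h\<close> against this is a heat average of
  \<open>h x * exp (- x^2)\<close>. The fixed Gaussian makes that product integrable when
  \<open>h\<close> is merely integrable against Schwartz functions, and it has no zeros.\<close>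

definition gauss_test :: "real \<Rightarrow> real \<Rightarrow> real \<Rightarrow> complex" where
  "gauss_test \<tau> y x = of_real (exp (- x\<^sup>2) * heat \<tau> (x - y))"

text \<open>Completing the square turns the product of the two Gaussians into a translated Gaussian.\<close>

lemma gauss_test_schwartz:
  assumes "\<tau> > 0"
  shows "gauss_test \<tau> y \<in> schwartz"
proof -
  define \<beta> where "\<beta> = 1 / (4 * \<tau>)"
  have \<beta>: "1 + \<beta> > 0" using assms by (simp add: \<beta>_def add_pos_pos)
  define z where "z = \<beta> * y / (1 + \<beta>)"
  define C where "C = 1 / sqrt (4 * pi * \<tau>) * exp ((1 + \<beta>) * z\<^sup>2 - \<beta> * y\<^sup>2)"
  have "exp (- x\<^sup>2) * heat \<tau> (x - y) = C * exp (- (1 + \<beta>) * (x - z)\<^sup>2)" for x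
  proof -
    have "\<beta> * y = (1 + \<beta>) * z" using \<beta> by (simp add: z_def)
    then have "- x\<^sup>2 - \<beta> * (x - y)\<^sup>2 = (1 + \<beta>) * z\<^sup>2 - \<beta> * y\<^sup>2 + - (1 + \<beta>) * (x - z)\<^sup>2"
      by algebra
    moreover have "heat \<tau> (x - y) = 1 / sqrt (4 * pi * \<tau>) * exp (- \<beta> * (x - y)\<^sup>2)"
      using assms by (simp add: heat_eq \<beta>_def)
    ultimately show ?thesis
      unfolding C_def by (simp flip: exp_add)
  qed
  then have "gauss_test \<tau> y = (\<lambda>x. of_real C * of_real (exp (- (1 + \<beta>) * (x - z)\<^sup>2)))"
    by (simp add: fun_eq_iff gauss_test_def)
  then show ?thesis
    using schwartz_cmult[OF schwartz_translate[OF schwartz_gauss[OF \<beta>]]] by simp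
qed

text \<open>Vanishing is asked only for almost every centre \<open>y\<close>, because for time
  derivatives the exceptional null sets depend on the test function and leave no more than
  that.\<close>

lemma AE_zero_if_tests_zero:
  assumes [measurable]: "h \<in> borel_measurable borel"
    and int: "\<And>\<psi>. \<psi> \<in> schwartz \<Longrightarrow> integrable lborel (\<lambda>x. h x * \<psi> x)"
    and \<tau>: "\<And>n. \<tau> n > 0" "\<tau> \<longlonglongrightarrow> 0"
    and zero: "\<And>n. AE y in lborel. (LINT x|lborel. h x * gauss_test (\<tau> n) y x) = 0"
  shows "AE x in lborel. h x = 0"
proof -
  have "integrable lborel (\<lambda>x. h x * of_real (exp (- 1 * x\<^sup>2)))"
    by (intro int schwartz_gauss) simp
  moreover have "h x * of_real (exp (- 1 * x\<^sup>2)) * of_real (heat \<tau> (x - y)) = h x * gauss_test \<tau> y x" for \<tau> x y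
    by (simp add: gauss_test_def)
  then have "AE y in lborel. (LINT x|lborel. h x * of_real (exp (- 1 * x\<^sup>2)) * of_real (heat (\<tau> n) (x - y))) = 0" for n
    using zero[of n] by (simp only:)
  ultimately have "AE x in lborel. h x * of_real (exp (- 1 * x\<^sup>2)) = 0"
    by (rule AE_zero_if_heat_averages_zero[OF _ \<tau>])
  then show ?thesis by simp
qed

lemma inverse_Suc_pos_tendsto: "inverse (real (Suc n)) > 0" "(\<lambda>n. inverse (real (Suc n))) \<longlonglongrightarrow> 0"
  by (simp, rule LIMSEQ_inverse_real_of_nat)

lemma tempered_fun_diff:
  assumes "tempered_fun f" "tempered_fun g"
  shows "tempered_fun (\<lambda>x. f x - g x)"
  using assms by (auto simp: tempered_fun_def left_diff_distrib)

lemma td_of_diff: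
  assumes "tempered_fun f" "tempered_fun g"
  shows "td_of (\<lambda>x. f x - g x) \<psi> = td_of f \<psi> - td_of g \<psi>"
  using assms by (auto simp: tempered_fun_def td_of_def left_diff_distrib)

lemma td_of_eq_imp_AE:
  assumes "tempered_fun f" "tempered_fun g" "td_of f = td_of g"
  shows "AE x in lborel. f x = g x"
proof -
  have "AE x in lborel. f x - g x = 0"
  proof (rule AE_zero_if_tests_zero[OF _ _ inverse_Suc_pos_tendsto])
    show "AE y in lborel. (LINT x|lborel. (f x - g x) * gauss_test (inverse (real (Suc n))) y x) = 0" for n
    proof (rule AE_I2)
      fix y
      define \<psi> where "\<psi> = gauss_test (inverse (real (Suc n))) y"
      have \<psi>: "\<psi> \<in> schwartz" unfolding \<psi>_def by (intro gauss_test_schwartz inverse_Suc_pos_tendsto)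
      have "td_of (\<lambda>x. f x - g x) \<psi> = 0"
        using td_of_diff[OF assms(1,2), of \<psi>] assms(3) by simp
      then show "(LINT x|lborel. (f x - g x) * gauss_test (inverse (real (Suc n))) y x) = 0"
        using \<psi> by (simp add: td_of_def \<psi>_def)
    qed
  qed (use tempered_fun_diff[OF assms(1,2)] in \<open>auto simp: tempered_fun_def\<close>)
  then show ?thesis by simp
qed

lemma Lp_tempered_fun:
  assumes f: "f \<in> Lp p" and p: "p \<ge> 1"
  shows "tempered_fun f"
proof -
  have "integrable lborel (\<lambda>x. f x * \<psi> x)" if \<psi>: "\<psi> \<in> schwartz" for \<psi>
  proof -
    obtain b where "\<And>x. norm (\<psi> x) \<le> b" using schwartz_bounded[OF \<psi>] by blast
    from schwartz_integrable_mult[OF norm_Lp_power_eq(2)[OF f p] schwartz_borel[OF \<psi>] schwartz_integrable[OF \<psi>] this p norm_Lp_power_eq(3)[OF f p]]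
    show ?thesis .
  qed
  then show ?thesis using f by (auto simp: tempered_fun_def Lp_def)
qed

lemma Lp_norm_cong_AE:
  assumes [measurable]: "f \<in> borel_measurable borel" "g \<in> borel_measurable borel" and "AE x in lborel. f x = g x"
  shows "Lp_norm p f = Lp_norm p g"
  unfolding Lp_norm_def using assms(3)
  by (intro arg_cong[where f = "\<lambda>x. x powr _"] integral_cong_AE) (measurable, elim eventually_mono, simp)

text \<open>The representative picked by \<open>SOME\<close> agrees with \<open>f\<close> almost
  everywhere, so the norm of the distribution does not depend on the choice.\<close>

lemma td_Lp_norm_td_of:
  assumes f: "f \<in> Lp p" and p: "p \<ge> 1"
  shows "td_Lp_norm p (td_of f) = Lp_norm p f"
proof -
  note tf = Lp_tempered_fun[OF f p]
  have rep: "tempered_fun (td_rep (td_of f)) \<and> td_of f = td_of (td_rep (td_of f))"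
    unfolding td_rep_def by (rule someI[of "\<lambda>g. tempered_fun g \<and> td_of f = td_of g"]) (use tf in simp)
  then have "AE x in lborel. td_rep (td_of f) x = f x"
    using tf by (intro td_of_eq_imp_AE) simp_all
  then show ?thesis
    unfolding td_Lp_norm_def using rep tf
    by (intro Lp_norm_cong_AE) (auto simp: tempered_fun_def)
qed

lemma td_multiplier_eq:
  assumes "m \<in> slow" "\<psi> \<in> schwartz"
  shows "td_multiplier m F \<psi> = F (fourier (\<lambda>\<xi>. m \<xi> * fourier_inv \<psi> \<xi>))"
  using assms fourier_inv_schwartz[OF assms(2)] schwartz_slow_mult[OF assms(1) fourier_inv_schwartz[OF assms(2)]]
  by (simp add: td_multiplier_def td_fourier_inv_def td_mult_def td_fourier_def)

lemma td_multiplier_outside: "\<psi> \<notin> schwartz \<Longrightarrow> td_multiplier m F \<psi> = 0"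
  by (simp add: td_multiplier_def td_fourier_inv_def)

lemma td_multiplier_diff: "td_multiplier m (F - G) = td_multiplier m F - td_multiplier m G"
  by (auto simp: fun_eq_iff td_multiplier_def td_fourier_inv_def td_mult_def td_fourier_def)

text \<open>Only \<open>U(-t) F\<close> is known to be a function, so the phase and its inverse are
  inserted on the Fourier side of the test function: the inverse phase turns \<open>F\<close> into
  \<open>U(-t) F\<close>, and the remaining symbol is that of the flow.\<close>

lemma bessel_flow_eq_td:
  assumes p: "p \<ge> 2" and s: "s < - (1 - 2 / p)" and f: "f \<in> Lp p"
    and F: "schrodinger (- t) F = td_of f"
  shows "bessel s F = td_of (bessel_flow (- s / 2) t f)"
proof
  fix \<psi>
  define \<sigma> where "\<sigma> = - s / 2"
  have \<sigma>: "\<sigma> > (1 - 2 / p) / 2" using s by (simp add: \<sigma>_def)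
  show "bessel s F \<psi> = td_of (bessel_flow (- s / 2) t f) \<psi>"
  proof (cases "\<psi> \<in> schwartz")
    case True
    define w where "w = (\<lambda>\<xi>::real. complex_of_real ((1 + \<xi>\<^sup>2) powr (s / 2)))"
    have w: "w \<in> slow" unfolding w_def by (rule slow_bracket)
    have c: "(\<lambda>\<xi>. cis (- (t * \<xi>\<^sup>2))) \<in> slow" for t
      using slow_chirp[of "- t"] by simp
    define g where "g = (\<lambda>\<xi>. cis (- (t * \<xi>\<^sup>2)) * w \<xi> * fourier_inv \<psi> \<xi>)"
    have g: "g \<in> schwartz"
      unfolding g_def by (intro schwartz_slow_mult slow_mult c w fourier_inv_schwartz True)
    have "bessel s F \<psi> = F (fourier (\<lambda>\<xi>. w \<xi> * fourier_inv \<psi> \<xi>))"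
      unfolding bessel_def w_def[symmetric] by (rule td_multiplier_eq[OF w True])
    also have "(\<lambda>\<xi>. w \<xi> * fourier_inv \<psi> \<xi>) = (\<lambda>\<xi>. cis (- (- t * \<xi>\<^sup>2)) * g \<xi>)"
      by (simp add: fun_eq_iff g_def cis_mult flip: mult.assoc)
    also have "F (fourier \<dots>) = schrodinger (- t) F (fourier g)"
      unfolding schrodinger_def
      by (subst td_multiplier_eq[OF c fourier_schwartz[OF g]]) (simp only: fourier_inversion[OF g])
    also have "\<dots> = (LINT x|lborel. f x * fourier g x)"
      unfolding F td_of_def using fourier_schwartz[OF g] by simp
    also have "\<dots> = (LINT x|lborel. bessel_flow \<sigma> t f x * \<psi> x)"
      by (subst bessel_flow_pairing[OF p \<sigma> f True]) (simp add: g_def w_def \<sigma>_def)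
    finally show ?thesis using True by (simp add: td_of_def \<sigma>_def)
  qed (simp add: bessel_def td_multiplier_outside td_of_def)
qed

text \<open>The factor 2 comes from
  \<open>\<bar>a + b\<bar> \<le> 2 * max \<bar>a\<bar> \<bar>b\<bar>\<close>; it is harmless because
  it only enters unspecified constants and limits equal to 0. Superadditivity of the power function
  recombines the two norms.\<close>

lemma Lp_add:
  assumes p: "p \<ge> 1" and f: "f \<in> Lp p" and g: "g \<in> Lp p"
  shows "(\<lambda>x. f x + g x) \<in> Lp p" "Lp_norm p (\<lambda>x. f x + g x) \<le> 2 * (Lp_norm p f + Lp_norm p g)"
proof -
  note [measurable] = norm_Lp_power_eq(2)[OF f p] norm_Lp_power_eq(2)[OF g p]
  let ?a = "Lp_norm p f" and ?b = "Lp_norm p g"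
  have ab: "?a \<ge> 0" "?b \<ge> 0" by (rule Lp_norm_nonneg)+
  have "(\<integral>\<^sup>+x. ennreal (norm (f x + g x) powr p) \<partial>lborel) \<le>
      (\<integral>\<^sup>+x. ennreal (2 powr p) * (ennreal (norm (f x) powr p) + ennreal (norm (g x) powr p)) \<partial>lborel)"
  proof (intro nn_integral_mono)
    fix x
    have "norm (f x + g x) powr p \<le> (2 * max (norm (f x)) (norm (g x))) powr p"
      using norm_triangle_ineq[of "f x" "g x"] p by (intro powr_mono2) auto
    also have "\<dots> = 2 powr p * max (norm (f x)) (norm (g x)) powr p" by (simp add: powr_mult)
    also have "\<dots> \<le> 2 powr p * (norm (f x) powr p + norm (g x) powr p)"
      by (intro mult_left_mono) (auto simp: max_def)
    finally show "ennreal (norm (f x + g x) powr p) \<le> ennreal (2 powr p) * (ennreal (norm (f x) powr p) + ennreal (norm (g x) powr p))"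
      by (simp add: ennreal_leI flip: ennreal_mult ennreal_plus)
  qed
  also have "\<dots> = ennreal (2 powr p) * (ennreal (?a powr p) + ennreal (?b powr p))"
    by (simp add: nn_integral_cmult nn_integral_add norm_Lp_power_eq(1)[OF f p] norm_Lp_power_eq(1)[OF g p])
  also have "\<dots> = ennreal (2 powr p * (?a powr p + ?b powr p))"
    by (simp flip: ennreal_mult ennreal_plus)
  also have "\<dots> \<le> ennreal ((2 * (?a + ?b)) powr p)"
  proof -
    have split: "(?a + ?b) powr p = (?a + ?b) powr (p - 1) * ?a + (?a + ?b) powr (p - 1) * ?b"
      unfolding distrib_left[symmetric] using ab p by (cases "?a + ?b = 0") (auto simp: powr_diff)
    have "?a powr p \<le> (?a + ?b) powr (p - 1) * ?a"
    proof -
      have "?a powr p = ?a powr (p - 1) * ?a" using ab by (cases "?a = 0") (auto simp: powr_diff)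
      also have "\<dots> \<le> (?a + ?b) powr (p - 1) * ?a" using ab p by (intro mult_right_mono powr_mono2) auto
      finally show ?thesis .
    qed
    moreover have "?b powr p \<le> (?a + ?b) powr (p - 1) * ?b"
    proof -
      have "?b powr p = ?b powr (p - 1) * ?b" using ab by (cases "?b = 0") (auto simp: powr_diff)
      also have "\<dots> \<le> (?a + ?b) powr (p - 1) * ?b" using ab p by (intro mult_right_mono powr_mono2) auto
      finally show ?thesis .
    qed
    ultimately have "?a powr p + ?b powr p \<le> (?a + ?b) powr p" by (simp add: split)
    then have "2 powr p * (?a powr p + ?b powr p) \<le> 2 powr p * (?a + ?b) powr p" by simp
    also have "\<dots> = (2 * (?a + ?b)) powr p" using ab by (subst powr_mult) auto
    finally show ?thesis by (rule ennreal_leI)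
  qed
  finally have "(\<integral>\<^sup>+x. ennreal (norm (f x + g x) powr p) \<partial>lborel) \<le> ennreal ((2 * (?a + ?b)) powr p)" .
  from Lp_normI[OF _ p _ this] ab
  show "(\<lambda>x. f x + g x) \<in> Lp p" "Lp_norm p (\<lambda>x. f x + g x) \<le> 2 * (?a + ?b)" by auto
qed

lemma Lp_uminus: "f \<in> Lp p \<Longrightarrow> (\<lambda>x. - f x) \<in> Lp p" "Lp_norm p (\<lambda>x. - f x) = Lp_norm p f"
  by (auto simp: Lp_def Lp_norm_def)

lemma Lp_diff: "p \<ge> 1 \<Longrightarrow> f \<in> Lp p \<Longrightarrow> g \<in> Lp p \<Longrightarrow> (\<lambda>x. f x - g x) \<in> Lp p"
  using Lp_add(1)[of p f "\<lambda>x. - g x"] Lp_uminus(1)[of g p] by simp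

section \<open>Curves with a time derivative in a weighted Lebesgue space\<close>

text \<open>The hypotheses say nothing about intervals that reach 0, so the half-open interval is
  exhausted by the sets \<open>{c n..T}\<close> with \<open>c n\<close> tending to 0.\<close>

lemma AE_zero_on_interval:
  fixes \<alpha> :: "real \<Rightarrow> complex"
  assumes int: "\<And>a b. 0 < a \<Longrightarrow> a \<le> b \<Longrightarrow> b \<le> T \<Longrightarrow> set_integrable lborel {a..b} \<alpha>"
    and zero: "\<And>a b. 0 < a \<Longrightarrow> a \<le> b \<Longrightarrow> b \<le> T \<Longrightarrow> (LINT \<tau>:{a..b}|lborel. \<alpha> \<tau>) = 0"
  shows "AE \<tau> in lborel. \<tau> \<in> {0<..T} \<longrightarrow> \<alpha> \<tau> = 0"
proof -
  define c where "c = (\<lambda>n. inverse (real (Suc n)))"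
  have c: "c n > 0" for n by (simp add: c_def)
  have "AE \<tau> in lborel. indicator {c n..T} \<tau> *\<^sub>R \<alpha> \<tau> = 0" for n
  proof (rule AE_zero_if_interval_integrals_zero)
    show "integrable lborel (\<lambda>\<tau>. indicator {c n..T} \<tau> *\<^sub>R \<alpha> \<tau>)"
      using int[of "c n" T] c[of n] by (cases "c n \<le> T") (auto simp: set_integrable_def)
    fix a b :: real
    have eq: "indicator {a..b} \<tau> *\<^sub>R (indicator {c n..T} \<tau> *\<^sub>R \<alpha> \<tau>) = indicator {max a (c n)..min b T} \<tau> *\<^sub>R \<alpha> \<tau>" for \<tau>
      by (auto simp: indicator_def)
    have "(LINT \<tau>:{max a (c n)..min b T}|lborel. \<alpha> \<tau>) = 0"
    proof (cases "max a (c n) \<le> min b T")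
      case True
      then show ?thesis using c[of n] by (intro zero) auto
    qed (simp add: set_lebesgue_integral_def)
    then show "(LINT \<tau>:{a..b}|lborel. indicator {c n..T} \<tau> *\<^sub>R \<alpha> \<tau>) = 0"
      unfolding set_lebesgue_integral_def eq .
  qed
  then have "AE \<tau> in lborel. \<forall>n. indicator {c n..T} \<tau> *\<^sub>R \<alpha> \<tau> = 0"
    unfolding AE_all_countable by blast
  then show ?thesis
  proof eventually_elim
    case (elim \<tau>)
    show ?case
    proof
      assume \<tau>: "\<tau> \<in> {0<..T}"
      then obtain n where "c n < \<tau>" using reals_Archimedean[of \<tau>] by (auto simp: c_def)
      then show "\<alpha> \<tau> = 0" using elim[rule_format, of n] \<tau> by simp
    qed
  qed
qed

lemma lborel_pair_measurable_iff:
  "f \<in> borel_measurable (lborel \<Otimes>\<^sub>M lborel) \<longleftrightarrow> f \<in> borel_measurable (borel \<Otimes>\<^sub>M (borel :: real measure))"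
  for f :: "real \<times> real \<Rightarrow> complex"
  by (simp add: lborel_prod borel_prod)

lemma gauss_test_measurable2 [measurable]: "(\<lambda>(y, x). gauss_test c y x) \<in> borel_measurable (borel \<Otimes>\<^sub>M borel)"
  unfolding gauss_test_def by measurable

text \<open>For each test function the two derivatives agree off a null set of times that depends on
  the test. The Gaussian tests depend measurably on their centre \<open>y\<close>, so Fubini for
  null sets exchanges the order: for almost every time the tests vanish for almost every
  \<open>y\<close> and all scales, which forces equality in \<open>x\<close>.\<close>

lemma time_deriv_unique:
  assumes w: "has_time_deriv T v w" and w': "has_time_deriv T v w'"
  shows "AE \<tau> in lborel. \<tau> \<in> {0..T} \<longrightarrow> (AE x in lborel. w \<tau> x = w' \<tau> x)"
proof -
  have [measurable]: "(\<lambda>(\<tau>, x). w \<tau> x) \<in> borel_measurable (borel \<Otimes>\<^sub>M borel)"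
    "(\<lambda>(\<tau>, x). w' \<tau> x) \<in> borel_measurable (borel \<Otimes>\<^sub>M borel)"
    using w w' by (simp_all add: has_time_deriv_def lborel_pair_measurable_iff)
  have tf: "AE \<tau> in lborel. \<tau> \<in> {0..T} \<longrightarrow> tempered_fun (w \<tau>) \<and> tempered_fun (w' \<tau>)"
    using w w' by (auto simp: has_time_deriv_def)
  define c where "c = (\<lambda>n. inverse (real (Suc n)))"
  define I where "I = (\<lambda>n \<tau> y. LINT x|lborel. (w \<tau> x - w' \<tau> x) * gauss_test (c n) y x)"
  have [measurable]: "(\<lambda>(\<tau>, y). I n \<tau> y) \<in> borel_measurable (borel \<Otimes>\<^sub>M borel)" for n
    unfolding I_def by measurable
  have "AE \<tau> in lborel. \<tau> \<in> {0..T} \<longrightarrow> I n \<tau> y = 0" for n y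
  proof -
    define \<psi> where "\<psi> = gauss_test (c n) y"
    have \<psi>: "\<psi> \<in> schwartz" unfolding \<psi>_def c_def by (intro gauss_test_schwartz inverse_Suc_pos_tendsto)
    have "AE \<tau> in lborel. \<tau> \<in> {0<..T} \<longrightarrow> td_of (w \<tau>) \<psi> - td_of (w' \<tau>) \<psi> = 0"
    proof (rule AE_zero_on_interval)
      fix a b assume ab: "0 < a" "a \<le> b" "b \<le> T"
      then have i: "set_integrable lborel {a..b} (\<lambda>\<tau>. td_of (w \<tau>) \<psi>)" "set_integrable lborel {a..b} (\<lambda>\<tau>. td_of (w' \<tau>) \<psi>)"
        and e: "v b \<psi> - v a \<psi> = (LINT \<tau>:{a..b}|lborel. td_of (w \<tau>) \<psi>)" "v b \<psi> - v a \<psi> = (LINT \<tau>:{a..b}|lborel. td_of (w' \<tau>) \<psi>)"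
        using w w' \<psi> unfolding has_time_deriv_def by blast+
      show "set_integrable lborel {a..b} (\<lambda>\<tau>. td_of (w \<tau>) \<psi> - td_of (w' \<tau>) \<psi>)"
        by (rule set_integral_diff(1)[OF i])
      show "(LINT \<tau>:{a..b}|lborel. td_of (w \<tau>) \<psi> - td_of (w' \<tau>) \<psi>) = 0"
        using set_integral_diff(2)[OF i] e by simp
    qed
    moreover have "AE \<tau> in lborel. \<tau> \<noteq> (0::real)" by (rule AE_lborel_singleton)
    ultimately show ?thesis
      using tf
    proof eventually_elim
      case (elim \<tau>)
      show ?case
      proof
        assume "\<tau> \<in> {0..T}"
        then have "td_of (\<lambda>x. w \<tau> x - w' \<tau> x) \<psi> = 0" using elim td_of_diff[of "w \<tau>" "w' \<tau>" \<psi>] by simp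
        then show "I n \<tau> y = 0" using \<psi> by (simp add: td_of_def I_def \<psi>_def)
      qed
    qed
  qed
  then have "AE y in lborel. AE \<tau> in lborel. \<tau> \<in> {0..T} \<longrightarrow> I n \<tau> y = 0" for n by simp
  then have "AE \<tau> in lborel. AE y in lborel. \<tau> \<in> {0..T} \<longrightarrow> I n \<tau> y = 0" for n
    by (subst lborel_pair.AE_commute) measurable
  then have "AE \<tau> in lborel. \<forall>n. AE y in lborel. \<tau> \<in> {0..T} \<longrightarrow> I n \<tau> y = 0"
    unfolding AE_all_countable by blast
  then show ?thesis
    using tf
  proof eventually_elim
    case (elim \<tau>)
    show ?case
    proof
      assume \<tau>: "\<tau> \<in> {0..T}"
      have "tempered_fun (\<lambda>x. w \<tau> x - w' \<tau> x)" using elim(2) \<tau> by (auto intro: tempered_fun_diff)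
      then have m: "(\<lambda>x. w \<tau> x - w' \<tau> x) \<in> borel_measurable borel"
        and i: "\<And>\<psi>. \<psi> \<in> schwartz \<Longrightarrow> integrable lborel (\<lambda>x. (w \<tau> x - w' \<tau> x) * \<psi> x)"
        by (simp_all add: tempered_fun_def)
      have z: "AE y in lborel. (LINT x|lborel. (w \<tau> x - w' \<tau> x) * gauss_test (inverse (real (Suc n))) y x) = 0" for n
        using spec[OF elim(1), of n] \<tau> unfolding I_def c_def by (simp only: simp_thms)
      have "AE x in lborel. w \<tau> x - w' \<tau> x = 0"
        by (rule AE_zero_if_tests_zero[OF m i inverse_Suc_pos_tendsto z])
      then show "AE x in lborel. w \<tau> x = w' \<tau> x" by simp
    qed
  qed
qed

lemma Lp_norm_measurable [measurable]:
  assumes [measurable]: "(\<lambda>(\<tau>, x). w \<tau> x) \<in> borel_measurable (borel \<Otimes>\<^sub>M borel)"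
  shows "(\<lambda>\<tau>. Lp_norm p (w \<tau>)) \<in> borel_measurable borel"
  unfolding Lp_norm_def by measurable

text \<open>The inverse weight is at most \<open>T powr (1 - 2 / p)\<close> on the interval, and
  Hoelder's inequality on a set of length \<open>T\<close> follows from the tangent inequality for
  the conjugate exponent. The factor \<open>1 + T\<close> is a crude form of the power of
  \<open>T\<close>.\<close>

lemma weighted_holder:
  fixes N :: "real \<Rightarrow> real"
  assumes p: "p \<ge> 2" and T: "T > 0" and [measurable]: "N \<in> borel_measurable borel" and N: "\<And>\<tau>. N \<tau> \<ge> 0"
    and int: "set_integrable lborel {0..T} (\<lambda>\<tau>. (\<tau> powr (- (1 - 2 / p)) * N \<tau>) powr (p / (p - 1)))"
  shows "set_integrable lborel {0..T} N"
    and "(LINT \<tau>:{0..T}|lborel. N \<tau>) \<le> T powr (1 - 2 / p) * (1 + T) *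
      (LINT \<tau>:{0..T}|lborel. (\<tau> powr (- (1 - 2 / p)) * N \<tau>) powr (p / (p - 1))) powr (1 / (p / (p - 1)))"
proof -
  define \<theta> where "\<theta> = - (1 - 2 / p)"
  define q where "q = p / (p - 1)"
  have q: "q \<ge> 1" using p by (simp add: q_def field_simps)
  have \<theta>: "\<theta> \<le> 0" using p by (simp add: \<theta>_def)
  define h where "h = (\<lambda>\<tau>. \<tau> powr \<theta> * N \<tau>)"
  have h_nn: "h \<tau> \<ge> 0" for \<tau> using N by (simp add: h_def)
  have hint: "set_integrable lborel {0..T} (\<lambda>\<tau>. h \<tau> powr q)" using int by (simp add: h_def q_def \<theta>_def)
  define P where "P = (LINT \<tau>:{0..T}|lborel. h \<tau> powr q)"
  have P: "P \<ge> 0" unfolding P_def set_lebesgue_integral_def by (intro integral_nonneg_AE) auto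
  define K where "K = T powr (- \<theta>) * (1 + T)"
  have K: "K > 0" using T by (simp add: K_def)
  have one: "set_integrable lborel {0..T} (\<lambda>_. 1 :: real)"
    unfolding set_integrable_def by (simp add: integrable_real_indicator emeasure_lborel_Icc_eq)
  have dom: "set_integrable lborel {0..T} (\<lambda>\<tau>. T powr (- \<theta>) * (h \<tau> powr q * (c powr (1 - q) / q) + ((1 - 1 / q) * c) * 1))" for c
    by (intro set_integrable_mult_right set_integral_add(1) set_integrable_mult_left hint one)
  have le: "AE \<tau> in lborel. indicator {0..T} \<tau> * N \<tau> \<le>
      indicator {0..T} \<tau> * (T powr (- \<theta>) * (h \<tau> powr q * (c powr (1 - q) / q) + ((1 - 1 / q) * c) * 1))" if "c > 0" for c
    using AE_lborel_singleton[of 0]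
  proof eventually_elim
    case (elim \<tau>)
    show ?case
    proof (cases "\<tau> \<in> {0..T}")
      case True
      then have \<tau>: "\<tau> > 0" "\<tau> \<le> T" using elim by auto
      have "N \<tau> = \<tau> powr (- \<theta>) * h \<tau>" using \<tau> by (simp add: h_def mult.assoc[symmetric] flip: powr_add)
      also have "\<dots> \<le> T powr (- \<theta>) * h \<tau>" using \<tau> \<theta> h_nn by (intro mult_right_mono powr_mono2) auto
      also have "\<dots> \<le> T powr (- \<theta>) * (h \<tau> powr q * (c powr (1 - q) / q) + ((1 - 1 / q) * c) * 1)"
        using powr_tangent_le[OF h_nn that q] by (intro mult_left_mono) auto
      finally show ?thesis using True by simp
    qed simp
  qed
  show "set_integrable lborel {0..T} N"
    unfolding set_integrable_def
  proof (rule Bochner_Integration.integrable_bound[OF dom[of 1, unfolded set_integrable_def]])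
    show "AE \<tau> in lborel. norm (indicator {0..T} \<tau> *\<^sub>R N \<tau>) \<le>
        norm (indicator {0..T} \<tau> *\<^sub>R (T powr (- \<theta>) * (h \<tau> powr q * (1 powr (1 - q) / q) + ((1 - 1 / q) * 1) * 1)))"
      using le[of 1, OF zero_less_one] by eventually_elim (use N in \<open>auto simp: indicator_def\<close>)
  qed measurable
  \<comment> \<open>The optimal parameter is \<open>P powr (1 / q)\<close>, but it may be 0 while
    the tangent inequality needs \<open>c > 0\<close>; so it is approached from above.\<close>
  have "(LINT \<tau>:{0..T}|lborel. N \<tau>) \<le> K * c" if c: "c > P powr (1 / q)" for c
  proof -
    have "c > 0" using c by (metis powr_ge_zero order_le_less_trans)
    have "P = (P powr (1 / q)) powr q" using P q by (simp add: powr_powr)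
    also have "\<dots> \<le> c powr q" using c q by (intro powr_mono2) auto
    finally have "P * (c powr (1 - q) / q) \<le> c powr q * (c powr (1 - q) / q)"
      using q by (intro mult_right_mono) auto
    also have "\<dots> = c / q" using \<open>c > 0\<close> by (simp flip: powr_add)
    finally have Pc: "P * (c powr (1 - q) / q) \<le> c / q" .
    have "(LINT \<tau>:{0..T}|lborel. N \<tau>) \<le> (LINT \<tau>:{0..T}|lborel. T powr (- \<theta>) * (h \<tau> powr q * (c powr (1 - q) / q) + ((1 - 1 / q) * c) * 1))"
      unfolding set_lebesgue_integral_def
      using \<open>set_integrable lborel {0..T} N\<close> dom[of c] le[OF \<open>c > 0\<close>]
      by (intro integral_mono_AE) (auto simp: set_integrable_def)
    also have "\<dots> = T powr (- \<theta>) * (P * (c powr (1 - q) / q) + ((1 - 1 / q) * c) * T)"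
    proof -
      have "(LINT \<tau>:{0..T}|lborel. 1) = T" using T by (simp add: set_lebesgue_integral_def)
      then show ?thesis
        using hint one unfolding P_def
        by (simp only: set_integral_mult_right set_integral_add(2)[OF set_integrable_mult_left[OF hint] set_integrable_mult_right[OF one]] set_integral_mult_left)
    qed
    also have "\<dots> \<le> T powr (- \<theta>) * (c / q + ((1 - 1 / q) * c) * T)"
      by (intro mult_left_mono add_right_mono Pc) auto
    also have "\<dots> \<le> T powr (- \<theta>) * (c + c * T)"
    proof (intro mult_left_mono add_mono mult_right_mono)
      show "c / q \<le> c" using q \<open>c > 0\<close> by (simp add: field_simps)
      show "(1 - 1 / q) * c \<le> c" using q \<open>c > 0\<close> by (simp add: field_simps)
    qed (use T in auto)
    also have "\<dots> = K * c" by (simp add: K_def algebra_simps)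
    finally show ?thesis .
  qed
  note * = this
  have "(LINT \<tau>:{0..T}|lborel. N \<tau>) \<le> K * P powr (1 / q)"
  proof (rule field_le_epsilon)
    fix e :: real assume "e > 0"
    then have "(LINT \<tau>:{0..T}|lborel. N \<tau>) \<le> K * (P powr (1 / q) + e / K)"
      using K by (intro *) auto
    also have "\<dots> = K * P powr (1 / q) + e" using K by (simp add: field_simps)
    finally show "(LINT \<tau>:{0..T}|lborel. N \<tau>) \<le> K * P powr (1 / q) + e" .
  qed
  then show "(LINT \<tau>:{0..T}|lborel. N \<tau>) \<le> T powr (1 - 2 / p) * (1 + T) *
      (LINT \<tau>:{0..T}|lborel. (\<tau> powr (- (1 - 2 / p)) * N \<tau>) powr (p / (p - 1))) powr (1 / (p / (p - 1)))"
    by (simp add: K_def P_def h_def \<theta>_def q_def)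
qed

text \<open>The representative is \<open>f t = g + \<integral> w\<close> over \<open>{0..t}\<close>,
  the integral being taken pointwise in \<open>x\<close>. Integrability of the L^p norm of
  \<open>w\<close> in time, from \<open>weighted_holder\<close>, gives both the uniform bound and
  continuity in L^p.\<close>

lemma curve_Lp_representation:
  assumes p: "p \<ge> 2" and T: "T > 0"
    and v: "\<And>t. t \<in> {0..T} \<Longrightarrow> v t \<in> tempered" and w: "has_time_deriv T v w"
    and w_Lp: "AE \<tau> in lborel. \<tau> \<in> {0..T} \<longrightarrow> w \<tau> \<in> Lp p"
    and w_int: "set_integrable lborel {0..T} (\<lambda>\<tau>. (\<tau> powr (- (1 - 2 / p)) * Lp_norm p (w \<tau>)) powr (p / (p - 1)))"
    and v0: "v 0 = td_of g" and g: "g \<in> Lp p"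
  obtains f where "\<And>t. t \<in> {0..T} \<Longrightarrow> f t \<in> Lp p" "\<And>t. t \<in> {0..T} \<Longrightarrow> v t = td_of (f t)"
    "\<And>t. t \<in> {0..T} \<Longrightarrow> Lp_norm p (f t) \<le> 2 * (Lp_norm p g + T powr (1 - 2 / p) * (1 + T) *
      (LINT \<tau>:{0..T}|lborel. (\<tau> powr (- (1 - 2 / p)) * Lp_norm p (w \<tau>)) powr (p / (p - 1))) powr (1 / (p / (p - 1))))"
    "\<And>t. t \<in> {0..T} \<Longrightarrow> ((\<lambda>r. Lp_norm p (\<lambda>x. f r x - f t x)) \<longlongrightarrow> 0) (at t within {0..T})"
proof -
  have p1: "p \<ge> 1" using p by simp
  have [measurable]: "(\<lambda>(\<tau>, x). w \<tau> x) \<in> borel_measurable (borel \<Otimes>\<^sub>M borel)"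
    using w by (simp add: has_time_deriv_def lborel_pair_measurable_iff)
  define n where "n = (\<lambda>\<tau>. indicator {0..T} \<tau> * Lp_norm p (w \<tau>))"
  have n_nn: "n \<tau> \<ge> 0" for \<tau> by (simp add: n_def Lp_norm_nonneg)
  have [measurable]: "n \<in> borel_measurable borel" unfolding n_def by measurable
  note wh = weighted_holder[OF p T Lp_norm_measurable[of w p] Lp_norm_nonneg w_int]
  have n_int: "integrable lborel n"
    using wh(1) by (simp add: n_def set_integrable_def)
  define J where "J = (LINT \<tau>|lborel. n \<tau>)"
  have J: "J \<le> T powr (1 - 2 / p) * (1 + T) *
      (LINT \<tau>:{0..T}|lborel. (\<tau> powr (- (1 - 2 / p)) * Lp_norm p (w \<tau>)) powr (p / (p - 1))) powr (1 / (p / (p - 1)))"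
    using wh(2) by (simp add: J_def n_def set_lebesgue_integral_def)
  \<comment> \<open>General enough to cover indicators of \<open>{0..t}\<close> and differences of
    two of them, so the norm bound and the continuity come from the same estimate.\<close>
  define weight where "weight = (\<lambda>k :: real \<Rightarrow> real. k \<in> borel_measurable borel \<and> (\<forall>\<tau>. \<bar>k \<tau>\<bar> \<le> 1) \<and> (\<forall>\<tau>. \<tau> \<notin> {0..T} \<longrightarrow> k \<tau> = 0))"
  define V where "V = (\<lambda>k x. LINT \<tau>|lborel. of_real (k \<tau>) * w \<tau> x)"
  have V: "AE x in lborel. integrable lborel (\<lambda>\<tau>. of_real (k \<tau>) * w \<tau> x)"
      "V k \<in> Lp p" "Lp_norm p (V k) \<le> (LINT \<tau>|lborel. \<bar>k \<tau>\<bar> * n \<tau>)"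
      "\<psi> \<in> schwartz \<Longrightarrow> (LINT x|lborel. V k x * \<psi> x) = (LINT \<tau>|lborel. LINT x|lborel. of_real (k \<tau>) * w \<tau> x * \<psi> x)"
      "\<psi> \<in> schwartz \<Longrightarrow> integrable lborel (\<lambda>\<tau>. LINT x|lborel. of_real (k \<tau>) * w \<tau> x * \<psi> x)"
    if weight: "weight k" for k :: "real \<Rightarrow> real" and \<psi>
  proof -
    have [measurable]: "k \<in> borel_measurable borel" and k: "\<And>\<tau>. \<bar>k \<tau>\<bar> \<le> 1" "\<And>\<tau>. \<tau> \<notin> {0..T} \<Longrightarrow> k \<tau> = 0"
      using weight by (auto simp: weight_def)
    have m: "(\<lambda>(\<tau>, x). of_real (k \<tau>) * w \<tau> x) \<in> borel_measurable (borel \<Otimes>\<^sub>M borel)" by measurable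
    have N: "\<bar>k \<tau>\<bar> * n \<tau> \<ge> 0" for \<tau> using n_nn by simp
    have N': "integrable lborel (\<lambda>\<tau>. \<bar>k \<tau>\<bar> * n \<tau>)"
      by (rule Bochner_Integration.integrable_bound[OF n_int])
        (use k n_nn in \<open>auto simp: abs_mult intro!: mult_left_le_one_le\<close>)
    have "AE \<tau> in lborel. (\<integral>\<^sup>+x. ennreal (norm (of_real (k \<tau>) * w \<tau> x) powr p) \<partial>lborel) \<le> ennreal ((\<bar>k \<tau>\<bar> * n \<tau>) powr p)"
      using w_Lp
    proof eventually_elim
      case (elim \<tau>)
      show ?case
      proof (cases "\<tau> \<in> {0..T}")
        case True
        then have wt: "w \<tau> \<in> Lp p" using elim by simp
        note [measurable] = norm_Lp_power_eq(2)[OF wt p1]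
        have "(\<integral>\<^sup>+x. ennreal (norm (of_real (k \<tau>) * w \<tau> x) powr p) \<partial>lborel) =
            (\<integral>\<^sup>+x. ennreal (\<bar>k \<tau>\<bar> powr p) * ennreal (norm (w \<tau> x) powr p) \<partial>lborel)"
          by (intro nn_integral_cong) (simp add: norm_mult powr_mult flip: ennreal_mult)
        also have "\<dots> = ennreal (\<bar>k \<tau>\<bar> powr p) * ennreal (Lp_norm p (w \<tau>) powr p)"
          by (simp add: nn_integral_cmult norm_Lp_power_eq(1)[OF wt p1])
        also have "\<dots> = ennreal ((\<bar>k \<tau>\<bar> * n \<tau>) powr p)"
          using True by (simp add: n_def powr_mult Lp_norm_nonneg flip: ennreal_mult)
        finally show ?thesis by simp
      qed (simp add: k(2))
    qed
    note avg = Lp_average[OF m N N' p1 this, folded V_def]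
    show "AE x in lborel. integrable lborel (\<lambda>\<tau>. of_real (k \<tau>) * w \<tau> x)" by (rule avg(1))
    show "V k \<in> Lp p" using avg(2) by (simp add: V_def)
    show "Lp_norm p (V k) \<le> (LINT \<tau>|lborel. \<bar>k \<tau>\<bar> * n \<tau>)" using avg(3) by (simp add: V_def)
    show "(LINT x|lborel. V k x * \<psi> x) = (LINT \<tau>|lborel. LINT x|lborel. of_real (k \<tau>) * w \<tau> x * \<psi> x)" if "\<psi> \<in> schwartz"
      using avg(4)[OF that] by (simp add: V_def)
    show "integrable lborel (\<lambda>\<tau>. LINT x|lborel. of_real (k \<tau>) * w \<tau> x * \<psi> x)" if "\<psi> \<in> schwartz"
      using avg(5)[OF that] .
  qed
  have ind: "weight (indicator {0..t})" if "t \<in> {0..T}" for t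
    using that by (auto simp: weight_def indicator_def)
  note W = V[OF ind]
  define f where "f = (\<lambda>t x. g x + V (indicator {0..t}) x)"
  have f_Lp: "f t \<in> Lp p" if "t \<in> {0..T}" for t
    unfolding f_def by (intro Lp_add p1 g W that)
  have f_norm: "Lp_norm p (f t) \<le> 2 * (Lp_norm p g + J)" if "t \<in> {0..T}" for t
  proof -
    have "Lp_norm p (f t) \<le> 2 * (Lp_norm p g + Lp_norm p (V (indicator {0..t})))"
      unfolding f_def by (intro Lp_add(2) p1 g W that)
    also have "Lp_norm p (V (indicator {0..t})) \<le> (LINT \<tau>|lborel. \<bar>indicator {0..t} \<tau>\<bar> * n \<tau>)"
      by (intro W(3) that)
    also have "\<dots> \<le> J" unfolding J_def
      using n_int n_nn by (intro integral_mono') (auto simp: indicator_def)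
    finally show ?thesis by simp
  qed
  have f_rep: "v t = td_of (f t)" if t: "t \<in> {0..T}" for t
  proof
    fix \<psi>
    show "v t \<psi> = td_of (f t) \<psi>"
    proof (cases "\<psi> \<in> schwartz")
      case True
      define \<alpha> where "\<alpha> = (\<lambda>\<tau>. td_of (w \<tau>) \<psi>)"
      have eq: "(LINT x|lborel. of_real (k \<tau>) * w \<tau> x * \<psi> x) = k \<tau> *\<^sub>R \<alpha> \<tau>" for k :: "real \<Rightarrow> real" and \<tau>
        using True by (simp add: \<alpha>_def td_of_def mult.assoc scaleR_conv_of_real)
      have \<alpha>_int: "set_integrable lborel {0..t} \<alpha>"
        using W(5)[OF t True] unfolding set_integrable_def eq .
      have pair: "(LINT x|lborel. V (indicator {0..t}) x * \<psi> x) = (LINT \<tau>:{0..t}|lborel. \<alpha> \<tau>)"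
        using W(4)[OF t True] unfolding set_lebesgue_integral_def eq .
      have "v t \<psi> - v 0 \<psi> = (LINT \<tau>:{0..t}|lborel. \<alpha> \<tau>)"
      proof (cases "t = 0")
        case True
        have "AE \<tau> in lborel. indicator {0..t} \<tau> *\<^sub>R \<alpha> \<tau> = 0"
          using AE_lborel_singleton[of 0] by eventually_elim (use True in \<open>auto simp: indicator_def\<close>)
        then have "(LINT \<tau>:{0..t}|lborel. \<alpha> \<tau>) = 0"
          unfolding set_lebesgue_integral_def by (rule integral_eq_zero_AE)
        then show ?thesis using True by simp
      next
        case False
        then have t0: "t > 0" using t by simp
        \<comment> \<open>The increment formula is given only from positive times on. Time 0 is
          reached along \<open>a m\<close> by continuity of the tested curve on the left and by
          integrability up to 0 on the right.\<close>
        define a where "a = (\<lambda>m. t * inverse (real (Suc m)))"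
        have a: "0 < a m" "a m \<le> t" for m
          using t0 by (simp_all add: a_def field_simps)
        have a_lim: "a \<longlonglongrightarrow> 0"
          unfolding a_def using tendsto_mult_right_zero[OF LIMSEQ_inverse_real_of_nat, of t] by simp
        have UN: "(\<Union>m. {a m..t}) = {0<..t}"
        proof -
          have "\<exists>m. a m \<le> x" if "0 < x" for x
          proof -
            have "\<forall>\<^sub>F m in sequentially. a m < x" using order_tendstoD(2)[OF a_lim that] .
            then obtain m where "a m < x" by (auto dest: eventually_happens)
            then show ?thesis by (auto intro: less_imp_le)
          qed
          then show ?thesis by (auto dest: less_le_trans[OF a(1)])
        qed
        have a_mono: "a j \<le> a i" if "i \<le> j" for i j
          using t0 that unfolding a_def by (intro mult_left_mono le_imp_inverse_le) auto
        have dec: "incseq (\<lambda>m. {a m..t})"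
          by (auto simp: incseq_def intro: order_trans[OF a_mono])
        have a_in: "a m \<in> {0..T}" for m using a[of m] t by auto
        have "set_integrable lborel {0<..t} \<alpha>"
          by (rule set_integrable_subset[OF \<alpha>_int]) auto
        then have lim1: "(\<lambda>m. LINT \<tau>:{a m..t}|lborel. \<alpha> \<tau>) \<longlonglongrightarrow> (LINT \<tau>:{0<..t}|lborel. \<alpha> \<tau>)"
          using set_integral_cont_up[of "\<lambda>m. {a m..t}" lborel \<alpha>] dec UN by simp
        have "continuous_on {0..T} (\<lambda>t. v t \<psi>)" using w True by (simp add: has_time_deriv_def)
        then have "(\<lambda>m. v (a m) \<psi>) \<longlonglongrightarrow> v 0 \<psi>"
          using a_lim by (rule continuous_on_tendsto_compose) (use T a_in in auto)
        then have "(\<lambda>m. v t \<psi> - v (a m) \<psi>) \<longlonglongrightarrow> v t \<psi> - v 0 \<psi>" by (intro tendsto_intros)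
        moreover have "v t \<psi> - v (a m) \<psi> = (LINT \<tau>:{a m..t}|lborel. \<alpha> \<tau>)" for m
          using w True a[of m] t unfolding has_time_deriv_def \<alpha>_def by auto
        ultimately have "v t \<psi> - v 0 \<psi> = (LINT \<tau>:{0<..t}|lborel. \<alpha> \<tau>)"
          using lim1 LIMSEQ_unique by auto
        also have "\<dots> = (LINT \<tau>:{0..t}|lborel. \<alpha> \<tau>)"
          unfolding set_lebesgue_integral_def
        proof (rule Bochner_Integration.integral_cong_AE)
          have "set_borel_measurable lborel {0..t} \<alpha>" "set_borel_measurable lborel {0<..t} \<alpha>"
            using \<alpha>_int \<open>set_integrable lborel {0<..t} \<alpha>\<close> by (auto simp: set_integrable_def set_borel_measurable_def)
          then show "(\<lambda>\<tau>. indicat_real {0<..t} \<tau> *\<^sub>R \<alpha> \<tau>) \<in> borel_measurable lborel" "(\<lambda>\<tau>. indicat_real {0..t} \<tau> *\<^sub>R \<alpha> \<tau>) \<in> borel_measurable lborel"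
            by (simp_all add: set_borel_measurable_def)
          show "AE \<tau> in lborel. indicat_real {0<..t} \<tau> *\<^sub>R \<alpha> \<tau> = indicat_real {0..t} \<tau> *\<^sub>R \<alpha> \<tau>"
            using AE_lborel_singleton[of 0] by eventually_elim (auto simp: indicator_def)
        qed
        finally show ?thesis .
      qed
      then have "v t \<psi> = (LINT x|lborel. g x * \<psi> x) + (LINT x|lborel. V (indicator {0..t}) x * \<psi> x)"
      proof -
        have "v 0 \<psi> = (LINT x|lborel. g x * \<psi> x)" using True by (simp add: v0 td_of_def)
        then show ?thesis
          using \<open>v t \<psi> - v 0 \<psi> = (LINT \<tau>:{0..t}|lborel. \<alpha> \<tau>)\<close> unfolding pair by (simp only: diff_eq_eq add.commute)
      qed
      also have "\<dots> = (LINT x|lborel. f t x * \<psi> x)"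
        using Lp_tempered_fun[OF g p1] Lp_tempered_fun[OF W(2)[OF t] p1] True
        unfolding f_def tempered_fun_def by (simp add: distrib_right)
      finally show ?thesis using True by (simp add: td_of_def)
    next
      case False
      then show ?thesis using v[OF t] by (simp add: tempered_def td_of_def)
    qed
  qed
  have f_cont: "((\<lambda>r. Lp_norm p (\<lambda>x. f r x - f t x)) \<longlongrightarrow> 0) (at t within {0..T})" if t: "t \<in> {0..T}" for t
    unfolding tendsto_at_iff_sequentially comp_def
  proof (intro allI impI)
    fix X :: "nat \<Rightarrow> real"
    assume X: "\<forall>i. X i \<in> {0..T} - {t}" "X \<longlonglongrightarrow> t"
    \<comment> \<open>A signed indicator of the times between \<open>t\<close> and
      \<open>X m\<close>; it tends to 0 except possibly at \<open>t\<close> itself.\<close>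
    define k where "k = (\<lambda>m \<tau>. (indicator {0..X m} \<tau> - indicator {0..t} \<tau>) :: real)"
    have k: "k m \<in> borel_measurable borel" "\<bar>k m \<tau>\<bar> \<le> 1" "\<tau> \<notin> {0..T} \<Longrightarrow> k m \<tau> = 0" for m \<tau>
      using X(1)[rule_format, of m] t by (auto simp: k_def indicator_def)
    then have wk: "weight (k m)" for m by (auto simp: weight_def)
    note [measurable] = k(1)
    have le: "Lp_norm p (\<lambda>x. f (X m) x - f t x) \<le> (LINT \<tau>|lborel. \<bar>k m \<tau>\<bar> * n \<tau>)" for m
    proof -
      have Xm: "X m \<in> {0..T}" using X(1) by auto
      have "AE x in lborel. f (X m) x - f t x = V (k m) x"
        using W(1)[OF Xm] W(1)[OF t]
      proof eventually_elim
        case (elim x)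
        have "V (k m) x = (LINT \<tau>|lborel. of_real (indicator {0..X m} \<tau>) * w \<tau> x - of_real (indicator {0..t} \<tau>) * w \<tau> x)"
          by (simp add: V_def k_def left_diff_distrib)
        also have "\<dots> = V (indicator {0..X m}) x - V (indicator {0..t}) x"
          unfolding V_def using elim by (rule Bochner_Integration.integral_diff)
        finally show ?case by (simp add: f_def)
      qed
      then have "Lp_norm p (\<lambda>x. f (X m) x - f t x) = Lp_norm p (V (k m))"
        using norm_Lp_power_eq(2)[OF Lp_diff[OF p1 f_Lp[OF Xm] f_Lp[OF t]] p1] norm_Lp_power_eq(2)[OF V(2)[OF wk] p1]
        by (intro Lp_norm_cong_AE)
      also have "\<dots> \<le> (LINT \<tau>|lborel. \<bar>k m \<tau>\<bar> * n \<tau>)" by (rule V(3)[OF wk])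
      finally show ?thesis .
    qed
    have "(\<lambda>m. LINT \<tau>|lborel. \<bar>k m \<tau>\<bar> * n \<tau>) \<longlonglongrightarrow> (LINT \<tau>::real|lborel. 0::real)"
    proof (rule integral_dominated_convergence[OF _ _ n_int])
      show "AE \<tau> in lborel. norm (\<bar>k m \<tau>\<bar> * n \<tau>) \<le> n \<tau>" for m
        using k(2) n_nn by (intro AE_I2) (simp add: abs_mult mult_left_le_one_le)
      show "AE \<tau> in lborel. (\<lambda>m. \<bar>k m \<tau>\<bar> * n \<tau>) \<longlonglongrightarrow> 0"
        using AE_lborel_singleton[of t]
      proof eventually_elim
        case (elim \<tau>)
        have "\<forall>\<^sub>F m in sequentially. k m \<tau> = 0"
        proof (cases "\<tau> < t")
          case True
          show ?thesis using order_tendstoD(1)[OF X(2) True]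
            by eventually_elim (use True in \<open>auto simp: k_def indicator_def\<close>)
        next
          case False
          then have "t < \<tau>" using elim by simp
          from order_tendstoD(2)[OF X(2) this] show ?thesis
            by eventually_elim (use \<open>t < \<tau>\<close> in \<open>auto simp: k_def indicator_def\<close>)
        qed
        then show ?case by (intro tendsto_eventually) (auto elim: eventually_mono)
      qed
    qed simp_all
    then have "(\<lambda>m. LINT \<tau>|lborel. \<bar>k m \<tau>\<bar> * n \<tau>) \<longlonglongrightarrow> 0" by simp
    then show "(\<lambda>m. Lp_norm p (\<lambda>x. f (X m) x - f t x)) \<longlonglongrightarrow> 0"
      by (rule tendsto_sandwich[rotated 2, OF tendsto_const]) (use le Lp_norm_nonneg in auto)
  qed
  show thesis
  proof (rule that[OF f_Lp f_rep _ f_cont])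
    show "Lp_norm p (f t) \<le> 2 * (Lp_norm p g + T powr (1 - 2 / p) * (1 + T) *
      (LINT \<tau>:{0..T}|lborel. (\<tau> powr (- (1 - 2 / p)) * Lp_norm p (w \<tau>)) powr (p / (p - 1))) powr (1 / (p / (p - 1))))"
      if "t \<in> {0..T}" for t
      by (rule order_trans[OF f_norm[OF that]]) (intro mult_left_mono add_left_mono J, simp)
  qed
qed

section \<open>Differences of distributions and of curves\<close>

lemma schrodinger_diff: "schrodinger t (F - G) = schrodinger t F - schrodinger t G"
  by (simp add: schrodinger_def td_multiplier_diff)

lemma bessel_diff: "bessel s (F - G) = bessel s F - bessel s G"
  by (simp add: bessel_def td_multiplier_diff)

lemma has_time_deriv_diff:
  assumes w: "has_time_deriv T v w" and w': "has_time_deriv T v' w'"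
  shows "has_time_deriv T (\<lambda>t. v t - v' t) (\<lambda>\<tau> x. w \<tau> x - w' \<tau> x)"
  unfolding has_time_deriv_def
proof (intro conjI ballI allI impI)
  have m [measurable]: "(\<lambda>(\<tau>, x). w \<tau> x) \<in> borel_measurable (borel \<Otimes>\<^sub>M borel)"
    "(\<lambda>(\<tau>, x). w' \<tau> x) \<in> borel_measurable (borel \<Otimes>\<^sub>M borel)"
    using w w' by (simp_all add: has_time_deriv_def lborel_pair_measurable_iff)
  have tf: "AE \<tau> in lborel. \<tau> \<in> {0..T} \<longrightarrow> tempered_fun (w \<tau>) \<and> tempered_fun (w' \<tau>)"
    using w w' by (auto simp: has_time_deriv_def)
  show "(\<lambda>(\<tau>, x). w \<tau> x - w' \<tau> x) \<in> borel_measurable (lborel \<Otimes>\<^sub>M lborel)" by measurable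
  show "AE \<tau> in lborel. \<tau> \<in> {0..T} \<longrightarrow> tempered_fun (\<lambda>x. w \<tau> x - w' \<tau> x)"
    using tf by eventually_elim (auto intro: tempered_fun_diff)
  fix \<psi> assume \<psi>: "\<psi> \<in> schwartz"
  note [measurable] = schwartz_borel[OF \<psi>]
  show "continuous_on {0..T} (\<lambda>t. (v t - v' t) \<psi>)"
    using w w' \<psi> unfolding has_time_deriv_def by (auto intro: continuous_on_diff)
  fix a b assume ab: "0 < a \<and> a \<le> b \<and> b \<le> T"
  have i: "set_integrable lborel {a..b} (\<lambda>\<tau>. td_of (w \<tau>) \<psi>)" "set_integrable lborel {a..b} (\<lambda>\<tau>. td_of (w' \<tau>) \<psi>)"
    and e: "v b \<psi> - v a \<psi> = (LINT \<tau>:{a..b}|lborel. td_of (w \<tau>) \<psi>)" "v' b \<psi> - v' a \<psi> = (LINT \<tau>:{a..b}|lborel. td_of (w' \<tau>) \<psi>)"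
    using w w' \<psi> ab unfolding has_time_deriv_def by blast+
  have [measurable]: "(\<lambda>\<tau>. td_of (\<lambda>x. w \<tau> x - w' \<tau> x) \<psi>) \<in> borel_measurable borel"
    "(\<lambda>\<tau>. td_of (w \<tau>) \<psi>) \<in> borel_measurable borel" "(\<lambda>\<tau>. td_of (w' \<tau>) \<psi>) \<in> borel_measurable borel"
    using \<psi> by (simp_all add: td_of_def) measurable
  have eq: "AE \<tau> in lborel. indicat_real {a..b} \<tau> *\<^sub>R td_of (\<lambda>x. w \<tau> x - w' \<tau> x) \<psi> = indicat_real {a..b} \<tau> *\<^sub>R (td_of (w \<tau>) \<psi> - td_of (w' \<tau>) \<psi>)"
    using tf by eventually_elim (use ab td_of_diff in \<open>auto simp: indicator_def\<close>)
  show "set_integrable lborel {a..b} (\<lambda>\<tau>. td_of (\<lambda>x. w \<tau> x - w' \<tau> x) \<psi>)"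
    using set_integral_diff(1)[OF i] unfolding set_integrable_def
  proof (rule integrable_cong_AE_imp)
    show "AE \<tau> in lborel. indicat_real {a..b} \<tau> *\<^sub>R (td_of (w \<tau>) \<psi> - td_of (w' \<tau>) \<psi>) = indicat_real {a..b} \<tau> *\<^sub>R td_of (\<lambda>x. w \<tau> x - w' \<tau> x) \<psi>"
      using eq by eventually_elim (rule sym)
  qed measurable
  have "(LINT \<tau>:{a..b}|lborel. td_of (\<lambda>x. w \<tau> x - w' \<tau> x) \<psi>) = (LINT \<tau>:{a..b}|lborel. td_of (w \<tau>) \<psi> - td_of (w' \<tau>) \<psi>)"
    unfolding set_lebesgue_integral_def by (rule integral_cong_AE) (measurable, rule eq)
  also have "\<dots> = (LINT \<tau>:{a..b}|lborel. td_of (w \<tau>) \<psi>) - (LINT \<tau>:{a..b}|lborel. td_of (w' \<tau>) \<psi>)"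
    by (rule set_integral_diff(2)[OF i])
  finally show "(v b - v' b) \<psi> - (v a - v' a) \<psi> = (LINT \<tau>:{a..b}|lborel. td_of (\<lambda>x. w \<tau> x - w' \<tau> x) \<psi>)"
    using e by (simp add: algebra_simps)
qed

text \<open>The seminorms are non-negative, so both continuity bounds may be raised to the common
  order \<open>max N N'\<close>.\<close>

lemma tempered_diff:
  assumes "F \<in> tempered" "G \<in> tempered"
  shows "F - G \<in> tempered"
proof -
  let ?S = "\<lambda>N \<psi>. \<Sum>k\<le>N. \<Sum>n\<le>N. schwartz_seminorm k n \<psi>"
  obtain C N where F: "\<And>\<psi>. \<psi> \<in> schwartz \<Longrightarrow> norm (F \<psi>) \<le> C * ?S N \<psi>"
    using assms(1) unfolding tempered_def by blast
  obtain C' N' where G: "\<And>\<psi>. \<psi> \<in> schwartz \<Longrightarrow> norm (G \<psi>) \<le> C' * ?S N' \<psi>"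
    using assms(2) unfolding tempered_def by blast
  have nn: "schwartz_seminorm k n \<psi> \<ge> 0" if "\<psi> \<in> schwartz" for k n \<psi>
  proof -
    have "bounded (range (\<lambda>x. \<bar>x\<bar> ^ k * norm (nth_deriv n \<psi> x)))" using that by (auto simp: schwartz_def)
    then have "bdd_above (range (\<lambda>x. \<bar>x\<bar> ^ k * norm (nth_deriv n \<psi> x)))" by (rule bounded_imp_bdd_above)
    then have "\<bar>0\<bar> ^ k * norm (nth_deriv n \<psi> 0) \<le> schwartz_seminorm k n \<psi>"
      unfolding schwartz_seminorm_def by (rule cSUP_upper[OF UNIV_I])
    then show ?thesis by (rule order_trans[rotated]) simp
  qed
  have mono: "?S N \<psi> \<le> ?S (max N N') \<psi>" "?S N' \<psi> \<le> ?S (max N N') \<psi>" if "\<psi> \<in> schwartz" for \<psi>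
    using nn[OF that]
    by (auto intro!: order_trans[OF sum_mono sum_mono2] sum_mono2 sum_nonneg)
  have "norm ((F - G) \<psi>) \<le> (\<bar>C\<bar> + \<bar>C'\<bar>) * ?S (max N N') \<psi>" if \<psi>: "\<psi> \<in> schwartz" for \<psi>
  proof -
    have pos: "?S N \<psi> \<ge> 0" "?S N' \<psi> \<ge> 0" using nn[OF \<psi>] by (auto intro!: sum_nonneg)
    have "norm ((F - G) \<psi>) \<le> norm (F \<psi>) + norm (G \<psi>)" by (simp add: norm_triangle_ineq4)
    also have "norm (F \<psi>) \<le> \<bar>C\<bar> * ?S (max N N') \<psi>"
      by (rule order_trans[OF F[OF \<psi>]]) (use mono[OF \<psi>] pos in \<open>auto intro!: mult_mono\<close>)
    also have "norm (G \<psi>) \<le> \<bar>C'\<bar> * ?S (max N N') \<psi>"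
      by (rule order_trans[OF G[OF \<psi>]]) (use mono[OF \<psi>] pos in \<open>auto intro!: mult_mono\<close>)
    finally show ?thesis by (simp add: distrib_right)
  qed
  then show ?thesis
    using assms unfolding tempered_def by (auto simp: algebra_simps intro!: exI[of _ "\<bar>C\<bar> + \<bar>C'\<bar>"] exI[of _ "max N N'"])
qed

lemma Lp_norm_cong_AE2:
  fixes w w' :: "real \<Rightarrow> real \<Rightarrow> complex"
  assumes [measurable]: "(\<lambda>(\<tau>, x). w \<tau> x) \<in> borel_measurable (borel \<Otimes>\<^sub>M borel)" "(\<lambda>(\<tau>, x). w' \<tau> x) \<in> borel_measurable (borel \<Otimes>\<^sub>M borel)"
    and "AE x in lborel. w \<tau> x = w' \<tau> x"
  shows "Lp_norm p (w \<tau>) = Lp_norm p (w' \<tau>)"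
proof (rule Lp_norm_cong_AE[OF _ _ assms(3)])
  show "w \<tau> \<in> borel_measurable borel" "w' \<tau> \<in> borel_measurable borel" by measurable
qed

lemma Xspace_representation:
  assumes p: "p \<ge> 2" and T: "T > 0" and v: "v \<in> Xspace p (p / (p - 1)) (- (1 - 2 / p)) T"
  obtains f where "\<And>t. t \<in> {0..T} \<Longrightarrow> f t \<in> Lp p" "\<And>t. t \<in> {0..T} \<Longrightarrow> v t = td_of (f t)"
    "\<And>t. t \<in> {0..T} \<Longrightarrow> ((\<lambda>r. Lp_norm p (\<lambda>x. f r x - f t x)) \<longlongrightarrow> 0) (at t within {0..T})"
proof -
  obtain w where w: "has_time_deriv T v w" "AE \<tau> in lborel. \<tau> \<in> {0..T} \<longrightarrow> w \<tau> \<in> Lp p"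
    "set_integrable lborel {0..T} (\<lambda>\<tau>. (\<tau> powr (- (1 - 2 / p)) * Lp_norm p (w \<tau>)) powr (p / (p - 1)))"
    using v by (auto simp: Xspace_def Xtilde_def)
  obtain g where g: "v 0 = td_of g" "g \<in> Lp p" using v by (auto simp: Xspace_def td_Lp_def)
  have "v t \<in> tempered" if "t \<in> {0..T}" for t using v that by (auto simp: Xspace_def Xtilde_def curves_def)
  from curve_Lp_representation[OF p T this w g] show thesis using that by metis
qed

text \<open>The norm of \<open>d\<close> refers to the derivative that \<open>SOME\<close> selects,
  about which only \<open>has_time_deriv\<close> is known. The difference of the derivatives of
  \<open>v\<close> and \<open>v'\<close> is another one, with known integrability; uniqueness
  transfers the value of the norm to it.\<close>

lemma Xspace_diff_representation:
  assumes p: "p \<ge> 2" and T: "T > 0"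
    and v: "v \<in> Xspace p (p / (p - 1)) (- (1 - 2 / p)) T" and v': "v' \<in> Xspace p (p / (p - 1)) (- (1 - 2 / p)) T"
    and d: "d = (\<lambda>t. v t - v' t)"
  obtains f where "\<And>t. t \<in> {0..T} \<Longrightarrow> f t \<in> Lp p" "\<And>t. t \<in> {0..T} \<Longrightarrow> d t = td_of (f t)"
    "\<And>t. t \<in> {0..T} \<Longrightarrow> Lp_norm p (f t) \<le> 2 * (1 + T powr (1 - 2 / p) * (1 + T)) * Xnorm p (p / (p - 1)) (- (1 - 2 / p)) T d"
proof -
  have p1: "p \<ge> 1" using p by simp
  define \<theta> where "\<theta> = - (1 - 2 / p)"
  define q where "q = p / (p - 1)"
  obtain w where w: "has_time_deriv T v w" "AE \<tau> in lborel. \<tau> \<in> {0..T} \<longrightarrow> w \<tau> \<in> Lp p"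
    "set_integrable lborel {0..T} (\<lambda>\<tau>. (\<tau> powr \<theta> * Lp_norm p (w \<tau>)) powr q)"
    using v by (auto simp: Xspace_def Xtilde_def \<theta>_def q_def)
  obtain w' where w': "has_time_deriv T v' w'" "AE \<tau> in lborel. \<tau> \<in> {0..T} \<longrightarrow> w' \<tau> \<in> Lp p"
    "set_integrable lborel {0..T} (\<lambda>\<tau>. (\<tau> powr \<theta> * Lp_norm p (w' \<tau>)) powr q)"
    using v' by (auto simp: Xspace_def Xtilde_def \<theta>_def q_def)
  obtain g where g: "v 0 = td_of g" "g \<in> Lp p" using v by (auto simp: Xspace_def td_Lp_def)
  obtain g' where g': "v' 0 = td_of g'" "g' \<in> Lp p" using v' by (auto simp: Xspace_def td_Lp_def)
  define \<omega> where "\<omega> = (\<lambda>\<tau> x. w \<tau> x - w' \<tau> x)"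
  have \<omega>: "has_time_deriv T d \<omega>" unfolding d \<omega>_def by (rule has_time_deriv_diff[OF w(1) w'(1)])
  define \<omega>' where "\<omega>' = time_deriv T d"
  have \<omega>': "has_time_deriv T d \<omega>'" unfolding \<omega>'_def time_deriv_def by (rule someI[of _ \<omega>]) (rule \<omega>)
  have [measurable]: "(\<lambda>(\<tau>, x). w \<tau> x) \<in> borel_measurable (borel \<Otimes>\<^sub>M borel)"
    "(\<lambda>(\<tau>, x). w' \<tau> x) \<in> borel_measurable (borel \<Otimes>\<^sub>M borel)"
    "(\<lambda>(\<tau>, x). \<omega> \<tau> x) \<in> borel_measurable (borel \<Otimes>\<^sub>M borel)"
    "(\<lambda>(\<tau>, x). \<omega>' \<tau> x) \<in> borel_measurable (borel \<Otimes>\<^sub>M borel)"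
    using w(1) w'(1) \<omega> \<omega>' by (simp_all add: has_time_deriv_def lborel_pair_measurable_iff)
  have \<omega>_Lp: "AE \<tau> in lborel. \<tau> \<in> {0..T} \<longrightarrow> \<omega> \<tau> \<in> Lp p"
    using w(2) w'(2) by eventually_elim (auto simp: \<omega>_def intro: Lp_diff[OF p1])
  have \<omega>_int: "set_integrable lborel {0..T} (\<lambda>\<tau>. (\<tau> powr \<theta> * Lp_norm p (\<omega> \<tau>)) powr q)"
    unfolding set_integrable_def
  proof (rule Bochner_Integration.integrable_bound)
    let ?h = "\<lambda>w \<tau>. (\<tau> powr \<theta> * Lp_norm p (w \<tau>)) powr q"
    \<comment> \<open>The 4 is the factor 2 of \<open>Lp_add\<close> times the 2 in
      \<open>a + b \<le> 2 * max a b\<close>.\<close>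
    show "integrable lborel (\<lambda>\<tau>. 4 powr q * (indicat_real {0..T} \<tau> *\<^sub>R ?h w \<tau> + indicat_real {0..T} \<tau> *\<^sub>R ?h w' \<tau>))"
      using w(3) w'(3) unfolding set_integrable_def by (intro integrable_mult_right Bochner_Integration.integrable_add)
    show "(\<lambda>\<tau>. indicat_real {0..T} \<tau> *\<^sub>R ?h \<omega> \<tau>) \<in> borel_measurable lborel" by measurable
    show "AE \<tau> in lborel. norm (indicat_real {0..T} \<tau> *\<^sub>R ?h \<omega> \<tau>) \<le> norm (4 powr q * (indicat_real {0..T} \<tau> *\<^sub>R ?h w \<tau> + indicat_real {0..T} \<tau> *\<^sub>R ?h w' \<tau>))"
      using w(2) w'(2)
    proof eventually_elim
      case (elim \<tau>)
      show ?case
      proof (cases "\<tau> \<in> {0..T}")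
        case True
        have q: "q \<ge> 0" using p by (simp add: q_def)
        let ?a = "\<tau> powr \<theta> * Lp_norm p (w \<tau>)" and ?b = "\<tau> powr \<theta> * Lp_norm p (w' \<tau>)"
        have ab: "?a \<ge> 0" "?b \<ge> 0" using Lp_norm_nonneg by auto
        have "Lp_norm p (\<omega> \<tau>) \<le> 2 * (Lp_norm p (w \<tau>) + Lp_norm p (w' \<tau>))"
          using Lp_add(2)[OF p1, of "w \<tau>" "\<lambda>x. - w' \<tau> x"] Lp_uminus(1)[of "w' \<tau>" p] Lp_uminus(2)[of p "w' \<tau>"] elim True by (simp add: \<omega>_def)
        then have "\<tau> powr \<theta> * Lp_norm p (\<omega> \<tau>) \<le> \<tau> powr \<theta> * (2 * (Lp_norm p (w \<tau>) + Lp_norm p (w' \<tau>)))"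
          by (intro mult_left_mono) auto
        also have "\<dots> \<le> 4 * max ?a ?b" by (simp add: algebra_simps max_def)
        finally have "?h \<omega> \<tau> \<le> (4 * max ?a ?b) powr q"
          using q Lp_norm_nonneg by (intro powr_mono2) auto
        also have "\<dots> = 4 powr q * max ?a ?b powr q" by (rule powr_mult)
        also have "\<dots> \<le> 4 powr q * (?h w \<tau> + ?h w' \<tau>)" by (intro mult_left_mono) (auto simp: max_def)
        finally show ?thesis using True by simp
      qed simp
    qed
  qed
  have d0: "d 0 = td_of (\<lambda>x. g x - g' x)"
    using td_of_diff[OF Lp_tempered_fun[OF g(2) p1] Lp_tempered_fun[OF g'(2) p1]] by (simp add: fun_eq_iff d g(1) g'(1))
  have G: "(\<lambda>x. g x - g' x) \<in> Lp p" by (rule Lp_diff[OF p1 g(2) g'(2)])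
  have temp: "d t \<in> tempered" if "t \<in> {0..T}" for t
    using v v' that unfolding d by (intro tempered_diff) (auto simp: Xspace_def Xtilde_def curves_def)
  define P where "P = (LINT \<tau>:{0..T}|lborel. (\<tau> powr \<theta> * Lp_norm p (\<omega> \<tau>)) powr q)"
  have "P = (LINT \<tau>:{0..T}|lborel. (\<tau> powr \<theta> * Lp_norm p (\<omega>' \<tau>)) powr q)"
    unfolding P_def set_lebesgue_integral_def
  proof (rule integral_cong_AE)
    show "AE \<tau> in lborel. indicat_real {0..T} \<tau> *\<^sub>R (\<tau> powr \<theta> * Lp_norm p (\<omega> \<tau>)) powr q = indicat_real {0..T} \<tau> *\<^sub>R (\<tau> powr \<theta> * Lp_norm p (\<omega>' \<tau>)) powr q"
      using time_deriv_unique[OF \<omega> \<omega>']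
    proof eventually_elim
      case (elim \<tau>)
      show ?case
      proof (cases "\<tau> \<in> {0..T}")
        case True
        then have "Lp_norm p (\<omega> \<tau>) = Lp_norm p (\<omega>' \<tau>)" using elim by (intro Lp_norm_cong_AE2) auto
        then show ?thesis by simp
      qed simp
    qed
  qed measurable
  then have tilde: "Xtilde_norm p q \<theta> T d = P powr (1 / q)"
    by (simp add: Xtilde_norm_def \<omega>'_def)
  have X: "Xnorm p q \<theta> T d = Lp_norm p (\<lambda>x. g x - g' x) + P powr (1 / q)"
    by (simp add: Xnorm_def tilde d0 td_Lp_norm_td_of[OF G p1])
  obtain f where f: "\<And>t. t \<in> {0..T} \<Longrightarrow> f t \<in> Lp p" "\<And>t. t \<in> {0..T} \<Longrightarrow> d t = td_of (f t)"
    "\<And>t. t \<in> {0..T} \<Longrightarrow> Lp_norm p (f t) \<le> 2 * (Lp_norm p (\<lambda>x. g x - g' x) + T powr (1 - 2 / p) * (1 + T) * P powr (1 / q))"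
  proof -
    note rep = curve_Lp_representation[OF p T temp \<omega> \<omega>_Lp \<omega>_int[unfolded \<theta>_def q_def] d0 G]
    show thesis
    proof (rule rep, assumption, goal_cases)
      case (1 f)
      note f_le = 1(3)
      have "Lp_norm p (f t) \<le> 2 * (Lp_norm p (\<lambda>x. g x - g' x) + T powr (1 - 2 / p) * (1 + T) * P powr (1 / q))"
        if "t \<in> {0..T}" for t
        using f_le[OF that] unfolding P_def \<theta>_def q_def .
      then show thesis using 1(1,2) by (intro that) blast+
    qed
  qed
  show thesis
  proof (rule that[OF f(1,2)])
    fix t assume t: "t \<in> {0..T}"
    let ?K = "T powr (1 - 2 / p) * (1 + T)" and ?a = "Lp_norm p (\<lambda>x. g x - g' x)" and ?b = "P powr (1 / q)"
    have "0 \<le> ?K * ?a" using T Lp_norm_nonneg by simp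
    moreover have "0 \<le> ?b" by simp
    moreover have "(1 + ?K) * (?a + ?b) = ?a + ?b + (?K * ?a + ?K * ?b)" by (simp only: distrib_left distrib_right mult_1)
    ultimately have le: "?a + ?K * ?b \<le> (1 + ?K) * (?a + ?b)" by linarith
    have "Lp_norm p (f t) \<le> 2 * ((1 + ?K) * (?a + ?b))"
      by (rule order_trans[OF f(3)[OF t]]) (intro mult_left_mono le, simp)
    then show "Lp_norm p (f t) \<le> 2 * (1 + T powr (1 - 2 / p) * (1 + T)) * Xnorm p (p / (p - 1)) (- (1 - 2 / p)) T d"
      unfolding X[unfolded \<theta>_def q_def] by (simp only: mult.assoc q_def)
  qed
qed

text \<open>Splits the motion in two:
  \<open>U(r) f - U(t) g = U(r) (f - g) + (U(r) - U(t)) g\<close>. Linearity of the flow in its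
  argument is obtained after pairing with a test function, where it is linearity of an absolutely
  convergent integral.\<close>

lemma bessel_difference:
  assumes p: "p \<ge> 2" and s: "s < - (1 - 2 / p)" and f: "f \<in> Lp p" "schrodinger (- r) F = td_of f"
    and g: "g \<in> Lp p" "schrodinger (- t) G = td_of g"
  shows "bessel s (F - G) = td_of (\<lambda>x. bessel_flow (- s / 2) r (\<lambda>x. f x - g x) x +
    (bessel_flow (- s / 2) r g x - bessel_flow (- s / 2) t g x))"
proof
  fix \<psi>
  define \<sigma> where "\<sigma> = - s / 2"
  have p1: "p \<ge> 1" using p by simp
  have \<sigma>: "\<sigma> > (1 - 2 / p) / 2" using s by (simp add: \<sigma>_def)
  have fg: "(\<lambda>x. f x - g x) \<in> Lp p" by (rule Lp_diff[OF p1 f(1) g(1)])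
  have flow: "bessel_flow \<sigma> t h \<in> Lp p" if "h \<in> Lp p" for t h
  proof -
    obtain C where "\<And>t' f. \<bar>t'\<bar> \<le> \<bar>t\<bar> \<Longrightarrow> f \<in> Lp p \<Longrightarrow> bessel_flow \<sigma> t' f \<in> Lp p \<and> Lp_norm p (bessel_flow \<sigma> t' f) \<le> C * Lp_norm p f"
      using bessel_flow_bounded[OF p \<sigma>, of "\<bar>t\<bar>"] by blast
    then show ?thesis using that by blast
  qed
  show "bessel s (F - G) \<psi> = td_of (\<lambda>x. bessel_flow (- s / 2) r (\<lambda>x. f x - g x) x +
    (bessel_flow (- s / 2) r g x - bessel_flow (- s / 2) t g x)) \<psi>"
  proof (cases "\<psi> \<in> schwartz")
    case True
    have int: "integrable lborel (\<lambda>x. h x * \<eta> x)" if "h \<in> Lp p" "\<eta> \<in> schwartz" for h \<eta>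
      using Lp_tempered_fun[OF that(1) p1] that(2) by (simp add: tempered_fun_def)
    define \<eta> where "\<eta> = fourier (\<lambda>\<xi>. cis (- (r * \<xi>\<^sup>2)) * of_real ((1 + \<xi>\<^sup>2) powr (- \<sigma>)) * fourier_inv \<psi> \<xi>)"
    have "(\<lambda>\<xi>. cis (- r * \<xi>\<^sup>2) * of_real ((1 + \<xi>\<^sup>2) powr (- \<sigma>)) * fourier_inv \<psi> \<xi>) \<in> schwartz"
      by (intro schwartz_slow_mult slow_mult slow_chirp slow_bracket fourier_inv_schwartz True)
    then have \<eta>: "\<eta> \<in> schwartz" unfolding \<eta>_def by (intro fourier_schwartz) simp
    have pair: "(LINT x|lborel. bessel_flow \<sigma> r h x * \<psi> x) = (LINT x|lborel. h x * \<eta> x)" if "h \<in> Lp p" for h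
      unfolding \<eta>_def by (rule bessel_flow_pairing[OF p \<sigma> that True])
    have "(LINT x|lborel. bessel_flow \<sigma> r (\<lambda>x. f x - g x) x * \<psi> x) =
        (LINT x|lborel. bessel_flow \<sigma> r f x * \<psi> x) - (LINT x|lborel. bessel_flow \<sigma> r g x * \<psi> x)"
      using int[OF f(1) \<eta>] int[OF g(1) \<eta>] by (simp add: pair fg f(1) g(1) left_diff_distrib)
    moreover have "(LINT x|lborel. (bessel_flow \<sigma> r (\<lambda>x. f x - g x) x + (bessel_flow \<sigma> r g x - bessel_flow \<sigma> t g x)) * \<psi> x) =
        (LINT x|lborel. bessel_flow \<sigma> r (\<lambda>x. f x - g x) x * \<psi> x) +
        ((LINT x|lborel. bessel_flow \<sigma> r g x * \<psi> x) - (LINT x|lborel. bessel_flow \<sigma> t g x * \<psi> x))"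
      using int[OF flow[OF fg] True] int[OF flow[OF g(1)] True]
      by (simp add: distrib_right left_diff_distrib)
    moreover have "bessel s (F - G) \<psi> = (LINT x|lborel. bessel_flow \<sigma> r f x * \<psi> x) - (LINT x|lborel. bessel_flow \<sigma> t g x * \<psi> x)"
      using True by (simp add: bessel_diff bessel_flow_eq_td[OF p s f] bessel_flow_eq_td[OF p s g] td_of_def \<sigma>_def)
    ultimately show ?thesis using True by (simp add: td_of_def \<sigma>_def)
  qed (simp add: bessel_def td_multiplier_outside td_of_def)
qed

section \<open>From the space Y to the Bessel potential norm\<close>

lemma Y_p_pull_back:
  assumes "u \<in> Y_p p T"
  shows "pull_back T u \<in> Xspace p (p / (p - 1)) (- (1 - 2 / p)) T"
    and "t \<in> {0..T} \<Longrightarrow> u t \<in> tempered"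
    and "t \<in> {0..T} \<Longrightarrow> pull_back T u t = schrodinger (- t) (u t)"
  using assms by (auto simp: Y_p_def Yspace_def curves_def pull_back_def)

lemma Hsp_norm_eq:
  assumes p: "p \<ge> 2" and s: "s < - (1 - 2 / p)" and f: "f \<in> Lp p" and F: "schrodinger (- t) F = td_of f"
  shows "bessel_flow (- s / 2) t f \<in> Lp p" "Hsp_norm s p F = Lp_norm p (bessel_flow (- s / 2) t f)"
proof -
  have \<sigma>: "- s / 2 > (1 - 2 / p) / 2" using s by simp
  obtain C where "\<And>t' f. \<bar>t'\<bar> \<le> \<bar>t\<bar> \<Longrightarrow> f \<in> Lp p \<Longrightarrow>
      bessel_flow (- s / 2) t' f \<in> Lp p \<and> Lp_norm p (bessel_flow (- s / 2) t' f) \<le> C * Lp_norm p f"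
    using bessel_flow_bounded[OF p \<sigma>, of "\<bar>t\<bar>"] by blast
  then show flow: "bessel_flow (- s / 2) t f \<in> Lp p" using f by blast
  show "Hsp_norm s p F = Lp_norm p (bessel_flow (- s / 2) t f)"
    unfolding Hsp_norm_def bessel_flow_eq_td[OF p s f F] using p by (intro td_Lp_norm_td_of flow) simp
qed

lemma Y_p_continuous_into_Hsp:
  assumes p: "p \<ge> 2" and s: "s < - (1 - 2 / p)" and T: "T > 0" and u: "u \<in> Y_p p T"
  shows "continuous_into_Hsp T s p u"
proof -
  have p1: "p \<ge> 1" using p by simp
  define \<sigma> where "\<sigma> = - s / 2"
  have \<sigma>: "\<sigma> > (1 - 2 / p) / 2" using s by (simp add: \<sigma>_def)
  obtain f where f: "\<And>t. t \<in> {0..T} \<Longrightarrow> f t \<in> Lp p" "\<And>t. t \<in> {0..T} \<Longrightarrow> pull_back T u t = td_of (f t)"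
    and f_cont: "\<And>t. t \<in> {0..T} \<Longrightarrow> ((\<lambda>r. Lp_norm p (\<lambda>x. f r x - f t x)) \<longlongrightarrow> 0) (at t within {0..T})"
    using Xspace_representation[OF p T Y_p_pull_back(1)[OF u]] by metis
  have v: "schrodinger (- t) (u t) = td_of (f t)" if "t \<in> {0..T}" for t
    using f(2)[OF that] Y_p_pull_back(3)[OF u that] by simp
  obtain C where C: "C \<ge> 0" "\<And>t f. \<bar>t\<bar> \<le> T \<Longrightarrow> f \<in> Lp p \<Longrightarrow>
      bessel_flow \<sigma> t f \<in> Lp p \<and> Lp_norm p (bessel_flow \<sigma> t f) \<le> C * Lp_norm p f"
    using bessel_flow_bounded[OF p \<sigma>, of T] by blast
  show ?thesis
    unfolding continuous_into_Hsp_def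
  proof (intro conjI ballI)
    fix t assume t: "t \<in> {0..T}"
    show "u t \<in> Hsp s p"
      using Y_p_pull_back(2)[OF u t] bessel_flow_eq_td[OF p s f(1)[OF t] v[OF t]] Hsp_norm_eq(1)[OF p s f(1)[OF t] v[OF t]]
      by (simp add: Hsp_def td_Lp_def)
    obtain D where D: "(D \<longlongrightarrow> 0) (at t within {0..T})"
      "\<And>r f. r \<in> {0..T} \<Longrightarrow> f \<in> Lp p \<Longrightarrow> Lp_norm p (\<lambda>x. bessel_flow \<sigma> r f x - bessel_flow \<sigma> t f x) \<le> D r * Lp_norm p f"
      using bessel_flow_continuous[OF p \<sigma> t] by blast
    have bound: "Hsp_norm s p (u r - u t) \<le> 2 * (C * Lp_norm p (\<lambda>x. f r x - f t x) + D r * Lp_norm p (f t))" if r: "r \<in> {0..T}" for r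
    proof -
      have d: "(\<lambda>x. f r x - f t x) \<in> Lp p" by (rule Lp_diff[OF p1 f(1)[OF r] f(1)[OF t]])
      have flow: "bessel_flow \<sigma> t' h \<in> Lp p" if "t' \<in> {0..T}" "h \<in> Lp p" for t' h
        using C(2)[of t' h] that by auto
      note parts = flow[OF r d] Lp_diff[OF p1 flow[OF r f(1)[OF t]] flow[OF t f(1)[OF t]]]
      have "Hsp_norm s p (u r - u t) = Lp_norm p (\<lambda>x. bessel_flow \<sigma> r (\<lambda>x. f r x - f t x) x +
          (bessel_flow \<sigma> r (f t) x - bessel_flow \<sigma> t (f t) x))"
        unfolding Hsp_norm_def bessel_difference[OF p s f(1)[OF r] v[OF r] f(1)[OF t] v[OF t]] \<sigma>_def[symmetric]
        by (rule td_Lp_norm_td_of[OF Lp_add(1)[OF p1 parts] p1])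
      also have "\<dots> \<le> 2 * (Lp_norm p (bessel_flow \<sigma> r (\<lambda>x. f r x - f t x)) +
          Lp_norm p (\<lambda>x. bessel_flow \<sigma> r (f t) x - bessel_flow \<sigma> t (f t) x))"
        by (rule Lp_add(2)[OF p1 parts])
      also have "\<dots> \<le> 2 * (C * Lp_norm p (\<lambda>x. f r x - f t x) + D r * Lp_norm p (f t))"
        using C(2)[of r, OF _ d] r D(2)[OF r f(1)[OF t]] by (intro mult_left_mono add_mono) auto
      finally show ?thesis .
    qed
    show "((\<lambda>r. Hsp_norm s p (u r - u t)) \<longlongrightarrow> 0) (at t within {0..T})"
    proof (rule tendsto_sandwich[of "\<lambda>_. 0"])
      show "\<forall>\<^sub>F r in at t within {0..T}. Hsp_norm s p (u r - u t) \<le> 2 * (C * Lp_norm p (\<lambda>x. f r x - f t x) + D r * Lp_norm p (f t))"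
        unfolding eventually_at_filter using bound by (auto intro: always_eventually)
      have "((\<lambda>r. 2 * (C * Lp_norm p (\<lambda>x. f r x - f t x) + D r * Lp_norm p (f t))) \<longlongrightarrow> 2 * (C * 0 + 0 * Lp_norm p (f t))) (at t within {0..T})"
        by (intro tendsto_intros f_cont t D(1))
      then show "((\<lambda>r. 2 * (C * Lp_norm p (\<lambda>x. f r x - f t x) + D r * Lp_norm p (f t))) \<longlongrightarrow> 0) (at t within {0..T})" by simp
    qed (auto simp: Hsp_norm_def td_Lp_norm_def Lp_norm_nonneg)
  qed
qed

text \<open>Both curves are compared at the same time, so the group does not move, and uniform
  boundedness of the flow on [0,T] is enough.\<close>

lemma Y_p_diff_Hsp_bound:
  assumes p: "p \<ge> 2" and s: "s < - (1 - 2 / p)" and T: "T > 0"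
  obtains K where "K \<ge> 0"
    "\<And>u u' t. u \<in> Y_p p T \<Longrightarrow> u' \<in> Y_p p T \<Longrightarrow> t \<in> {0..T} \<Longrightarrow> Hsp_norm s p (u t - u' t) \<le> K * Y_p_norm p T (u - u')"
proof -
  have \<sigma>: "- s / 2 > (1 - 2 / p) / 2" using s by simp
  obtain C where C: "C \<ge> 0" "\<And>t f. \<bar>t\<bar> \<le> T \<Longrightarrow> f \<in> Lp p \<Longrightarrow>
      bessel_flow (- s / 2) t f \<in> Lp p \<and> Lp_norm p (bessel_flow (- s / 2) t f) \<le> C * Lp_norm p f"
    using bessel_flow_bounded[OF p \<sigma>, of T] by blast
  define K where "K = 2 * (1 + T powr (1 - 2 / p) * (1 + T))"
  have K: "K \<ge> 0" using T by (simp add: K_def)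
  show thesis
  proof (rule that[of "C * K"])
    fix u u' t assume u: "u \<in> Y_p p T" "u' \<in> Y_p p T" and t: "t \<in> {0..T}"
    have d: "pull_back T (u - u') = (\<lambda>t. pull_back T u t - pull_back T u' t)"
      by (auto simp: fun_eq_iff pull_back_def schrodinger_diff)
    obtain f where f: "\<And>t. t \<in> {0..T} \<Longrightarrow> f t \<in> Lp p" "\<And>t. t \<in> {0..T} \<Longrightarrow> pull_back T (u - u') t = td_of (f t)"
      "\<And>t. t \<in> {0..T} \<Longrightarrow> Lp_norm p (f t) \<le> K * Xnorm p (p / (p - 1)) (- (1 - 2 / p)) T (pull_back T (u - u'))"
      using Xspace_diff_representation[OF p T Y_p_pull_back(1)[OF u(1)] Y_p_pull_back(1)[OF u(2)] d]
      unfolding K_def by metis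
    have v: "schrodinger (- t) (u t - u' t) = td_of (f t)"
      using f(2)[OF t] t by (simp add: pull_back_def)
    have "Hsp_norm s p (u t - u' t) \<le> C * Lp_norm p (f t)"
      unfolding Hsp_norm_eq(2)[OF p s f(1)[OF t] v] using C(2)[of t, OF _ f(1)[OF t]] t by auto
    also have "\<dots> \<le> C * (K * Y_p_norm p T (u - u'))"
      using f(3)[OF t] C(1) by (intro mult_left_mono) (simp_all add: Y_p_norm_def Ynorm_def)
    finally show "Hsp_norm s p (u t - u' t) \<le> C * K * Y_p_norm p T (u - u')" by (simp add: mult.assoc)
  qed (use C K in simp)
qed

theorem corollary1p5:
  fixes p s M T\<^sub>M :: real
  assumes "2 \<le> p" and "p < 4"
    and "s < - (1 - 2 / p)"
    and "M > 0"
    and "local_existence_time p M T\<^sub>M"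
  shows "(\<forall>\<phi>\<in>Lp_ball p M. continuous_into_Hsp T\<^sub>M s p (solution_map p T\<^sub>M \<phi>)) \<and>
    (\<exists>C\<^sub>M>0. \<forall>\<phi>\<^sub>1\<in>Lp_ball p M. \<forall>\<phi>\<^sub>2\<in>Lp_ball p M.
       (SUP t\<in>{0..T\<^sub>M}. ennreal (Hsp_norm s p (solution_map p T\<^sub>M \<phi>\<^sub>1 t - solution_map p T\<^sub>M \<phi>\<^sub>2 t)))
         \<le> ennreal (C\<^sub>M * Lp_norm p (\<phi>\<^sub>1 - \<phi>\<^sub>2)))"
proof -
  have T: "T\<^sub>M > 0" and ex: "\<And>\<phi>. \<phi> \<in> Lp_ball p M \<Longrightarrow> \<exists>!u. u \<in> Y_p p T\<^sub>M \<and> integral_solution T\<^sub>M \<phi> u"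
    using assms(5) by (auto simp: local_existence_time_def)
  obtain L where L: "\<And>\<phi> \<phi>'. \<phi> \<in> Lp_ball p M \<Longrightarrow> \<phi>' \<in> Lp_ball p M \<Longrightarrow>
      Y_p_norm p T\<^sub>M (solution_map p T\<^sub>M \<phi> - solution_map p T\<^sub>M \<phi>') \<le> L * Lp_norm p (\<phi> - \<phi>')"
    using assms(5) unfolding local_existence_time_def by blast
  have sol: "solution_map p T\<^sub>M \<phi> \<in> Y_p p T\<^sub>M" if "\<phi> \<in> Lp_ball p M" for \<phi>
    unfolding solution_map_def using theI'[OF ex[OF that]] by simp
  obtain K where K: "K \<ge> 0" "\<And>u u' t. u \<in> Y_p p T\<^sub>M \<Longrightarrow> u' \<in> Y_p p T\<^sub>M \<Longrightarrow> t \<in> {0..T\<^sub>M} \<Longrightarrow>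
      Hsp_norm s p (u t - u' t) \<le> K * Y_p_norm p T\<^sub>M (u - u')"
    using Y_p_diff_Hsp_bound[OF assms(1,3) T] by blast
  \<comment> \<open>The Lipschitz constant \<open>L\<close> carries no sign, hence the absolute
    value; adding 1 makes the final constant strictly positive even if \<open>K\<close> or
    \<open>L\<close> is 0.\<close>
  have "(SUP t\<in>{0..T\<^sub>M}. ennreal (Hsp_norm s p (solution_map p T\<^sub>M \<phi> t - solution_map p T\<^sub>M \<phi>' t)))
      \<le> ennreal ((K * \<bar>L\<bar> + 1) * Lp_norm p (\<phi> - \<phi>'))" if \<phi>: "\<phi> \<in> Lp_ball p M" "\<phi>' \<in> Lp_ball p M" for \<phi> \<phi>'
  proof (rule SUP_least, rule ennreal_leI)
    fix t assume t: "t \<in> {0..T\<^sub>M}"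
    let ?n = "Lp_norm p (\<phi> - \<phi>')"
    have "Hsp_norm s p (solution_map p T\<^sub>M \<phi> t - solution_map p T\<^sub>M \<phi>' t) \<le> K * (L * ?n)"
      by (rule order_trans[OF K(2)[OF sol[OF \<phi>(1)] sol[OF \<phi>(2)] t]]) (intro mult_left_mono L \<phi> K)
    also have "\<dots> \<le> K * (\<bar>L\<bar> * ?n)"
      by (intro mult_left_mono mult_right_mono K Lp_norm_nonneg) simp
    also have "\<dots> \<le> (K * \<bar>L\<bar> + 1) * ?n" by (simp add: distrib_right Lp_norm_nonneg)
    finally show "Hsp_norm s p (solution_map p T\<^sub>M \<phi> t - solution_map p T\<^sub>M \<phi>' t) \<le> (K * \<bar>L\<bar> + 1) * ?n" .
  qed
  moreover have "K * \<bar>L\<bar> + 1 > 0" using K(1) by (simp add: add_nonneg_pos)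
  ultimately show ?thesis
    using Y_p_continuous_into_Hsp[OF assms(1,3) T sol] by blast
qed

end
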